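(* Let $n\ge1$ and $\eta(\xi)=|\xi|^2/(1+|\xi|^2)^2$ for $\xi\in\mathbb{R}^n$. Let $s,\varrho\in\mathbb{R}$ with $s+\varrho>0$, let $1\le\alpha\le\infty$, and let either $1\le r<2$ and $\ell>n\left(\frac1r-\frac12\right)$, or $r=2$ and $\ell\ge0$. Then there is a constant $C>0$, independent of $f$ and $t$, such that for every $f\in\dot B^{s+\ell}_{r,\alpha}(\mathbb{R}^n)\cap\dot B^{-\varrho}_{2,\infty}(\mathbb{R}^n)$ and every $t\ge0$, $$\Big\|2^{qs}\big\|\widehat{\dot\Delta_q f}\,e^{-\eta(\xi)t}\big\|_{L^2}\Big\|_{l^\alpha_q}\le C\Big[(1+t)^{-\frac{s+\varrho}{2}}\|f\|_{\dot B^{-\varrho}_{2,\infty}}+(1+t)^{-\frac{\ell}{2}+\frac n2\left(\frac1r-\frac12\right)}\|f\|_{\dot B^{s+\ell}_{r,\alpha}}\Big].$$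
   Context: Notation: $\hat{\cdot}=\mathcal{F}$ is the Fourier transform in $x$, and the inner $L^2$ norm is taken in the frequency variable $\xi\in\mathbb{R}^n$; $\|\cdot\|_{l^\alpha_q}$ is the $l^\alpha$ norm over $q\in\mathbb{Z}$. Littlewood-Paley blocks: fix a smooth $\varphi:\mathbb{R}^n\to[0,1]$ supported in $\{\frac34\le|\xi|\le\frac83\}$ with $\sum_{k\in\mathbb{Z}}\varphi(2^{-k}\xi)=1$ for all $\xi\ne0$; set $\dot\Delta_q f=\mathcal{F}^{-1}(\varphi(2^{-q}\xi)\mathcal{F}f)$ for $q\in\mathbb{Z}$. For $s\in\mathbb{R}$, $1\le p,r\le\infty$, the homogeneous Besov space $\dot B^s_{p,r}$ is the set of $f\in\mathcal{S}'/\mathcal{P}$ (tempered distributions modulo polynomials) with $\|f\|_{\dot B^s_{p,r}}=\big\|2^{qs}\|\dot\Delta_qf\|_{L^p}\big\|_{l^r_q(\mathbb{Z})}<\infty$. *)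

theory Defs
  imports "HOL-Probability.Probability"
begin

subsection \<open>Smooth functions and Schwartz functions\<close>

definition partial_deriv :: "'n \<Rightarrow> (real^'n \<Rightarrow> 'b::real_normed_vector) \<Rightarrow> real^'n \<Rightarrow> 'b"
  where "partial_deriv i f = (\<lambda>x. frechet_derivative f (at x) (axis i 1))"

definition iter_partial :: "'n list \<Rightarrow> (real^'n \<Rightarrow> 'b::real_normed_vector) \<Rightarrow> real^'n \<Rightarrow> 'b"
  where "iter_partial is f = foldr partial_deriv is f"

text \<open>All iterated partial derivatives exist and are (totally) differentiable, in particular
  continuous; this is \<open>C\<^sup>\<infinity>\<close>.\<close>

definition smooth :: "(real^'n \<Rightarrow> 'b::real_normed_vector) \<Rightarrow> bool"
  where "smooth f \<longleftrightarrow> (\<forall>is x. iter_partial is f differentiable (at x))"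

definition schwartz :: "(real^'n \<Rightarrow> complex) \<Rightarrow> bool"
  where "schwartz \<psi> \<longleftrightarrow> smooth \<psi> \<and>
    (\<forall>N is. \<exists>C. \<forall>x. (1 + norm x) ^ N * norm (iter_partial is \<psi> x) \<le> C)"

text \<open>For \<open>N = 0, 1, 2, \<dots>\<close> these increasing seminorms generate the topology of the Schwartz space.
  A derivative is indexed by the list of the coordinates in which one differentiates.\<close>

definition schwartz_seminorm :: "nat \<Rightarrow> (real^'n \<Rightarrow> complex) \<Rightarrow> real"
  where "schwartz_seminorm N \<psi> =
    (\<Sum>is\<in>{is. length is \<le> N}. SUP x. (1 + norm x) ^ N * norm (iter_partial is \<psi> x))"

definition fourier :: "(real^'n \<Rightarrow> complex) \<Rightarrow> real^'n \<Rightarrow> complex"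
  where "fourier \<psi> \<xi> = (LINT x|lborel. cis (- (x \<bullet> \<xi>)) * \<psi> x)"

definition inv_fourier :: "(real^'n \<Rightarrow> complex) \<Rightarrow> real^'n \<Rightarrow> complex"
  where "inv_fourier \<psi> x = (LINT \<xi>|lborel. cis (x \<bullet> \<xi>) * \<psi> \<xi>) /\<^sub>R (2 * pi) ^ CARD('n)"


subsection \<open>Tempered distributions\<close>

text \<open>Distributions are functionals on all functions, of which only the values at Schwartz
  functions matter.\<close>

type_synonym 'n distr = "(real^'n \<Rightarrow> complex) \<Rightarrow> complex"

definition tempered :: "'n::finite distr \<Rightarrow> bool"
  where "tempered u \<longleftrightarrow>
    (\<forall>\<psi> \<theta>. schwartz \<psi> \<longrightarrow> schwartz \<theta> \<longrightarrow> u (\<lambda>x. \<psi> x + \<theta> x) = u \<psi> + u \<theta>) \<and>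
    (\<forall>c \<psi>. schwartz \<psi> \<longrightarrow> u (\<lambda>x. c * \<psi> x) = c * u \<psi>) \<and>
    (\<exists>C N. \<forall>\<psi>. schwartz \<psi> \<longrightarrow> norm (u \<psi>) \<le> C * schwartz_seminorm N \<psi>)"

definition represents :: "(real^'n \<Rightarrow> complex) \<Rightarrow> 'n::finite distr \<Rightarrow> bool"
  where "represents g u \<longleftrightarrow> g \<in> borel_measurable lborel \<and>
    (\<forall>\<psi>. schwartz \<psi> \<longrightarrow> integrable lborel (\<lambda>x. g x * \<psi> x) \<and> u \<psi> = (LINT x|lborel. g x * \<psi> x))"

definition distr_fourier :: "'n::finite distr \<Rightarrow> 'n distr"
  where "distr_fourier u = (\<lambda>\<psi>. u (fourier \<psi>))"

definition distr_inv_fourier :: "'n::finite distr \<Rightarrow> 'n distr"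
  where "distr_inv_fourier u = (\<lambda>\<psi>. u (inv_fourier \<psi>))"

definition distr_mult :: "(real^'n \<Rightarrow> real) \<Rightarrow> 'n::finite distr \<Rightarrow> 'n distr"
  where "distr_mult m u = (\<lambda>\<psi>. u (\<lambda>x. m x *\<^sub>R \<psi> x))"


subsection \<open>Tempered distributions modulo polynomials\<close>

definition poly_rel :: "('n::finite distr \<times> 'n distr) set"
  where "poly_rel = {(u, v). tempered u \<and> tempered v \<and>
    (\<exists>P. polynomial_function P \<and> represents P (\<lambda>\<psi>. u \<psi> - v \<psi>))}"

definition tempered_mod_poly :: "'n::finite distr set set"
  where "tempered_mod_poly = Collect tempered // poly_rel"

lemma real_polynomial_function_growth:
  fixes P :: "real^'n \<Rightarrow> real"
  assumes "real_polynomial_function P"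
  shows "\<exists>C k. \<forall>x. \<bar>P x\<bar> \<le> C * (1 + norm x) ^ k"
  using assms
proof (induction rule: real_polynomial_function.induct)
  case (linear f)
  then obtain K where K: "\<And>x. norm (f x) \<le> norm x * K" "K > 0"
    using bounded_linear.pos_bounded by blast
  have "\<bar>f x\<bar> \<le> K * (1 + norm x) ^ 1" for x
    using K(1)[of x] K(2) by (simp add: algebra_simps)
  then show ?case by blast
next
  case (const c)
  show ?case by (rule exI[of _ "\<bar>c\<bar>"], rule exI[of _ 0]) simp
next
  case (add f g)
  then obtain C k D l where
    f: "\<And>x. \<bar>f x\<bar> \<le> C * (1 + norm x) ^ k" and g: "\<And>x. \<bar>g x\<bar> \<le> D * (1 + norm x) ^ l"
    by blast
  have "\<bar>f x + g x\<bar> \<le> (\<bar>C\<bar> + \<bar>D\<bar>) * (1 + norm x) ^ (k + l)" for x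
  proof -
    have "C * (1 + norm x) ^ k \<le> \<bar>C\<bar> * (1 + norm x) ^ (k + l)"
      by (intro mult_mono power_increasing) auto
    moreover have "D * (1 + norm x) ^ l \<le> \<bar>D\<bar> * (1 + norm x) ^ (k + l)"
      by (intro mult_mono power_increasing) auto
    ultimately show ?thesis
      using f[of x] g[of x] by (simp add: distrib_right)
  qed
  then show ?case by blast
next
  case (mult f g)
  then obtain C k D l where
    f: "\<And>x. \<bar>f x\<bar> \<le> C * (1 + norm x) ^ k" and g: "\<And>x. \<bar>g x\<bar> \<le> D * (1 + norm x) ^ l"
    by blast
  have "\<bar>f x * g x\<bar> \<le> (C * D) * (1 + norm x) ^ (k + l)" for x
  proof -
    have "\<bar>f x * g x\<bar> \<le> (C * (1 + norm x) ^ k) * (D * (1 + norm x) ^ l)"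
      unfolding abs_mult using f[of x] g[of x] by (intro mult_mono) (auto intro: order_trans[OF abs_ge_zero])
    then show ?thesis by (simp add: power_add ac_simps)
  qed
  then show ?case by blast
qed

lemma polynomial_function_growth:
  fixes P :: "real^'n \<Rightarrow> complex"
  assumes "polynomial_function P"
  shows "\<exists>C k. \<forall>x. norm (P x) \<le> C * (1 + norm x) ^ k"
proof -
  have "real_polynomial_function (Re \<circ> P)" "real_polynomial_function (Im \<circ> P)"
    using assms bounded_linear_Re bounded_linear_Im by (auto simp: polynomial_function_def)
  then obtain C k D l where
    f: "\<And>x. \<bar>Re (P x)\<bar> \<le> C * (1 + norm x) ^ k" and
    g: "\<And>x. \<bar>Im (P x)\<bar> \<le> D * (1 + norm x) ^ l"
    using real_polynomial_function_growth[of "Re \<circ> P"] real_polynomial_function_growth[of "Im \<circ> P"]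
    by auto
  have "norm (P x) \<le> (\<bar>C\<bar> + \<bar>D\<bar>) * (1 + norm x) ^ (k + l)" for x
  proof -
    have "C * (1 + norm x) ^ k \<le> \<bar>C\<bar> * (1 + norm x) ^ (k + l)"
      by (intro mult_mono power_increasing) auto
    moreover have "D * (1 + norm x) ^ l \<le> \<bar>D\<bar> * (1 + norm x) ^ (k + l)"
      by (intro mult_mono power_increasing) auto
    ultimately show ?thesis
      using f[of x] g[of x] cmod_le[of "P x"] by (simp add: distrib_right)
  qed
  then show ?thesis by blast
qed

lemma integrable_prod_inverse_1_plus_square:
  "integrable lborel (\<lambda>x::real^'n. \<Prod>b\<in>Basis. inverse (1 + (x \<bullet> b)\<^sup>2))"
proof (rule integrableI_nonneg)
  have fin: "(\<integral>\<^sup>+x. ennreal (inverse (1 + x\<^sup>2)) \<partial>lborel) < \<infinity>"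
    using integrable_inverse_1_plus_square
    by (auto simp: set_integrable_def real_integrable_def einterval_def less_top)
  have "(\<integral>\<^sup>+(x::real^'n). ennreal (\<Prod>b\<in>Basis. inverse (1 + (x \<bullet> b)\<^sup>2)) \<partial>lborel)
      = (\<integral>\<^sup>+(x::real^'n). (\<Prod>b\<in>Basis. ennreal (inverse (1 + (x \<bullet> b)\<^sup>2))) \<partial>lborel)"
    by (simp add: prod_ennreal)
  also have "\<dots> = (\<Prod>b\<in>(Basis::(real^'n) set). \<integral>\<^sup>+x. ennreal (inverse (1 + x\<^sup>2)) \<partial>lborel)"
    by (rule nn_integral_lborel_prod) auto
  also have "\<dots> < \<infinity>"
    using fin by (simp add: power_less_top_ennreal)
  finally show "(\<integral>\<^sup>+(x::real^'n). ennreal (\<Prod>b\<in>Basis. inverse (1 + (x \<bullet> b)\<^sup>2)) \<partial>lborel) < \<infinity>" .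
qed (auto intro!: prod_nonneg AE_I2)

lemma polynomial_schwartz_integrable:
  fixes P \<psi> :: "real^'n \<Rightarrow> complex"
  assumes P: "polynomial_function P" and \<psi>: "schwartz \<psi>"
  shows "integrable lborel (\<lambda>x. P x * \<psi> x)"
proof -
  obtain C k where C: "\<And>x. norm (P x) \<le> C * (1 + norm x) ^ k"
    using polynomial_function_growth[OF P] by blast
  let ?m = "2 * DIM(real^'n)"
  obtain D where "\<And>x. (1 + norm x) ^ (k + ?m) * norm (iter_partial [] \<psi> x) \<le> D"
    using \<psi> unfolding schwartz_def by blast
  then have D: "(1 + norm x) ^ (k + ?m) * norm (\<psi> x) \<le> D" for x
    by (simp add: iter_partial_def)
  have "\<psi> differentiable (at x)" for x
    using \<psi> unfolding schwartz_def smooth_def by (auto simp: iter_partial_def dest: spec[of _ "[]"])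
  then have "continuous_on UNIV \<psi>"
    by (meson continuous_at_imp_continuous_on differentiable_imp_continuous_within)
  moreover have "continuous_on UNIV P"
    using P by (simp add: continuous_on_polymonial_function)
  ultimately have [measurable]: "\<psi> \<in> borel_measurable lborel" "P \<in> borel_measurable lborel"
    by (simp_all add: borel_measurable_continuous_onI)
  show ?thesis
  proof (rule Bochner_Integration.integrable_bound)
    show "integrable lborel (\<lambda>x::real^'n. \<bar>C\<bar> * D * (\<Prod>b\<in>Basis. inverse (1 + (x \<bullet> b)\<^sup>2)))"
      by (intro integrable_mult_right integrable_prod_inverse_1_plus_square)
    have "norm (P x * \<psi> x) \<le> \<bar>C\<bar> * D * (\<Prod>b\<in>Basis. inverse (1 + (x \<bullet> b)\<^sup>2))" for x
    proof -
      have pos: "1 + norm x > 0" by (simp add: add_pos_nonneg)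
      have "norm (P x * \<psi> x) \<le> (\<bar>C\<bar> * (1 + norm x) ^ k) * norm (\<psi> x)"
      proof -
        have "C * (1 + norm x) ^ k \<le> \<bar>C\<bar> * (1 + norm x) ^ k"
          by (intro mult_right_mono) auto
        then show ?thesis
          unfolding norm_mult using C[of x] by (intro mult_right_mono) auto
      qed
      also have "\<dots> = \<bar>C\<bar> * ((1 + norm x) ^ (k + ?m) * norm (\<psi> x)) * inverse ((1 + norm x) ^ ?m)"
        using pos by (simp add: power_add field_simps)
      also have "\<dots> \<le> \<bar>C\<bar> * D * inverse ((1 + norm x) ^ ?m)"
        using D[of x] pos by (intro mult_right_mono mult_left_mono) auto
      also have "inverse ((1 + norm x) ^ ?m) = (\<Prod>b\<in>(Basis::(real^'n) set). inverse ((1 + norm x)\<^sup>2))"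
        by (simp add: power_mult power_inverse)
      also have "\<bar>C\<bar> * D * \<dots> \<le> \<bar>C\<bar> * D * (\<Prod>b\<in>Basis. inverse (1 + (x \<bullet> b)\<^sup>2))"
      proof (intro mult_left_mono prod_mono conjI)
        show "0 \<le> \<bar>C\<bar> * D"
          using D[of x] pos by (intro mult_nonneg_nonneg) (auto intro: order_trans[rotated])
        fix b :: "real^'n" assume "b \<in> Basis"
        then have "\<bar>x \<bullet> b\<bar> \<le> norm x" by (rule Basis_le_norm)
        then have "(x \<bullet> b)\<^sup>2 \<le> (norm x)\<^sup>2" by (metis abs_le_square_iff abs_norm_cancel)
        then have "1 + (x \<bullet> b)\<^sup>2 \<le> (1 + norm x)\<^sup>2" by (simp add: power2_sum add_increasing2)
        then show "inverse ((1 + norm x)\<^sup>2) \<le> inverse (1 + (x \<bullet> b)\<^sup>2)"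
          by (intro le_imp_inverse_le) (auto intro: add_pos_nonneg)
      qed auto
      finally show ?thesis .
    qed
    then show "AE x in lborel. norm (P x * \<psi> x) \<le> norm (\<bar>C\<bar> * D * (\<Prod>b\<in>Basis. inverse (1 + (x \<bullet> b)\<^sup>2)))"
      by (intro AE_I2) (metis abs_ge_self order_trans real_norm_def)
  qed measurable
qed

lemma polynomial_represents_iff:
  assumes "polynomial_function P"
  shows "represents P u \<longleftrightarrow> (\<forall>\<psi>. schwartz \<psi> \<longrightarrow> u \<psi> = (LINT x|lborel. P x * \<psi> x))"
  unfolding represents_def
  using polynomial_schwartz_integrable[OF assms] continuous_on_polymonial_function[OF assms, of UNIV]
  by (auto intro: borel_measurable_continuous_onI)

lemma equiv_poly_rel: "equiv (Collect tempered) (poly_rel :: ('n::finite distr \<times> 'n distr) set)"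
proof (rule equivI)
  show "refl_on (Collect tempered) (poly_rel :: ('n distr \<times> 'n distr) set)"
    by (auto simp: refl_on_def poly_rel_def polynomial_represents_iff intro!: exI[of _ "\<lambda>_. 0"])
  show "(poly_rel :: ('n distr \<times> 'n distr) set) \<subseteq> Collect tempered \<times> Collect tempered"
    by (auto simp: poly_rel_def)
  show "sym (poly_rel :: ('n distr \<times> 'n distr) set)"
  proof (rule symI)
    fix u v :: "'n distr" assume "(u, v) \<in> poly_rel"
    then obtain P where P: "polynomial_function P" "represents P (\<lambda>\<psi>. u \<psi> - v \<psi>)"
      and uv: "tempered u" "tempered v"
      by (auto simp: poly_rel_def)
    have "represents (\<lambda>x. - P x) (\<lambda>\<psi>. v \<psi> - u \<psi>)"
    proof -
      have "v \<psi> - u \<psi> = - (LINT x|lborel. P x * \<psi> x)" if "schwartz \<psi>" for \<psi>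
      proof -
        have "u \<psi> - v \<psi> = (LINT x|lborel. P x * \<psi> x)"
          using P(2) that by (simp add: represents_def)
        then show ?thesis by (metis minus_diff_eq)
      qed
      then show ?thesis
        using P(2) by (auto simp: represents_def)
    qed
    then show "(v, u) \<in> poly_rel"
      using P(1) uv polynomial_function_minus[OF P(1)] by (auto simp: poly_rel_def)
  qed
  show "trans (poly_rel :: ('n distr \<times> 'n distr) set)"
  proof (rule transI)
    fix u v w :: "'n distr" assume "(u, v) \<in> poly_rel" "(v, w) \<in> poly_rel"
    then obtain P Q where
      P: "polynomial_function P" "represents P (\<lambda>\<psi>. u \<psi> - v \<psi>)" and
      Q: "polynomial_function Q" "represents Q (\<lambda>\<psi>. v \<psi> - w \<psi>)" and
      uw: "tempered u" "tempered w"
      by (auto simp: poly_rel_def)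
    have "u \<psi> - w \<psi> = (LINT x|lborel. (P x + Q x) * \<psi> x)" if "schwartz \<psi>" for \<psi>
    proof -
      have "u \<psi> - w \<psi> = (u \<psi> - v \<psi>) + (v \<psi> - w \<psi>)" by simp
      also have "\<dots> = (LINT x|lborel. P x * \<psi> x) + (LINT x|lborel. Q x * \<psi> x)"
        using P(2) Q(2) that by (simp add: represents_def)
      also have "\<dots> = (LINT x|lborel. (P x + Q x) * \<psi> x)"
        using polynomial_schwartz_integrable[OF P(1) that] polynomial_schwartz_integrable[OF Q(1) that]
        by (simp add: distrib_right)
      finally show ?thesis .
    qed
    then have "represents (\<lambda>x. P x + Q x) (\<lambda>\<psi>. u \<psi> - w \<psi>)"
      using P(1) Q(1) by (subst polynomial_represents_iff) auto
    then show "(u, w) \<in> poly_rel"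
      using P(1) Q(1) uw by (auto simp: poly_rel_def)
  qed
qed


subsection \<open>\<open>L\<^sup>p\<close> and \<open>l\<^sup>r\<close> norms with values in \<open>[0, \<infinity>]\<close>\<close>

definition enn_powr :: "ennreal \<Rightarrow> real \<Rightarrow> ennreal"
  where "enn_powr a c = (if a = \<infinity> then \<infinity> else ennreal (enn2real a powr c))"

definition Lp_norm :: "'a measure \<Rightarrow> ennreal \<Rightarrow> ('a \<Rightarrow> ennreal) \<Rightarrow> ennreal"
  where "Lp_norm M p g = (if p = \<infinity> then esssup M g
    else enn_powr (\<integral>\<^sup>+x. enn_powr (g x) (enn2real p) \<partial>M) (1 / enn2real p))"

definition lr_norm :: "ennreal \<Rightarrow> (int \<Rightarrow> ennreal) \<Rightarrow> ennreal"
  where "lr_norm r a = Lp_norm (count_space UNIV) r a"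

text \<open>A function representing a distribution is unique almost everywhere, so the infimum is
  the norm of that function; it is \<open>\<infinity>\<close> if the distribution is not given by a function.\<close>

definition distr_Lp_norm :: "ennreal \<Rightarrow> 'n::finite distr \<Rightarrow> ennreal"
  where "distr_Lp_norm p u = (INF g\<in>{g. represents g u}. Lp_norm lborel p (\<lambda>x. ennreal (norm (g x))))"


subsection \<open>Littlewood-Paley blocks and homogeneous Besov spaces\<close>

definition lp_cutoff :: "(real^'n \<Rightarrow> real) \<Rightarrow> bool"
  where "lp_cutoff \<phi> \<longleftrightarrow> smooth \<phi> \<and> range \<phi> \<subseteq> {0..1} \<and>
    closure {\<xi>. \<phi> \<xi> \<noteq> 0} \<subseteq> {\<xi>. 3/4 \<le> norm \<xi> \<and> norm \<xi> \<le> 8/3} \<and>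
    (\<forall>\<xi>. \<xi> \<noteq> 0 \<longrightarrow> ((\<lambda>k::int. \<phi> (2 powi (- k) *\<^sub>R \<xi>)) has_sum 1) UNIV)"

text \<open>\<open>\<phi>\<close> vanishes near the origin, where the Fourier transform of every polynomial is supported.
  Hence all representatives of a class have the same blocks, and any one of them may be chosen.\<close>

definition lp_block :: "(real^'n \<Rightarrow> real) \<Rightarrow> int \<Rightarrow> 'n::finite distr set \<Rightarrow> 'n distr"
  where "lp_block \<phi> q F =
    distr_inv_fourier (distr_mult (\<lambda>\<xi>. \<phi> (2 powi (- q) *\<^sub>R \<xi>)) (distr_fourier (SOME f. f \<in> F)))"

definition besov_norm ::
    "(real^'n \<Rightarrow> real) \<Rightarrow> real \<Rightarrow> ennreal \<Rightarrow> ennreal \<Rightarrow> 'n::finite distr set \<Rightarrow> ennreal"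
  where "besov_norm \<phi> s p r F =
    lr_norm r (\<lambda>q. ennreal (2 powr (real_of_int q * s)) * distr_Lp_norm p (lp_block \<phi> q F))"

definition besov_space ::
    "(real^'n \<Rightarrow> real) \<Rightarrow> real \<Rightarrow> ennreal \<Rightarrow> ennreal \<Rightarrow> 'n::finite distr set set"
  where "besov_space \<phi> s p r = {F \<in> tempered_mod_poly. besov_norm \<phi> s p r F < \<infinity>}"

definition eta :: "real^'n \<Rightarrow> real"
  where "eta \<xi> = (norm \<xi>)\<^sup>2 / (1 + (norm \<xi>)\<^sup>2)\<^sup>2"

end

theory Submission
  imports Defs
begin

text \<open>
  Let \<open>u\<^sub>q\<close> be a block, \<open>\<phi>\<^sub>q\<close> its cutoff, and \<open>\<kappa>\<^sub>q\<close> the sum of the three neighbouring cutoffs, so that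
  \<open>\<phi>\<^sub>q \<kappa>\<^sub>q = \<phi>\<^sub>q\<close>. If \<open>u\<^sub>q\<close> is represented by a function \<open>g\<close> in \<open>L\<^sup>r\<close>, then the Fourier transform of \<open>u\<^sub>q\<close> is
  \<open>\<kappa>\<^sub>q\<close> times that of \<open>w\<close>, the convolution of \<open>g\<close> with a kernel obtained by dilating a fixed Schwartz
  function. Young's inequality gives \<open>\<parallel>w\<parallel>\<^sub>2 \<le> C 2\<^bsup>qn(1/r-1/2)\<^esup> \<parallel>g\<parallel>\<^sub>r\<close>; with the Plancherel inequality this replaces
  the Hausdorff-Young inequality. On the support of \<open>\<kappa>\<^sub>q\<close> the symbol \<open>\<eta>\<close> is at least \<open>c 4\<^bsup>-|q|\<^esup>\<close>. For \<open>q < 0\<close> the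
  estimate with \<open>r = 2\<close> and the sum of \<open>2\<^bsup>q(s+\<rho>)\<^esup> exp (- c t 4\<^sup>q)\<close> over \<open>q\<close> yield the first term; for \<open>q \<ge> 0\<close> the
  supremum of \<open>2\<^bsup>-q\<beta>\<^esup> exp (- c t 4\<^bsup>-q\<^esup>)\<close> with \<open>\<beta> = l - n(1/r-1/2)\<close> yields the second.
\<close>

subsection \<open>Functions with bounded weighted derivatives\<close>

text \<open>At high frequencies \<open>eta\<close> behaves like |xi|^(-2), so the damping on the
  block \<open>q\<close> fades like 4^(-q), and decay in \<open>t\<close> has to be bought with
  derivatives: of the \<open>l\<close> derivatives in the second norm, n(1/r - 1/2) pay for the
  passage from L^r to L^2, and the remaining ones give the rate. There only a supremum over
  \<open>q\<close> of scalar factors is taken, so the l^alpha summability is inherited from the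
  datum. At low frequencies the datum is controlled merely by a supremum over \<open>q\<close>; the
  l^alpha norm must come from the weight 2^(q(s+rho)), whose sum over q < 0 converges because s +
  rho > 0.

  The norm of a distribution is an infimum over representing functions. An upper bound for the left
  side therefore means exhibiting one L^2 function that represents the damped transform, while on
  the right the estimate must hold for every function representing the block. The blocks on both
  sides come from the same chosen representative of the class, so the estimates are stated for a
  single functional and verified by testing on Schwartz functions.\<close>

lemma one_plus_norm_pos [simp]: "0 < 1 + norm x"
  by (simp add: add_pos_nonneg)

lemma one_plus_norm_neq_0 [simp]: "1 + norm x \<noteq> 0"
  by (metis less_irrefl one_plus_norm_pos)

lemma iter_partial_Nil [simp]: "iter_partial [] f = f"
  by (simp add: iter_partial_def)

lemma iter_partial_snoc [simp]: "iter_partial (js @ [i]) f = iter_partial js (partial_deriv i f)"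
  by (simp add: iter_partial_def)

lemma partial_deriv_eq:
  assumes "(f has_derivative f') (at x)"
  shows "partial_deriv i f x = f' (axis i 1)"
  using frechet_derivative_at[OF assms] by (simp add: partial_deriv_def)

text \<open>Bounding only finitely many derivatives makes closure properties provable by induction on \<open>k\<close>.
  Schwartz functions lie in the classes for all \<open>k\<close> and \<open>a\<close>; the Fourier multipliers of the
  theorem lie in those with \<open>a = 0\<close>.\<close>

primrec symbol_class :: "nat \<Rightarrow> real \<Rightarrow> (real^'n \<Rightarrow> 'b::real_normed_vector) \<Rightarrow> bool" where
  "symbol_class 0 a f \<longleftrightarrow>
     (\<forall>x. f differentiable (at x)) \<and> (\<exists>C. \<forall>x. norm (f x) \<le> C * (1 + norm x) powr a)"
| "symbol_class (Suc k) a f \<longleftrightarrow>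
     (\<forall>x. f differentiable (at x)) \<and> (\<exists>C. \<forall>x. norm (f x) \<le> C * (1 + norm x) powr a) \<and>
     (\<forall>i. symbol_class k a (partial_deriv i f))"

lemma symbol_classD0: "symbol_class k a f \<Longrightarrow> symbol_class 0 a f"
  by (cases k) auto

lemma symbol_class_differentiable: "symbol_class k a f \<Longrightarrow> f differentiable (at x)"
  by (cases k) auto

lemma symbol_class_bound:
  "symbol_class k a f \<Longrightarrow> \<exists>C\<ge>0. \<forall>x. norm (f x) \<le> C * (1 + norm x) powr a"
proof -
  assume "symbol_class k a f"
  then obtain C where C: "\<And>x. norm (f x) \<le> C * (1 + norm x) powr a"
    by (cases k) auto
  have "C \<ge> 0" using C[of 0] norm_ge_zero[of "f 0"] by (simp del: norm_ge_zero)
  then show ?thesis using C by blast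
qed

lemma symbol_class_SucD: "symbol_class (Suc k) a f \<Longrightarrow> symbol_class k a f"
proof (induction k arbitrary: f)
  case 0
  then show ?case by simp
next
  case (Suc k)
  show ?case using Suc.prems Suc.IH by (subst symbol_class.simps(2)) (auto simp del: symbol_class.simps(1))
qed

lemma symbol_class_mono:
  assumes "symbol_class k a f" "a \<le> b"
  shows "symbol_class k b f"
proof -
  have *: "\<exists>C. \<forall>x. norm (g x) \<le> C * (1 + norm x) powr b" if g: "\<exists>C. \<forall>x. norm (g x) \<le> C * (1 + norm x) powr a"
    for g :: "real^'n \<Rightarrow> 'b"
  proof -
    obtain C where C: "\<And>x. norm (g x) \<le> C * (1 + norm x) powr a" using g by blast
    have "C \<ge> 0" using C[of 0] norm_ge_zero[of "g 0"] by (simp del: norm_ge_zero)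
    have "norm (g x) \<le> C * (1 + norm x) powr b" for x
      using C[of x] \<open>C \<ge> 0\<close> \<open>a \<le> b\<close> mult_left_mono[OF powr_mono[of a b "1 + norm x"] \<open>C \<ge> 0\<close>] by auto
    then show ?thesis by blast
  qed
  show ?thesis using assms(1)
    by (induction k arbitrary: f) (auto simp: *)
qed

text \<open>Reverse list induction matches the recursion of \<open>symbol_class\<close>: both peel
  off the derivative that is applied to \<open>f\<close> first.\<close>

lemma symbol_class_iterate:
  assumes "symbol_class k a f" "length js \<le> k"
  shows "symbol_class 0 a (iter_partial js f)"
  using assms
proof (induction js arbitrary: f k rule: rev_induct)
  case Nil
  then show ?case by (auto dest: symbol_classD0)
next
  case (snoc i js)
  then obtain k' where k: "k = Suc k'" by (cases k) auto
  show ?case using snoc.prems unfolding k by (simp del: symbol_class.simps(1)) (rule snoc.IH[of k'], auto)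
qed

text \<open>Bridge from the list-indexed derivatives in the definitions of \<open>smooth\<close> and
  \<open>schwartz\<close> to the recursive classes, on which induction is possible.\<close>

lemma symbol_class_all_iff:
  "(\<forall>k. symbol_class k a f) \<longleftrightarrow>
    smooth f \<and> (\<forall>js. \<exists>C. \<forall>x. norm (iter_partial js f x) \<le> C * (1 + norm x) powr a)"
proof
  assume "\<forall>k. symbol_class k a f"
  then have "symbol_class 0 a (iter_partial js f)" for js
    using symbol_class_iterate[of "length js"] by blast
  then show "smooth f \<and> (\<forall>js. \<exists>C. \<forall>x. norm (iter_partial js f x) \<le> C * (1 + norm x) powr a)"
    unfolding smooth_def by simp
next
  assume *: "smooth f \<and> (\<forall>js. \<exists>C. \<forall>x. norm (iter_partial js f x) \<le> C * (1 + norm x) powr a)"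
  show "\<forall>k. symbol_class k a f"
  proof
    fix k
    have "symbol_class 0 a (iter_partial js f)" for js
      using * unfolding smooth_def by simp
    then show "symbol_class k a f"
    proof (induction k arbitrary: f)
      case 0
      from 0[of "[]"] show ?case by simp
    next
      case (Suc k)
      have "symbol_class k a (partial_deriv i f)" for i
        by (rule Suc.IH) (use Suc.prems[of "_ @ [i]"] in simp)
      then show ?case using Suc.prems[of "[]"] by simp
    qed
  qed
qed

text \<open>The polynomial weight is divided out and becomes the decay exponent
  \<open>- real N\<close>. The closure properties of Schwartz functions are obtained through this
  form.\<close>

lemma schwartz_iff_symbol_class:
  "schwartz \<psi> \<longleftrightarrow> (\<forall>k N. symbol_class k (- real N) \<psi>)"
proof -
  have pos: "1 + norm x > 0" for x :: "real^'n" by (simp add: add_pos_nonneg)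
  have *: "c * (1 + norm x) powr (- real N) = c / (1 + norm x) ^ N" for N c and x :: "real^'n"
    using pos[of x] by (simp add: powr_minus powr_realpow divide_inverse)
  have **: "((1 + norm x) ^ N * y \<le> C) = (y \<le> C * (1 + norm x) powr (- real N))" for y C N and x :: "real^'n"
    unfolding * using pos[of x] by (simp add: pos_le_divide_eq mult.commute)
  have "(\<forall>k N. symbol_class k (- real N) \<psi>) \<longleftrightarrow> (\<forall>N. \<forall>k. symbol_class k (- real N) \<psi>)" by blast
  then show ?thesis
    unfolding symbol_class_all_iff schwartz_def ** by blast
qed

text \<open>Takes an explicit derivative, so that inductions work with closed formulas rather than
  with \<open>frechet_derivative\<close>.\<close>

lemma symbol_class_cong_partial:
  assumes "\<And>x. (f has_derivative f' x) (at x)"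
    and "\<exists>C. \<forall>x. norm (f x) \<le> C * (1 + norm x) powr a"
    and "\<And>i. symbol_class k a (\<lambda>x. f' x (axis i 1))"
  shows "symbol_class (Suc k) a f"
proof -
  have "partial_deriv i f = (\<lambda>x. f' x (axis i 1))" for i
    using partial_deriv_eq[OF assms(1)] by blast
  then show ?thesis using assms by (auto simp: differentiable_def)
qed

lemma differentiable_has_partials:
  assumes "f differentiable (at x)"
  obtains f' where "(f has_derivative f') (at x)" "\<And>i. partial_deriv i f x = f' (axis i 1)"
proof -
  obtain f' where "(f has_derivative f') (at x)"
    using assms unfolding differentiable_def by blast
  then show ?thesis using partial_deriv_eq that by metis
qed

lemma partial_deriv_add:
  assumes "f differentiable (at x)" "g differentiable (at x)"
  shows "partial_deriv i (\<lambda>x. f x + g x) x = partial_deriv i f x + partial_deriv i g x"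
proof -
  obtain f' where f: "(f has_derivative f') (at x)" "\<And>i. partial_deriv i f x = f' (axis i 1)"
    using differentiable_has_partials[OF assms(1)] by metis
  obtain g' where g: "(g has_derivative g') (at x)" "\<And>i. partial_deriv i g x = g' (axis i 1)"
    using differentiable_has_partials[OF assms(2)] by metis
  show ?thesis using partial_deriv_eq[OF has_derivative_add[OF f(1) g(1)]] f(2) g(2) by simp
qed

lemma partial_deriv_bilinear:
  assumes "f differentiable (at x)" "g differentiable (at x)" and p: "bounded_bilinear p"
  shows "partial_deriv i (\<lambda>x. p (f x) (g x)) x = p (f x) (partial_deriv i g x) + p (partial_deriv i f x) (g x)"
proof -
  obtain f' where f: "(f has_derivative f') (at x)" "\<And>i. partial_deriv i f x = f' (axis i 1)"
    using differentiable_has_partials[OF assms(1)] by metis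
  obtain g' where g: "(g has_derivative g') (at x)" "\<And>i. partial_deriv i g x = g' (axis i 1)"
    using differentiable_has_partials[OF assms(2)] by metis
  show ?thesis using partial_deriv_eq[OF bounded_bilinear.FDERIV[OF p f(1) g(1)]] f(2) g(2) by simp
qed

section \<open>Sums, products and linear factors\<close>

lemma symbol_class_add:
  assumes "symbol_class k a f" "symbol_class k a g"
  shows "symbol_class k a (\<lambda>x. f x + g x)"
  using assms
proof (induction k arbitrary: f g)
  have bd: "\<exists>C. \<forall>x. norm (f x + g x) \<le> C * (1 + norm x) powr a"
    if fg: "symbol_class k a f" "symbol_class k a g" for k and f g :: "real^'a \<Rightarrow> 'b"
  proof -
    obtain C D where "\<And>x. norm (f x) \<le> C * (1 + norm x) powr a" "\<And>x. norm (g x) \<le> D * (1 + norm x) powr a"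
      using symbol_class_bound[OF fg(1)] symbol_class_bound[OF fg(2)] by metis
    then have "norm (f x + g x) \<le> (C + D) * (1 + norm x) powr a" for x
      unfolding distrib_right by (meson add_mono norm_triangle_ineq order_trans)
    then show ?thesis by blast
  qed
  {
    case 0
    then show ?case using bd[OF 0] by auto
  next
    case (Suc k)
    note d = symbol_class_differentiable[OF Suc.prems(1)] symbol_class_differentiable[OF Suc.prems(2)]
    have "partial_deriv i (\<lambda>x. f x + g x) = (\<lambda>x. partial_deriv i f x + partial_deriv i g x)" for i
      using partial_deriv_add[OF d] by blast
    then show ?case using Suc bd[OF Suc.prems] by auto
  }
qed

text \<open>Leibniz rule: each term of the derivative pairs one differentiated factor with an
  undifferentiated one, whose order \<open>symbol_class_SucD\<close> lowers to match. A general
  bilinear map serves scalar and complex products at once.\<close>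

lemma symbol_class_bilinear:
  assumes p: "bounded_bilinear p"
    and "symbol_class k a f" "symbol_class k b g"
  shows "symbol_class k (a + b) (\<lambda>x. p (f x) (g x))"
  using assms(2,3)
proof (induction k arbitrary: f g)
  have bd: "\<exists>C. \<forall>x. norm (p (f x) (g x)) \<le> C * (1 + norm x) powr (a + b)"
    if fg: "symbol_class k a f" "symbol_class k b g" for k f g
  proof -
    obtain K where K: "K \<ge> 0" "\<And>u v. norm (p u v) \<le> norm u * norm v * K"
      using bounded_bilinear.nonneg_bounded[OF p] by blast
    obtain C where C: "C \<ge> 0" "\<And>x. norm (f x) \<le> C * (1 + norm x) powr a"
      using symbol_class_bound[OF fg(1)] by blast
    obtain D where D: "D \<ge> 0" "\<And>x. norm (g x) \<le> D * (1 + norm x) powr b"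
      using symbol_class_bound[OF fg(2)] by blast
    have "norm (p (f x) (g x)) \<le> (C * D * K) * (1 + norm x) powr (a + b)" for x
    proof -
      have "norm (p (f x) (g x)) \<le> (C * (1 + norm x) powr a) * (D * (1 + norm x) powr b) * K"
        by (rule order_trans[OF K(2)], intro mult_right_mono mult_mono C D K) (use C(1) in auto)
      then show ?thesis by (simp add: powr_add ac_simps)
    qed
    then show ?thesis by blast
  qed
  have df: "(\<lambda>x. p (f x) (g x)) differentiable (at x)"
    if "symbol_class k a f" "symbol_class k b g" for k f g x
    using symbol_class_differentiable[OF that(1), of x] symbol_class_differentiable[OF that(2), of x]
      bounded_bilinear.FDERIV[OF p] unfolding differentiable_def by blast
  {
    case 0
    then show ?case using bd[OF 0] df[OF 0] by auto
  next
    case (Suc k)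
    note d = symbol_class_differentiable[OF Suc.prems(1)] symbol_class_differentiable[OF Suc.prems(2)]
    have "partial_deriv i (\<lambda>x. p (f x) (g x)) =
        (\<lambda>x. p (f x) (partial_deriv i g x) + p (partial_deriv i f x) (g x))" for i
      using partial_deriv_bilinear[OF d p] by blast
    moreover have "symbol_class k (a + b) (\<lambda>x. p (f x) (partial_deriv i g x) + p (partial_deriv i f x) (g x))" for i
      using Suc.prems(1) Suc.prems(2)
      by (intro symbol_class_add[OF Suc.IH[OF symbol_class_SucD[OF Suc.prems(1)]]
            Suc.IH[OF _ symbol_class_SucD[OF Suc.prems(2)]]]) simp_all
    ultimately show ?case using bd[OF Suc.prems] df[OF Suc.prems] by auto
  }
qed

lemmas symbol_class_scaleR = symbol_class_bilinear[OF bounded_bilinear_scaleR]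
lemmas symbol_class_mult = symbol_class_bilinear[OF bounded_bilinear_mult]

lemma symbol_class_const: "symbol_class k 0 (\<lambda>x. c)"
proof (induction k arbitrary: c)
  case (Suc k)
  show ?case
    by (rule symbol_class_cong_partial[OF has_derivative_const]) (use Suc in auto)
qed auto

lemma symbol_class_linear:
  fixes T :: "real^'n \<Rightarrow> 'b::real_normed_vector"
  assumes "bounded_linear T"
  shows "symbol_class k 1 T"
proof -
  obtain K where K: "\<And>x. norm (T x) \<le> norm x * K" "K > 0"
    using bounded_linear.pos_bounded[OF assms] by blast
  have bd: "\<exists>C. \<forall>x. norm (T x) \<le> C * (1 + norm x) powr 1"
  proof (intro exI allI)
    fix x show "norm (T x) \<le> K * (1 + norm x) powr 1"
      using K(1)[of x] K(2) by (simp add: algebra_simps)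
  qed
  have d: "(T has_derivative T) (at x)" for x
    using assms by (rule bounded_linear_imp_has_derivative)
  show ?thesis
  proof (cases k)
    case 0
    then show ?thesis using bd d by (auto simp: differentiable_def)
  next
    case (Suc k')
    show ?thesis unfolding Suc
      by (rule symbol_class_cong_partial[OF d bd], rule symbol_class_mono[OF symbol_class_const]) simp
  qed
qed

lemma schwartz_mult_bounded_symbol:
  assumes "\<And>k. symbol_class k 0 m" "schwartz \<psi>"
  shows "schwartz (\<lambda>x. m x *\<^sub>R \<psi> x)"
  using assms symbol_class_scaleR[of _ 0 m "- real _" \<psi>]
  unfolding schwartz_iff_symbol_class by force

lemma schwartz_mult_linear:
  assumes "bounded_linear T" "schwartz \<psi>"
  shows "schwartz (\<lambda>x. T x *\<^sub>R \<psi> x)"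
  unfolding schwartz_iff_symbol_class
proof (intro allI)
  fix k N
  \<comment> \<open>One extra power of decay pays for the linear growth of \<open>T\<close>.\<close>
  have "symbol_class k (- real (Suc N)) \<psi>"
    using assms(2) by (simp only: schwartz_iff_symbol_class)
  then have "symbol_class k (1 + - real (Suc N)) (\<lambda>x. T x *\<^sub>R \<psi> x)"
    using assms(1) by (intro symbol_class_scaleR symbol_class_linear)
  then show "symbol_class k (- real N) (\<lambda>x. T x *\<^sub>R \<psi> x)" by simp
qed

lemma schwartz_partial_deriv:
  assumes "schwartz \<psi>"
  shows "schwartz (partial_deriv i \<psi>)"
  unfolding schwartz_iff_symbol_class
proof (intro allI)
  fix k N
  have "symbol_class (Suc k) (- real N) \<psi>"
    using assms by (auto simp: schwartz_iff_symbol_class simp del: symbol_class.simps)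
  then show "symbol_class k (- real N) (partial_deriv i \<psi>)" by simp
qed

lemma schwartz_cmult:
  assumes "schwartz \<psi>"
  shows "schwartz (\<lambda>x. c * \<psi> x)"
  unfolding schwartz_iff_symbol_class
proof (intro allI)
  fix k N
  have "symbol_class k (0 + - real N) (\<lambda>x. c * \<psi> x)"
    using assms by (intro symbol_class_mult symbol_class_const) (auto simp: schwartz_iff_symbol_class)
  then show "symbol_class k (- real N) (\<lambda>x. c * \<psi> x)" by simp
qed

text \<open>With exponent 0 the weight is constant, so the bound survives any dilation; the chain
  rule contributes only the constant factor \<open>c\<close>.\<close>

lemma symbol_class_dilation:
  fixes c :: real
  assumes "symbol_class k 0 f"
  shows "symbol_class k 0 (\<lambda>x. f (c *\<^sub>R x))"
  using assms
proof (induction k arbitrary: f)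
  have d: "((\<lambda>x. f (c *\<^sub>R x)) has_derivative (\<lambda>h. frechet_derivative f (at (c *\<^sub>R x)) (c *\<^sub>R h))) (at x)"
    if "symbol_class k 0 f" for k and f :: "real^'a \<Rightarrow> 'b" and x
  proof -
    have "(f has_derivative frechet_derivative f (at (c *\<^sub>R x))) (at (c *\<^sub>R x))"
      using symbol_class_differentiable[OF that] by (simp add: frechet_derivative_works)
    then show ?thesis
      by (rule has_derivative_compose[rotated]) (auto intro!: derivative_eq_intros)
  qed
  {
    case 0
    then show ?case using d[OF 0] by (auto simp: differentiable_def)
  next
    case (Suc k)
    have "linear (frechet_derivative f (at (c *\<^sub>R x)))" for x
      using symbol_class_differentiable[OF Suc.prems] by (rule linear_frechet_derivative)
    then have eq: "frechet_derivative f (at (c *\<^sub>R x)) (c *\<^sub>R axis i 1) = c *\<^sub>R partial_deriv i f (c *\<^sub>R x)" for i x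
      by (simp add: partial_deriv_def linear_scale)
    show ?case
    proof (rule symbol_class_cong_partial[OF d[OF Suc.prems]])
      show "\<exists>C. \<forall>x. norm (f (c *\<^sub>R x)) \<le> C * (1 + norm x) powr 0"
        using symbol_class_bound[OF Suc.prems] by auto
      have "symbol_class k (0 + 0) (\<lambda>x. c *\<^sub>R partial_deriv i f (c *\<^sub>R x))" for i
        using Suc.prems by (intro symbol_class_scaleR symbol_class_const Suc.IH) auto
      then show "symbol_class k 0 (\<lambda>x. frechet_derivative f (at (c *\<^sub>R x)) (c *\<^sub>R axis i 1))" for i
        unfolding eq by simp
    qed
  }
qed

section \<open>Smooth functions of bounded support\<close>

lemma smooth_differentiable: "smooth f \<Longrightarrow> f differentiable (at x)"
  unfolding smooth_def by (metis iter_partial_Nil)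

lemma smooth_partial_deriv: "smooth f \<Longrightarrow> smooth (partial_deriv i f)"
  unfolding smooth_def by (metis iter_partial_snoc)

lemma partial_deriv_eq_0_outside_support:
  assumes "x \<notin> closure {x. f x \<noteq> 0}"
  shows "partial_deriv i f x = 0"
proof -
  have "((\<lambda>x. 0) has_derivative (\<lambda>h. 0)) (at x)" by simp
  then have "(f has_derivative (\<lambda>h. 0)) (at x)"
  proof (rule has_derivative_transform_within_open[of _ _ _ _ "- closure {x. f x \<noteq> 0}"])
    show "x \<in> - closure {x. f x \<noteq> 0}" using assms by simp
    fix y assume "y \<in> - closure {x. f x \<noteq> 0}"
    then show "0 = f y" using closure_subset[of "{x. f x \<noteq> 0}"] by auto
  qed auto
  then show ?thesis by (rule partial_deriv_eq)
qed

text \<open>The weighted function is continuous on the compact closure of the support, hence bounded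
  for every exponent, negative ones included. Derivatives vanish outside that closure, so the
  induction applies to them.\<close>

lemma smooth_compact_support_symbol_class:
  assumes "smooth f" "bounded {x. f x \<noteq> 0}"
  shows "symbol_class k a f"
  using assms
proof (induction k arbitrary: f)
  have bd: "\<exists>C. \<forall>x. norm (f x) \<le> C * (1 + norm x) powr a"
    if "smooth f" "bounded {x. f x \<noteq> 0}" for f :: "real^'a \<Rightarrow> 'b"
  proof -
    let ?g = "\<lambda>x. (1 + norm x) powr (- a) *\<^sub>R f x"
    have "continuous_on (closure {x. f x \<noteq> 0}) f"
      by (intro continuous_at_imp_continuous_on ballI differentiable_imp_continuous_within
          smooth_differentiable that)
    then have "continuous_on (closure {x. f x \<noteq> 0}) ?g"
      by (intro continuous_intros) auto
    then have "bounded (?g ` closure {x. f x \<noteq> 0})"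
      using that(2) by (intro compact_imp_bounded compact_continuous_image) (simp_all add: compact_closure)
    then obtain C where C: "\<And>x. x \<in> closure {x. f x \<noteq> 0} \<Longrightarrow> norm (?g x) \<le> C"
      unfolding bounded_iff by blast
    have "norm (f x) \<le> \<bar>C\<bar> * (1 + norm x) powr a" for x
    proof (cases "f x = 0")
      case False
      then have "x \<in> closure {x. f x \<noteq> 0}" using closure_subset by fast
      from C[OF this] have "(1 + norm x) powr (- a) * norm (f x) \<le> \<bar>C\<bar>" by simp
      then show ?thesis by (simp add: powr_minus field_simps)
    qed simp
    then show ?thesis by blast
  qed
  {
    case 0
    then show ?case using bd[OF 0] smooth_differentiable by auto
  next
    case (Suc k)
    have "{x. partial_deriv i f x \<noteq> 0} \<subseteq> closure {x. f x \<noteq> 0}" for i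
      using partial_deriv_eq_0_outside_support by blast
    then have "bounded {x. partial_deriv i f x \<noteq> 0}" for i
      using Suc.prems(2) bounded_closure bounded_subset by blast
    then show ?case
      using bd[OF Suc.prems] Suc.IH[OF smooth_partial_deriv[OF Suc.prems(1)]]
        smooth_differentiable[OF Suc.prems(1)] by simp
  }
qed

lemma schwartz_of_smooth_compact_support:
  fixes f :: "real^'n \<Rightarrow> real"
  assumes "smooth f" "bounded {x. f x \<noteq> 0}"
  shows "schwartz (\<lambda>x. of_real (f x))"
  unfolding schwartz_iff_symbol_class
proof (intro allI)
  fix k N
  have "symbol_class k (- real N + 0) (\<lambda>x. f x *\<^sub>R (1::complex))"
    using assms by (intro symbol_class_scaleR smooth_compact_support_symbol_class symbol_class_const)
  then show "symbol_class k (- real N) (\<lambda>x. of_real (f x) :: complex)"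
    by (simp add: scaleR_conv_of_real)
qed

section \<open>The damping factor as a Fourier multiplier\<close>

text \<open>For \<open>v = 1/(1+|x|^2)\<close> the derivative is \<open>-2 (x . h) v^2\<close>,
  again built from \<open>v\<close> and of exponent 1 - 2 - 2 = -3. The induction thus closes
  without formulas for higher derivatives.\<close>

lemma symbol_class_inverse_1_plus_norm_square:
  "symbol_class k (-2) (\<lambda>x::real^'n. inverse (1 + (norm x)\<^sup>2))"
proof -
  let ?v = "\<lambda>x::real^'n. inverse (1 + (norm x)\<^sup>2)"
  have pos: "1 + (norm x)\<^sup>2 > 0" for x :: "real^'n" by (simp add: add_pos_nonneg)
  have D: "(?v has_derivative (\<lambda>h. - (2 * (x \<bullet> h) * (?v x * ?v x)))) (at x)" for x
  proof -
    have "((\<lambda>x. 1 + (norm x)\<^sup>2) has_derivative (\<lambda>h. 2 * (x \<bullet> h))) (at x)"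
      unfolding power2_norm_eq_inner by (auto intro!: derivative_eq_intros simp: inner_commute)
    from Deriv.has_derivative_inverse[OF _ this] show ?thesis
      using pos[of x] by (simp add: ac_simps)
  qed
  have bd: "\<exists>C. \<forall>x. norm (?v x) \<le> C * (1 + norm x) powr (-2)"
  proof (intro exI allI)
    fix x :: "real^'n"
    have p: "1 + norm x > 0" by (simp add: add_pos_nonneg)
    have "(1 + norm x)\<^sup>2 \<le> 2 * (1 + (norm x)\<^sup>2)"
      using sum_squares_bound[of 1 "norm x"] by (simp add: power2_eq_square algebra_simps)
    then have "?v x \<le> 2 * inverse ((1 + norm x)\<^sup>2)"
      using p pos[of x] by (simp add: field_simps)
    then show "norm (?v x) \<le> 2 * (1 + norm x) powr (-2)"
      using p pos[of x] by (simp add: powr_minus powr_numeral)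
  qed
  show ?thesis
  proof (induction k)
    case 0
    show ?case using bd D by (auto simp: differentiable_def)
  next
    case (Suc k)
    show ?case
    proof (rule symbol_class_cong_partial[OF D bd])
      fix i
      have "symbol_class k (0 + (1 + (-2 + -2))) (\<lambda>x::real^'n. (-2) * ((x \<bullet> axis i 1) * (?v x * ?v x)))"
        by (intro symbol_class_mult symbol_class_linear bounded_linear_inner_left Suc symbol_class_const)
      then show "symbol_class k (-2) (\<lambda>x::real^'n. - (2 * (x \<bullet> axis i 1) * (?v x * ?v x)))"
        by (intro symbol_class_mono[of k "0 + (1 + (- 2 + - 2))" _ "- 2"]) (simp_all add: mult.assoc)
    qed
  qed
qed

text \<open>With \<open>v = 1/(1+|x|^2)\<close> one has \<open>eta = v - v^2\<close>, so the closure
  properties apply.\<close>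

lemma symbol_class_eta: "symbol_class k 0 (eta :: real^'n \<Rightarrow> real)"
proof -
  let ?v = "\<lambda>x::real^'n. inverse (1 + (norm x)\<^sup>2)"
  have pos: "1 + (norm x)\<^sup>2 > 0" for x :: "real^'n" by (simp add: add_pos_nonneg)
  have "symbol_class k (0 + (-2 + -2)) (\<lambda>x. (-1) * (?v x * ?v x))"
    by (intro symbol_class_mult symbol_class_const symbol_class_inverse_1_plus_norm_square)
  then have "symbol_class k 0 (\<lambda>x. (-1) * (?v x * ?v x))"
    by (rule symbol_class_mono) simp
  moreover have "symbol_class k 0 ?v"
    by (rule symbol_class_mono[OF symbol_class_inverse_1_plus_norm_square]) simp
  ultimately have "symbol_class k 0 (\<lambda>x. ?v x + (-1) * (?v x * ?v x))"
    by (intro symbol_class_add) auto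
  moreover have "(\<lambda>x. ?v x + (-1) * (?v x * ?v x)) = eta"
  proof
    fix x :: "real^'n"
    define a where "a = 1 + (norm x)\<^sup>2"
    have "a > 0" unfolding a_def by (rule pos)
    then have "inverse a + (-1) * (inverse a * inverse a) = (a - 1) / a\<^sup>2"
      by (simp add: power2_eq_square divide_simps)
    then show "?v x + (-1) * (?v x * ?v x) = eta x"
      by (simp add: a_def eta_def)
  qed
  ultimately show ?thesis by simp
qed

text \<open>The derivative is \<open>exp (- eta x * t)\<close> times a symbol. The bounds may depend
  on \<open>t\<close>: the lemma only certifies that the damping preserves Schwartz functions, while
  the decay enters through \<open>cutoff_neighbours_exp_eta_le\<close>.\<close>

lemma symbol_class_exp_eta:
  assumes "t \<ge> 0"
  shows "symbol_class k 0 (\<lambda>x::real^'n. exp (- eta x * t))"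
proof (induction k)
  have D: "((\<lambda>x::real^'n. exp (- eta x * t)) has_derivative
      (\<lambda>h. (- t) * (frechet_derivative eta (at x) h * exp (- eta x * t)))) (at x)" for x
  proof -
    have *: "(eta has_derivative frechet_derivative eta (at x)) (at x)"
      using symbol_class_differentiable[OF symbol_class_eta, of x] by (simp add: frechet_derivative_works)
    show ?thesis
      using has_derivative_exp[OF has_derivative_mult_left[OF has_derivative_minus[OF *], of t]]
      by (simp add: ac_simps)
  qed
  have bd: "\<exists>C. \<forall>x::real^'n. norm (exp (- eta x * t)) \<le> C * (1 + norm x) powr 0"
  proof (intro exI allI)
    fix x :: "real^'n"
    have "eta x \<ge> 0" by (simp add: eta_def)
    then show "norm (exp (- eta x * t)) \<le> 1 * (1 + norm x) powr 0"
      using assms add_pos_nonneg[of 1 "norm x"] by simp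
  qed
  {
    case 0
    show ?case using bd D by (auto simp: differentiable_def)
  next
    case (Suc k)
    show ?case
    proof (rule symbol_class_cong_partial[OF D bd])
      fix i
      have eq: "frechet_derivative eta (at x) (axis i 1) = partial_deriv i eta x" for x :: "real^'n"
        by (simp add: partial_deriv_def)
      have "symbol_class (Suc k) 0 (eta :: real^'n \<Rightarrow> real)" by (rule symbol_class_eta)
      then have "symbol_class k 0 (partial_deriv i (eta :: real^'n \<Rightarrow> real))" by simp
      then have "symbol_class k (0 + (0 + 0)) (\<lambda>x::real^'n. (- t) * (partial_deriv i eta x * exp (- eta x * t)))"
        by (intro symbol_class_mult symbol_class_const Suc)
      then show "symbol_class k 0 (\<lambda>x::real^'n. (- t) * (frechet_derivative eta (at x) (axis i 1) * exp (- eta x * t)))"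
        unfolding eq by simp
    qed
  }
qed


subsection \<open>The Fourier transform on Schwartz functions\<close>

lemma nn_integral_lborel_affine:
  fixes t :: "'a::euclidean_space"
  assumes [measurable]: "f \<in> borel_measurable borel" and c: "c \<noteq> 0"
  shows "(\<integral>\<^sup>+x. f x \<partial>lborel) = ennreal (\<bar>c\<bar> ^ DIM('a)) * (\<integral>\<^sup>+x. f (t + c *\<^sub>R x) \<partial>lborel)"
  by (subst lborel_affine[OF c, of t])
     (simp add: nn_integral_density nn_integral_distr nn_integral_cmult ennreal_power)

lemma integrable_lborel_affine:
  fixes f :: "'a::euclidean_space \<Rightarrow> 'b::{banach, second_countable_topology}"
  assumes f: "integrable lborel f" and c: "c \<noteq> 0"
  shows "integrable lborel (\<lambda>x. f (t + c *\<^sub>R x))"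
proof -
  have [measurable]: "f \<in> borel_measurable borel" using f by auto
  have "ennreal (\<bar>c\<bar> ^ DIM('a)) * (\<integral>\<^sup>+x. norm (f (t + c *\<^sub>R x)) \<partial>lborel) < \<infinity>"
    using f c unfolding integrable_iff_bounded
    by (subst nn_integral_lborel_affine[OF _ c, of _ t, symmetric]) auto
  moreover have "ennreal (\<bar>c\<bar> ^ DIM('a)) \<noteq> 0" using c by auto
  ultimately have "(\<integral>\<^sup>+x. norm (f (t + c *\<^sub>R x)) \<partial>lborel) < \<infinity>"
    using c by (auto simp: ennreal_mult_less_top)
  then show ?thesis unfolding integrable_iff_bounded by simp
qed

lemma integral_lborel_affine:
  fixes f :: "'a::euclidean_space \<Rightarrow> 'b::{banach, second_countable_topology}"
  assumes f: "integrable lborel f" and c: "c \<noteq> 0"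
  shows "(LINT x|lborel. f x) = \<bar>c\<bar> ^ DIM('a) *\<^sub>R (LINT x|lborel. f (t + c *\<^sub>R x))"
proof -
  have [measurable]: "f \<in> borel_measurable borel" using f by auto
  show ?thesis
    by (subst lborel_affine[OF c, of t]) (simp add: integral_density integral_distr)
qed

text \<open>The exponent \<open>2 * CARD('n)\<close> allots a factor \<open>(1+|x|)^(-2)\<close> to
  each coordinate, where it is at most \<open>1/(1+x_b^2)\<close>.\<close>

lemma integrable_one_plus_norm_powr:
  "integrable lborel (\<lambda>x::real^'n. (1 + norm x) powr (- real (2 * CARD('n))))"
proof (rule Bochner_Integration.integrable_bound[OF integrable_prod_inverse_1_plus_square])
  show "(\<lambda>x::real^'n. (1 + norm x) powr (- real (2 * CARD('n)))) \<in> borel_measurable lborel"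
    by measurable
  show "AE x::real^'n in lborel. norm ((1 + norm x) powr (- real (2 * CARD('n)))) \<le> norm (\<Prod>b\<in>Basis. inverse (1 + (x \<bullet> b)\<^sup>2))"
  proof (rule AE_I2)
    fix x :: "real^'n"
    have "(1 + norm x) powr (- real (2 * CARD('n))) = inverse ((1 + norm x) ^ (2 * CARD('n)))"
      using one_plus_norm_pos[of x] by (simp only: powr_minus powr_realpow)
    also have "\<dots> = (\<Prod>b\<in>(Basis::(real^'n) set). inverse ((1 + norm x)\<^sup>2))"
      by (simp add: power_mult power_inverse)
    also have "\<dots> \<le> (\<Prod>b\<in>Basis. inverse (1 + (x \<bullet> b)\<^sup>2))"
    proof (intro prod_mono conjI)
      fix b :: "real^'n" assume "b \<in> Basis"
      then have "\<bar>x \<bullet> b\<bar> \<le> norm x" by (rule Basis_le_norm)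
      then have "(x \<bullet> b)\<^sup>2 \<le> (norm x)\<^sup>2" by (metis abs_le_square_iff abs_norm_cancel)
      then have "1 + (x \<bullet> b)\<^sup>2 \<le> (1 + norm x)\<^sup>2" by (simp add: power2_sum add_increasing2)
      then show "inverse ((1 + norm x)\<^sup>2) \<le> inverse (1 + (x \<bullet> b)\<^sup>2)"
        by (intro le_imp_inverse_le) (auto intro: add_pos_nonneg)
    qed auto
    finally show "norm ((1 + norm x) powr (- real (2 * CARD('n)))) \<le> norm (\<Prod>b\<in>Basis. inverse (1 + (x \<bullet> b)\<^sup>2))"
      by (simp add: prod_nonneg)
  qed
qed

lemma schwartz_differentiable: "schwartz \<psi> \<Longrightarrow> \<psi> differentiable (at x)"
  by (auto simp: schwartz_def smooth_differentiable)

lemma schwartz_continuous: "schwartz \<psi> \<Longrightarrow> continuous_on A \<psi>"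
  by (meson continuous_at_imp_continuous_on differentiable_imp_continuous_within schwartz_differentiable)

lemma schwartz_measurable: "schwartz \<psi> \<Longrightarrow> \<psi> \<in> borel_measurable borel"
  by (simp add: borel_measurable_continuous_onI schwartz_continuous)

lemma schwartz_bound:
  assumes "schwartz \<psi>"
  shows "\<exists>C\<ge>0. \<forall>x. norm (\<psi> x) \<le> C * (1 + norm x) powr (- real N)"
  using assms symbol_class_bound[of 0 "- real N" \<psi>]
  by (auto simp: schwartz_iff_symbol_class simp del: symbol_class.simps)

lemma schwartz_bounded:
  assumes "schwartz \<psi>"
  shows "\<exists>C\<ge>0. \<forall>x. norm (\<psi> x) \<le> C"
  using schwartz_bound[OF assms, of 0] by simp

lemma schwartz_integrable:
  assumes "schwartz \<psi>"
  shows "integrable lborel \<psi>"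
  using polynomial_schwartz_integrable[of "\<lambda>_. 1" \<psi>] assms by simp

lemma schwartz_norm_power2_integrable:
  assumes "schwartz \<psi>"
  shows "integrable lborel (\<lambda>x. (norm (\<psi> x))\<^sup>2)"
proof -
  obtain C where C: "\<And>x. norm (\<psi> x) \<le> C" using schwartz_bounded[OF assms] by blast
  have [measurable]: "\<psi> \<in> borel_measurable borel" using assms by (rule schwartz_measurable)
  show ?thesis
  proof (rule Bochner_Integration.integrable_bound)
    show "integrable lborel (\<lambda>x. C * norm (\<psi> x))"
      using schwartz_integrable[OF assms] by simp
    show "AE x in lborel. norm ((norm (\<psi> x))\<^sup>2) \<le> norm (C * norm (\<psi> x))"
      using C by (intro AE_I2) (auto simp: power2_eq_square intro!: mult_right_mono order_trans[OF _ abs_ge_self])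
  qed measurable
qed

lemma cis_integrable:
  assumes "integrable lborel f"
  shows "integrable lborel (\<lambda>x::real^'n. cis (c * (x \<bullet> \<xi>)) * f x)"
proof (rule Bochner_Integration.integrable_bound[OF assms])
  have [measurable]: "f \<in> borel_measurable borel" using assms by auto
  have [measurable]: "(\<lambda>x. cis (c * (x \<bullet> \<xi>))) \<in> borel_measurable borel"
    by (intro borel_measurable_continuous_onI continuous_intros)
  show "(\<lambda>x. cis (c * (x \<bullet> \<xi>)) * f x) \<in> borel_measurable lborel" by measurable
qed (simp add: norm_mult)

lemma cis_minus_integrable:
  assumes "integrable lborel f"
  shows "integrable lborel (\<lambda>x::real^'n. cis (- (x \<bullet> \<xi>)) * f x)"
  using cis_integrable[OF assms, of "-1"] by simp

lemma norm_fourier_le: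
  assumes "integrable lborel f"
  shows "norm (fourier f \<xi>) \<le> (LINT x|lborel. norm (f x))"
  unfolding fourier_def
  by (rule order_trans[OF integral_norm_bound]) (simp add: norm_mult)

lemma inv_fourier_eq: "inv_fourier \<psi> x = fourier \<psi> (- x) /\<^sub>R (2 * pi) ^ CARD('n)" for x :: "real^'n"
  by (simp add: inv_fourier_def fourier_def inner_commute)

text \<open>The reflection \<open>y -> -y\<close> exchanges the two transforms, so they commute;
  inversion in one order then yields inversion in the other.\<close>

lemma fourier_inv_fourier:
  fixes f :: "real^'n \<Rightarrow> complex"
  assumes "integrable lborel (fourier f)"
  shows "fourier (inv_fourier f) x = inv_fourier (fourier f) x"
proof -
  have "(LINT y|lborel. cis (x \<bullet> y) * fourier f y) = (LINT y|lborel. cis (- (y \<bullet> x)) * fourier f (- y))"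
    using integral_lborel_affine[OF cis_integrable[OF assms, of 1 x], of "-1" 0]
    by (simp add: inner_commute)
  then show ?thesis
    by (simp add: fourier_def[of "inv_fourier f"] fourier_def[of "fourier f"] inv_fourier_eq inner_commute)
qed

lemma norm_cis_remainder_le: "norm (cis a - 1 - \<i> * a) \<le> a\<^sup>2 / 2"
  using iexp_approx1[of a 1] by (simp add: cis_conv_exp power2_eq_square algebra_simps)

text \<open>Expanding the character to second order avoids any limit under the integral.\<close>

lemma has_derivative_fourier:
  fixes \<psi> :: "real^'n \<Rightarrow> complex"
  assumes \<psi>: "schwartz \<psi>"
  shows "(fourier \<psi> has_derivative (\<lambda>h. LINT x|lborel. cis (- (x \<bullet> \<xi>)) * ((x \<bullet> h) *\<^sub>R (- \<i> * \<psi> x)))) (at \<xi>)"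
proof -
  let ?D = "\<lambda>h. LINT x|lborel. cis (- (x \<bullet> \<xi>)) * ((x \<bullet> h) *\<^sub>R (- \<i> * \<psi> x))"
  have \<psi>': "schwartz (\<lambda>x. - \<i> * \<psi> x)" using schwartz_cmult[OF \<psi>, of "- \<i>"] .
  have int: "integrable lborel (\<lambda>x. cis (- (x \<bullet> \<xi>)) * ((x \<bullet> h) *\<^sub>R (- \<i> * \<psi> x)))" for h
    by (intro cis_minus_integrable schwartz_integrable schwartz_mult_linear \<psi>' bounded_linear_inner_left)
  \<comment> \<open>Two powers of decay absorb \<open>|x|^2\<close> from the remainder; the other
    \<open>2 * CARD('n)\<close> make the majorant integrable.\<close>
  obtain C where C: "C \<ge> 0" "\<And>x. norm (\<psi> x) \<le> C * (1 + norm x) powr (- real (2 * CARD('n) + 2))"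
    using schwartz_bound[OF \<psi>] by blast
  have [measurable]: "\<psi> \<in> borel_measurable borel" using \<psi> by (rule schwartz_measurable)
  have int2: "integrable lborel (\<lambda>x. (norm x)\<^sup>2 * norm (\<psi> x))"
  proof (rule Bochner_Integration.integrable_bound)
    show "integrable lborel (\<lambda>x::real^'n. C * (1 + norm x) powr (- real (2 * CARD('n))))"
      using integrable_one_plus_norm_powr[where 'n='n] by simp
    have "(norm x)\<^sup>2 * norm (\<psi> x) \<le> C * (1 + norm x) powr (- real (2 * CARD('n)))" for x
    proof -
      have "(norm x)\<^sup>2 * norm (\<psi> x) \<le> (1 + norm x)\<^sup>2 * (C * (1 + norm x) powr (- real (2 * CARD('n) + 2)))"
        by (intro mult_mono C power_mono) auto
      also have "\<dots> = C * ((1 + norm x) powr 2 * (1 + norm x) powr (- real (2 * CARD('n) + 2)))"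
        using one_plus_norm_pos[of x] by (simp add: powr_numeral del: one_plus_norm_pos)
      also have "\<dots> = C * (1 + norm x) powr (2 + - real (2 * CARD('n) + 2))"
        by (simp only: powr_add)
      also have "2 + - real (2 * CARD('n) + 2) = - real (2 * CARD('n))" by simp
      finally show ?thesis .
    qed
    then show "AE x in lborel. norm ((norm x)\<^sup>2 * norm (\<psi> x)) \<le> norm (C * (1 + norm x) powr (- real (2 * CARD('n))))"
      using C(1) by (intro AE_I2) simp
  qed measurable
  define K where "K = (LINT x|lborel. (norm x)\<^sup>2 * norm (\<psi> x))"
  have K: "K \<ge> 0" unfolding K_def by simp
  have rem: "norm (fourier \<psi> y - fourier \<psi> \<xi> - ?D (y - \<xi>)) \<le> K * (norm (y - \<xi>))\<^sup>2" for y
  proof -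
    let ?h = "y - \<xi>"
    have "fourier \<psi> y - fourier \<psi> \<xi> - ?D ?h = (LINT x|lborel. cis (- (x \<bullet> y)) * \<psi> x
        - cis (- (x \<bullet> \<xi>)) * \<psi> x - cis (- (x \<bullet> \<xi>)) * ((x \<bullet> ?h) *\<^sub>R (- \<i> * \<psi> x)))"
      unfolding fourier_def
      using cis_minus_integrable[OF schwartz_integrable[OF \<psi>]] int by (simp only: Bochner_Integration.integral_diff Bochner_Integration.integrable_diff)
    also have "norm \<dots> \<le> (LINT x|lborel. (norm ?h)\<^sup>2 * ((norm x)\<^sup>2 * norm (\<psi> x)))"
    proof (rule Bochner_Integration.integral_norm_bound_integral)
      fix x :: "real^'n"
      have "cis (- (x \<bullet> y)) * \<psi> x - cis (- (x \<bullet> \<xi>)) * \<psi> x - cis (- (x \<bullet> \<xi>)) * ((x \<bullet> ?h) *\<^sub>R (- \<i> * \<psi> x))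
        = cis (- (x \<bullet> \<xi>)) * (cis (- (x \<bullet> ?h)) - 1 - \<i> * of_real (- (x \<bullet> ?h))) * \<psi> x"
      proof -
        have "cis (- (x \<bullet> y)) = cis (- (x \<bullet> \<xi>)) * cis (- (x \<bullet> ?h))"
          by (simp add: cis_mult inner_diff_right)
        then show ?thesis by (simp add: scaleR_conv_of_real algebra_simps)
      qed
      also have "norm \<dots> \<le> ((- (x \<bullet> ?h))\<^sup>2 / 2) * norm (\<psi> x)"
        unfolding norm_mult norm_cis using norm_cis_remainder_le[of "- (x \<bullet> ?h)"]
        by (intro mult_right_mono) auto
      also have "\<dots> \<le> (norm x * norm ?h)\<^sup>2 * norm (\<psi> x)"
      proof (intro mult_right_mono)
        have "(x \<bullet> ?h)\<^sup>2 \<le> (norm x * norm ?h)\<^sup>2"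
          using Cauchy_Schwarz_ineq2[of x ?h] by (simp add: abs_le_square_iff[symmetric])
        then show "(- (x \<bullet> ?h))\<^sup>2 / 2 \<le> (norm x * norm ?h)\<^sup>2"
          using zero_le_power2[of "norm x * norm ?h"] unfolding power2_minus by linarith
      qed simp
      finally show "norm (cis (- (x \<bullet> y)) * \<psi> x - cis (- (x \<bullet> \<xi>)) * \<psi> x - cis (- (x \<bullet> \<xi>)) * ((x \<bullet> ?h) *\<^sub>R (- \<i> * \<psi> x)))
          \<le> (norm ?h)\<^sup>2 * ((norm x)\<^sup>2 * norm (\<psi> x))"
        by (simp add: power_mult_distrib ac_simps)
    qed (use int int2 cis_minus_integrable[OF schwartz_integrable[OF \<psi>]] in \<open>auto intro!: Bochner_Integration.integrable_diff\<close>)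
    finally show ?thesis by (simp add: K_def mult.commute)
  qed
  have lin: "bounded_linear ?D"
  proof (rule linear_conv_bounded_linear[THEN iffD1], rule linearI)
    fix h k
    show "?D (h + k) = ?D h + ?D k"
      by (subst Bochner_Integration.integral_add[OF int int, symmetric])
         (simp add: inner_add_right scaleR_add_left distrib_left del: mult_minus_left scaleR_minus_right)
  next
    fix c h
    show "?D (c *\<^sub>R h) = c *\<^sub>R ?D h"
    proof -
      have "cis (- (x \<bullet> \<xi>)) * ((x \<bullet> c *\<^sub>R h) *\<^sub>R (- \<i> * \<psi> x))
          = c *\<^sub>R (cis (- (x \<bullet> \<xi>)) * ((x \<bullet> h) *\<^sub>R (- \<i> * \<psi> x)))" for x
        by simp
      then show ?thesis by (simp only: integral_scaleR_right)
    qed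
  qed
  show ?thesis
    unfolding has_derivative_at_within
  proof (intro conjI lin)
    have "((\<lambda>y. K * norm (y - \<xi>)) \<longlongrightarrow> K * norm (\<xi> - \<xi>)) (at \<xi>)" by (intro tendsto_intros)
    then have l: "((\<lambda>y. K * norm (y - \<xi>)) \<longlongrightarrow> 0) (at \<xi>)" by simp
    show "((\<lambda>y. ((fourier \<psi> y - fourier \<psi> \<xi>) - ?D (y - \<xi>)) /\<^sub>R norm (y - \<xi>)) \<longlongrightarrow> 0) (at \<xi>)"
    proof (rule Lim_null_comparison[OF _ l], rule eventually_at_filter[THEN iffD2], rule always_eventually, intro allI impI)
      fix y assume "y \<noteq> \<xi>"
      then have "norm (y - \<xi>) > 0" by simp
      moreover have "norm (v /\<^sub>R h) \<le> B" if "norm v \<le> B * h" "h > 0" for v :: complex and B h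
        using that by (simp add: field_simps)
      ultimately show "norm (((fourier \<psi> y - fourier \<psi> \<xi>) - ?D (y - \<xi>)) /\<^sub>R norm (y - \<xi>)) \<le> K * norm (y - \<xi>)"
        using rem[of y] unfolding power2_eq_square mult.assoc[symmetric] by blast
    qed
  qed
qed

section \<open>Exchange of derivatives and coordinate factors; invariance of the Schwartz
  space\<close>

lemma partial_deriv_fourier:
  fixes \<psi> :: "real^'n \<Rightarrow> complex"
  assumes "schwartz \<psi>"
  shows "partial_deriv i (fourier \<psi>) = fourier (\<lambda>x. (x \<bullet> axis i 1) *\<^sub>R (- \<i> * \<psi> x))"
  using partial_deriv_eq[OF has_derivative_fourier[OF assms]] by (auto simp: fourier_def)

text \<open>Mean value inequality along a coordinate direction: a bound for one partial derivative
  on one segment suffices. It supplies the majorant for difference quotients.\<close>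

lemma norm_difference_le_partial_deriv:
  fixes f :: "real^'n \<Rightarrow> complex"
  assumes f: "\<And>x. f differentiable (at x)"
    and B: "\<And>s. 0 \<le> s \<Longrightarrow> s \<le> h \<Longrightarrow> norm (partial_deriv i f (x + s *\<^sub>R axis i 1)) \<le> B"
    and h: "h \<ge> 0"
  shows "norm (f (x + h *\<^sub>R axis i 1) - f x) \<le> B * h"
proof -
  have D: "((\<lambda>s. f (x + s *\<^sub>R axis i 1)) has_derivative (\<lambda>k. k *\<^sub>R partial_deriv i f (x + s *\<^sub>R axis i 1))) (at s within {0..h})" for s
  proof -
    let ?y = "x + s *\<^sub>R axis i 1"
    have 1: "(f has_derivative frechet_derivative f (at ?y)) (at ?y)"
      using f by (simp add: frechet_derivative_works)
    have 2: "((\<lambda>s. x + s *\<^sub>R axis i 1) has_derivative (\<lambda>k. k *\<^sub>R axis i 1)) (at s within {0..h})"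
      by (auto intro!: derivative_eq_intros)
    have "linear (frechet_derivative f (at ?y))" using f by (rule linear_frechet_derivative)
    then show ?thesis
      using has_derivative_compose[OF 2 1] by (simp add: partial_deriv_def linear_scale)
  qed
  have "norm (f (x + h *\<^sub>R axis i 1) - f (x + 0 *\<^sub>R axis i 1)) \<le> B * norm (h - 0)"
  proof (rule differentiable_bound[OF convex_closed_interval D])
    fix s assume "s \<in> {0..h}"
    then have "norm (partial_deriv i f (x + s *\<^sub>R axis i 1)) \<le> B" using B by auto
    then show "onorm (\<lambda>k. k *\<^sub>R partial_deriv i f (x + s *\<^sub>R axis i 1)) \<le> B"
      by (simp add: onorm_scaleR_left onorm_id)
  qed (use h in auto)
  then show ?thesis using h by simp
qed

text \<open>Translation invariance makes every difference quotient integrate to 0, and dominated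
  convergence carries this over to the derivative.\<close>

lemma integral_partial_deriv_schwartz:
  fixes \<psi> :: "real^'n \<Rightarrow> complex"
  assumes \<psi>: "schwartz \<psi>"
  shows "(LINT x|lborel. partial_deriv i \<psi> x) = 0"
proof -
  let ?e = "axis i 1 :: real^'n"
  let ?h = "\<lambda>m. inverse (real (Suc m))"
  let ?N = "2 * CARD('n)"
  let ?q = "\<lambda>m x. (\<psi> (x + ?h m *\<^sub>R ?e) - \<psi> x) /\<^sub>R ?h m"
  have [measurable]: "\<psi> \<in> borel_measurable borel" "partial_deriv i \<psi> \<in> borel_measurable borel"
    using \<psi> by (auto intro: schwartz_measurable schwartz_partial_deriv)
  obtain C where C: "C \<ge> 0" "\<And>x. norm (partial_deriv i \<psi> x) \<le> C * (1 + norm x) powr (- real ?N)"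
    using schwartz_bound[OF schwartz_partial_deriv[OF \<psi>]] by blast
  \<comment> \<open>The increments are at most 1, so \<open>1 + |x|\<close> changes by a factor of
    at most 2 along the segment; this is the origin of \<open>2 powr ?N\<close>.\<close>
  have bd: "norm (?q m x) \<le> C * 2 powr (real ?N) * (1 + norm x) powr (- real ?N)" for m x
  proof -
    let ?B = "C * 2 powr (real ?N) * (1 + norm x) powr (- real ?N)"
    have "norm (\<psi> (x + ?h m *\<^sub>R ?e) - \<psi> x) \<le> ?B * ?h m"
    proof (rule norm_difference_le_partial_deriv[OF schwartz_differentiable[OF \<psi>]])
      fix s assume s: "0 \<le> s" "s \<le> ?h m"
      have "?h m \<le> 1" by (simp add: field_simps)
      then have "norm (s *\<^sub>R ?e) \<le> 1" using s by simp
      moreover define b where "b = norm (x + s *\<^sub>R ?e)"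
      ultimately have "norm x \<le> b + 1"
        using norm_triangle_ineq4[of "x + s *\<^sub>R ?e" "s *\<^sub>R ?e"] by simp
      moreover have "0 \<le> b" unfolding b_def by simp
      ultimately have "1 + norm x \<le> 2 * (1 + b)" by simp
      then have "1 + norm x \<le> 2 * (1 + norm (x + s *\<^sub>R ?e))" unfolding b_def .
      then have "(2 * (1 + norm (x + s *\<^sub>R ?e))) powr (- real ?N) \<le> (1 + norm x) powr (- real ?N)"
        by (intro powr_mono2') auto
      then have "(1 + norm (x + s *\<^sub>R ?e)) powr (- real ?N) \<le> 2 powr real ?N * (1 + norm x) powr (- real ?N)"
      proof -
        have "(2 * (1 + norm (x + s *\<^sub>R ?e))) powr (- real ?N)
            = inverse (2 powr real ?N) * (1 + norm (x + s *\<^sub>R ?e)) powr (- real ?N)"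
          by (subst powr_mult) (simp_all only: powr_minus one_plus_norm_pos less_imp_le zero_le_numeral)
        moreover note \<open>(2 * (1 + norm (x + s *\<^sub>R ?e))) powr (- real ?N) \<le> (1 + norm x) powr (- real ?N)\<close>
        moreover have "2 powr real ?N > 0" by simp
        moreover have "u \<le> K * v" if "inverse K * u \<le> v" "K > 0" for u v K :: real
          using that by (simp add: field_simps)
        ultimately show ?thesis by simp
      qed
      then have "C * (1 + norm (x + s *\<^sub>R ?e)) powr (- real ?N) \<le> ?B"
        using C(1) by (simp add: mult.assoc mult_left_mono)
      then show "norm (partial_deriv i \<psi> (x + s *\<^sub>R ?e)) \<le> ?B"
        using C(2) order_trans by blast
    qed simp
    moreover have "norm (v /\<^sub>R h) \<le> B" if "norm v \<le> B * h" "h > 0" for v :: complex and B h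
      using that by (simp add: field_simps)
    ultimately show ?thesis by fastforce
  qed
  have lim: "(\<lambda>m. ?q m x) \<longlonglongrightarrow> partial_deriv i \<psi> x" for x
  proof -
    have 1: "(\<psi> has_derivative frechet_derivative \<psi> (at x)) (at x)"
      using schwartz_differentiable[OF \<psi>] by (simp add: frechet_derivative_works)
    have 2: "((\<lambda>s. x + s *\<^sub>R ?e) has_derivative (\<lambda>k. k *\<^sub>R ?e)) (at 0)"
      by (auto intro!: derivative_eq_intros)
    have l: "linear (frechet_derivative \<psi> (at x))" using schwartz_differentiable[OF \<psi>] by (rule linear_frechet_derivative)
    have "((\<lambda>s. \<psi> (x + s *\<^sub>R ?e)) has_derivative (\<lambda>k. k *\<^sub>R partial_deriv i \<psi> x)) (at 0)"
      using has_derivative_compose[OF 2, of \<psi> "frechet_derivative \<psi> (at x)"] 1 l by (simp add: partial_deriv_def linear_scale)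
    then have "((\<lambda>s. norm (\<psi> (x + s *\<^sub>R ?e) - \<psi> x - s *\<^sub>R partial_deriv i \<psi> x) / \<bar>s\<bar>) \<longlongrightarrow> 0) (at 0)"
      by (simp add: has_derivative_iff_norm)
    moreover have "norm (w - s *\<^sub>R v) / \<bar>s\<bar> = norm (w /\<^sub>R s - v)" if "s \<noteq> 0" for s and w v :: complex
    proof -
      have "w /\<^sub>R s - v = (w - s *\<^sub>R v) /\<^sub>R s" using that by (simp add: scaleR_diff_right)
      then show ?thesis by (simp add: divide_inverse mult.commute)
    qed
    ultimately have "((\<lambda>s. norm ((\<psi> (x + s *\<^sub>R ?e) - \<psi> x) /\<^sub>R s - partial_deriv i \<psi> x)) \<longlongrightarrow> 0) (at 0)"
      by (rule_tac Lim_transform_eventually) (auto simp: eventually_at_filter)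
    then have t: "((\<lambda>s. (\<psi> (x + s *\<^sub>R ?e) - \<psi> x) /\<^sub>R s) \<longlongrightarrow> partial_deriv i \<psi> x) (at 0)"
      by (simp add: tendsto_norm_zero_iff LIM_zero_iff)
    have "filterlim (\<lambda>m. ?h m) (at 0) sequentially"
      unfolding filterlim_at using LIMSEQ_inverse_real_of_nat by auto
    from filterlim_compose[OF t this] show ?thesis .
  qed
  have "(\<lambda>m. LINT x|lborel. ?q m x) \<longlonglongrightarrow> (LINT x|lborel. partial_deriv i \<psi> x)"
  proof (rule integral_dominated_convergence)
    show "integrable lborel (\<lambda>x::real^'n. C * 2 powr (real ?N) * (1 + norm x) powr (- real ?N))"
      using integrable_one_plus_norm_powr[where 'n='n] by simp
  qed (use lim bd in auto)
  moreover have "(LINT x|lborel. ?q m x) = 0" for m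
  proof -
    have i: "integrable lborel \<psi>" using \<psi> by (rule schwartz_integrable)
    have "integrable lborel (\<lambda>x. \<psi> (x + ?h m *\<^sub>R ?e))"
      using integrable_lborel_affine[OF i, of 1 "?h m *\<^sub>R ?e"] by (simp add: add.commute)
    moreover have "(LINT x|lborel. \<psi> (x + ?h m *\<^sub>R ?e)) = (LINT x|lborel. \<psi> x)"
      using integral_lborel_affine[OF i, of 1 "?h m *\<^sub>R ?e"] by (simp add: add.commute)
    ultimately show ?thesis using i by simp
  qed
  ultimately have "(\<lambda>m. 0) \<longlonglongrightarrow> (LINT x|lborel. partial_deriv i \<psi> x)" by simp
  then show ?thesis by (rule LIMSEQ_unique[OF _ tendsto_const])
qed

lemma has_derivative_cis_inner:
  "((\<lambda>x::real^'n. cis (- (x \<bullet> \<xi>))) has_derivative (\<lambda>h. (- \<i>) * (of_real (h \<bullet> \<xi>) * cis (- (x \<bullet> \<xi>))))) (at x)"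
proof -
  have "((\<lambda>x. exp (- \<i> * of_real (x \<bullet> \<xi>))) has_derivative (\<lambda>h. (- \<i> * of_real (h \<bullet> \<xi>)) * exp (- \<i> * of_real (x \<bullet> \<xi>)))) (at x)"
  proof -
    have "((\<lambda>x. - \<i> * of_real (x \<bullet> \<xi>)) has_derivative (\<lambda>h. - \<i> * of_real (h \<bullet> \<xi>))) (at x)"
      by (auto intro!: derivative_eq_intros)
    from has_derivative_compose[OF this DERIV_exp[unfolded has_field_derivative_def]]
    show ?thesis by (simp add: ac_simps)
  qed
  then show ?thesis by (simp add: cis_conv_exp ac_simps)
qed

lemma symbol_class_cis_inner: "symbol_class k 0 (\<lambda>x::real^'n. cis (- (x \<bullet> \<xi>)))"
proof (induction k)
  case 0
  have "(\<lambda>x::real^'n. cis (- (x \<bullet> \<xi>))) differentiable (at x)" for x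
    unfolding differentiable_def using has_derivative_cis_inner by blast
  then show ?case by (auto intro!: exI[of _ 1])
next
  case (Suc k)
  show ?case
  proof (rule symbol_class_cong_partial[OF has_derivative_cis_inner])
    show "\<exists>C. \<forall>x::real^'n. norm (cis (- (x \<bullet> \<xi>))) \<le> C * (1 + norm x) powr 0"
      by (auto intro!: exI[of _ 1])
    have "symbol_class k (0 + (0 + 0)) (\<lambda>x::real^'n. (- \<i>) * (of_real (axis i 1 \<bullet> \<xi>) * cis (- (x \<bullet> \<xi>))))" for i
      by (intro symbol_class_mult symbol_class_const Suc)
    then show "symbol_class k 0 (\<lambda>x::real^'n. (- \<i>) * (of_real (axis i 1 \<bullet> \<xi>) * cis (- (x \<bullet> \<xi>))))" for i
      by simp
  qed
qed

text \<open>Integration by parts: the integral of the derivative of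
  \<open>cis (- (x \<bullet> \<xi>)) * \<psi> x\<close>, itself a Schwartz function, is 0.\<close>

lemma fourier_partial_deriv:
  fixes \<psi> :: "real^'n \<Rightarrow> complex"
  assumes \<psi>: "schwartz \<psi>"
  shows "fourier (partial_deriv i \<psi>) \<xi> = \<i> * of_real (\<xi> $ i) * fourier \<psi> \<xi>"
proof -
  have s: "schwartz (\<lambda>x. cis (- (x \<bullet> \<xi>)) * \<psi> x)"
    unfolding schwartz_iff_symbol_class
  proof (intro allI)
    fix k N
    have "symbol_class k (- real N) \<psi>" using \<psi> by (simp only: schwartz_iff_symbol_class)
    then have "symbol_class k (0 + (- real N)) (\<lambda>x. cis (- (x \<bullet> \<xi>)) * \<psi> x)"
      by (intro symbol_class_mult symbol_class_cis_inner)
    then show "symbol_class k (- real N) (\<lambda>x. cis (- (x \<bullet> \<xi>)) * \<psi> x)" by simp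
  qed
  have "partial_deriv i (\<lambda>x. cis (- (x \<bullet> \<xi>)) * \<psi> x) x =
      cis (- (x \<bullet> \<xi>)) * partial_deriv i \<psi> x - \<i> * of_real (\<xi> $ i) * (cis (- (x \<bullet> \<xi>)) * \<psi> x)" for x
    using partial_deriv_bilinear[OF _ schwartz_differentiable[OF \<psi>] bounded_bilinear_mult, of "\<lambda>x. cis (- (x \<bullet> \<xi>))" x i]
      partial_deriv_eq[OF has_derivative_cis_inner[of \<xi> x], of i] has_derivative_cis_inner[of \<xi> x]
    by (auto simp: differentiable_def inner_axis' algebra_simps)
  then have "(LINT x|lborel. cis (- (x \<bullet> \<xi>)) * partial_deriv i \<psi> x - \<i> * of_real (\<xi> $ i) * (cis (- (x \<bullet> \<xi>)) * \<psi> x)) = 0"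
    using integral_partial_deriv_schwartz[OF s, of i] by simp
  then show ?thesis
    using cis_minus_integrable[OF schwartz_integrable[OF \<psi>], of \<xi>]
      cis_minus_integrable[OF schwartz_integrable[OF schwartz_partial_deriv[OF \<psi>]], of \<xi> i]
    unfolding fourier_def by simp
qed

text \<open>Each power of \<open>1 + |\<xi>|\<close> costs one derivative of \<open>\<psi>\<close>:
  \<open>|\<xi>|\<close> is at most the sum of the coordinates in absolute value, and multiplication
  by a coordinate becomes a partial derivative.\<close>

lemma fourier_decay:
  fixes \<psi> :: "real^'n \<Rightarrow> complex"
  assumes "schwartz \<psi>"
  shows "\<exists>C. \<forall>\<xi>. (1 + norm \<xi>) ^ N * norm (fourier \<psi> \<xi>) \<le> C"
  using assms
proof (induction N arbitrary: \<psi>)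
  case 0
  then show ?case using norm_fourier_le[OF schwartz_integrable] by auto
next
  case (Suc N)
  obtain C where C: "\<And>\<xi>. (1 + norm \<xi>) ^ N * norm (fourier \<psi> \<xi>) \<le> C"
    using Suc.IH[OF Suc.prems] by blast
  have "\<forall>i. \<exists>C. \<forall>\<xi>. (1 + norm \<xi>) ^ N * norm (fourier (partial_deriv i \<psi>) \<xi>) \<le> C"
    using Suc.IH[OF schwartz_partial_deriv[OF Suc.prems]] by blast
  then obtain D where D: "\<And>i \<xi>. (1 + norm \<xi>) ^ N * norm (fourier (partial_deriv i \<psi>) \<xi>) \<le> D i"
    by metis
  have "(1 + norm \<xi>) ^ Suc N * norm (fourier \<psi> \<xi>) \<le> C + sum D UNIV" for \<xi>
  proof -
    have "norm \<xi> \<le> (\<Sum>i\<in>UNIV. \<bar>\<xi> $ i\<bar>)" by (rule norm_le_l1_cart)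
    then have "norm \<xi> * norm (fourier \<psi> \<xi>) \<le> (\<Sum>i\<in>UNIV. \<bar>\<xi> $ i\<bar>) * norm (fourier \<psi> \<xi>)"
      by (rule mult_right_mono) simp
    also have "\<dots> = (\<Sum>i\<in>UNIV. norm (fourier (partial_deriv i \<psi>) \<xi>))"
      by (simp add: fourier_partial_deriv[OF Suc.prems] norm_mult sum_distrib_right)
    finally have *: "norm \<xi> * norm (fourier \<psi> \<xi>) \<le> (\<Sum>i\<in>UNIV. norm (fourier (partial_deriv i \<psi>) \<xi>))" .
    have "(1 + norm \<xi>) ^ Suc N * norm (fourier \<psi> \<xi>)
        = (1 + norm \<xi>) ^ N * norm (fourier \<psi> \<xi>) + (1 + norm \<xi>) ^ N * (norm \<xi> * norm (fourier \<psi> \<xi>))"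
      by (simp add: algebra_simps)
    also have "\<dots> \<le> C + (1 + norm \<xi>) ^ N * (\<Sum>i\<in>UNIV. norm (fourier (partial_deriv i \<psi>) \<xi>))"
      by (intro add_mono C mult_left_mono *) simp
    also have "\<dots> \<le> C + sum D UNIV"
      unfolding sum_distrib_left by (intro add_left_mono sum_mono D)
    finally show ?thesis .
  qed
  then show ?case by blast
qed

text \<open>A derivative of the transform is the transform of a coordinate multiple of
  \<open>\<psi>\<close>, again Schwartz. Induction over all \<open>\<psi>\<close> at once therefore
  reduces every order to \<open>fourier_decay\<close>.\<close>

lemma schwartz_fourier:
  fixes \<psi> :: "real^'n \<Rightarrow> complex"
  assumes "schwartz \<psi>"
  shows "schwartz (fourier \<psi>)"
  unfolding schwartz_iff_symbol_class
proof (intro allI)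
  fix k N
  show "symbol_class k (- real N) (fourier \<psi>)"
    using assms
  proof (induction k arbitrary: \<psi>)
    have bd: "\<exists>C. \<forall>\<xi>. norm (fourier \<psi> \<xi>) \<le> C * (1 + norm \<xi>) powr (- real N)" if \<psi>: "schwartz \<psi>" for \<psi> :: "real^'n \<Rightarrow> complex"
    proof -
      obtain C where C: "\<And>\<xi>. (1 + norm \<xi>) ^ N * norm (fourier \<psi> \<xi>) \<le> C"
        using fourier_decay[OF \<psi>] by blast
      have "norm (fourier \<psi> \<xi>) \<le> C * (1 + norm \<xi>) powr (- real N)" for \<xi>
        using C[of \<xi>] one_plus_norm_pos[of \<xi>] by (simp add: powr_minus powr_realpow field_simps del: one_plus_norm_pos)
      then show ?thesis by blast
    qed
    have df: "fourier \<psi> differentiable (at \<xi>)" if \<psi>: "schwartz \<psi>" for \<psi> :: "real^'n \<Rightarrow> complex" and \<xi>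
      using has_derivative_fourier[OF \<psi>] by (auto simp: differentiable_def)
    {
      case 0
      then show ?case using bd df by simp
    next
      case (Suc k)
      have "schwartz (\<lambda>x. (x \<bullet> axis i 1) *\<^sub>R (- \<i> * \<psi> x))" for i
        using schwartz_cmult[OF Suc.prems] by (intro schwartz_mult_linear bounded_linear_inner_left)
      then have "symbol_class k (- real N) (partial_deriv i (fourier \<psi>))" for i
        unfolding partial_deriv_fourier[OF Suc.prems] by (rule Suc.IH)
      then show ?case using bd[OF Suc.prems] df[OF Suc.prems] by simp
    }
  qed
qed


subsection \<open>Fourier inversion and the Plancherel inequality\<close>

abbreviation sq_integral :: "'a measure \<Rightarrow> ('a \<Rightarrow> complex) \<Rightarrow> ennreal"
  where "sq_integral M f \<equiv> \<integral>\<^sup>+x. ennreal ((norm (f x))\<^sup>2) \<partial>M"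

lemma borel_measurable_cis [measurable]: "cis \<in> borel_measurable borel"
  by (intro borel_measurable_continuous_onI continuous_intros)

lemma borel_measurable_cnj [measurable]: "cnj \<in> borel_measurable borel"
  by (intro borel_measurable_continuous_onI continuous_intros)

text \<open>Fubini for tensor products, read off from the description of \<open>lborel\<close> as an
  image of the product measure; it reduces the Gaussian integrals to one dimension.\<close>

lemma
  fixes f :: "'a::euclidean_space \<Rightarrow> real \<Rightarrow> 'b::{real_normed_field, banach, second_countable_topology}"
  assumes f: "\<And>b. b \<in> Basis \<Longrightarrow> integrable lborel (f b)"
  shows integrable_lborel_prod: "integrable lborel (\<lambda>x::'a. \<Prod>b\<in>Basis. f b (x \<bullet> b))"
    and integral_lborel_prod: "(LINT x::'a|lborel. (\<Prod>b\<in>Basis. f b (x \<bullet> b))) = (\<Prod>b\<in>Basis. LINT x|lborel. f b x)"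
proof -
  interpret P: product_sigma_finite "\<lambda>_::'a. lborel :: real measure" ..
  let ?T = "\<lambda>g::'a \<Rightarrow> real. \<Sum>b\<in>Basis. g b *\<^sub>R b"
  have [measurable]: "f b \<in> borel_measurable borel" if "b \<in> Basis" for b
    using f[OF that] by auto
  have T: "?T \<in> (\<Pi>\<^sub>M b\<in>Basis. lborel) \<rightarrow>\<^sub>M borel" by measurable
  have m: "(\<lambda>x::'a. \<Prod>b\<in>Basis. f b (x \<bullet> b)) \<in> borel_measurable borel"
    by (intro borel_measurable_prod) measurable
  have eq: "(\<Prod>b\<in>Basis. f b (?T g \<bullet> b)) = (\<Prod>b\<in>Basis. f b (g b))" for g
    by (intro prod.cong) simp_all
  show "integrable lborel (\<lambda>x::'a. \<Prod>b\<in>Basis. f b (x \<bullet> b))"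
    by (subst lborel_eq) (simp add: integrable_distr_eq[OF T m] eq P.product_integrable_prod f)
  show "(LINT x::'a|lborel. (\<Prod>b\<in>Basis. f b (x \<bullet> b))) = (\<Prod>b\<in>Basis. LINT x|lborel. f b x)"
    by (subst lborel_eq) (simp add: integral_distr[OF T m] eq P.product_integral_prod f)
qed

text \<open>Scaled so that it is an eigenfunction of the Fourier transform, with eigenvalue and
  total mass both \<open>sqrt (2 * pi) ^ CARD('n)\<close>.\<close>

definition gaussian :: "real^'n \<Rightarrow> real"
  where "gaussian x = exp (- (norm x)\<^sup>2 / 2)"

lemma gaussian_bounds: "0 < gaussian x" "gaussian x \<le> 1"
  by (auto simp: gaussian_def)

lemma gaussian_nonneg [simp]: "0 \<le> gaussian x"
  by (simp add: gaussian_def)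

lemma borel_measurable_gaussian [measurable]: "gaussian \<in> borel_measurable borel"
  unfolding gaussian_def[abs_def] by measurable

text \<open>This is the characteristic function of the standard normal distribution, freed from the
  density's factor \<open>1 / sqrt (2 * pi)\<close>.\<close>

lemma gaussian_real_fourier:
  fixes t :: real
  shows "integrable lborel (\<lambda>x. cis (t * x) * of_real (exp (- x\<^sup>2 / 2)))"
    and "(LINT x|lborel. cis (t * x) * of_real (exp (- x\<^sup>2 / 2))) = of_real (sqrt (2 * pi) * exp (- t\<^sup>2 / 2))"
proof -
  have "integrable lborel std_normal_density" by (rule integrable_normal_density) simp
  then have "integrable lborel (\<lambda>x. sqrt (2 * pi) * std_normal_density x)" by simp
  then have i: "integrable lborel (\<lambda>x. exp (- x\<^sup>2 / 2) :: real)"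
    by (simp add: std_normal_density_def)
  show "integrable lborel (\<lambda>x. cis (t * x) * of_real (exp (- x\<^sup>2 / 2)))"
    by (rule Bochner_Integration.integrable_bound[OF i]) (auto simp: norm_mult)
  have "of_real (exp (- t\<^sup>2 / 2)) = char std_normal_distribution t"
    by (simp add: char_std_normal_distribution)
  also have "\<dots> = (LINT x|lborel. std_normal_density x *\<^sub>R iexp (t * x))"
    unfolding char_def by (rule integral_density) auto
  also have "\<dots> = (LINT x|lborel. inverse (of_real (sqrt (2 * pi))) * (cis (t * x) * of_real (exp (- x\<^sup>2 / 2))))"
    by (intro Bochner_Integration.integral_cong refl)
       (simp only: std_normal_density_def cis_conv_exp scaleR_conv_of_real of_real_mult of_real_divide
         of_real_1 of_real_inverse divide_inverse mult_1 ac_simps)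
  also have "\<dots> = inverse (of_real (sqrt (2 * pi))) * (LINT x|lborel. cis (t * x) * of_real (exp (- x\<^sup>2 / 2)))"
    by (rule integral_mult_right_zero)
  finally show "(LINT x|lborel. cis (t * x) * of_real (exp (- x\<^sup>2 / 2))) = of_real (sqrt (2 * pi) * exp (- t\<^sup>2 / 2))"
    by (simp add: field_simps)
qed

lemma cis_sum: "finite A \<Longrightarrow> cis (sum f A) = (\<Prod>a\<in>A. cis (f a))"
  by (induction A rule: finite_induct) (auto simp: cis_mult[symmetric])

lemma gaussian_prod: "gaussian (x :: real^'n) = (\<Prod>b\<in>Basis. exp (- (x \<bullet> b)\<^sup>2 / 2))"
  unfolding gaussian_def power2_norm_eq_inner
  unfolding euclidean_inner[of x x]
  by (simp add: exp_sum[OF finite_Basis, symmetric] power2_eq_square sum_negf sum_divide_distrib)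

lemma gaussian_fourier:
  fixes x :: "real^'n"
  shows "integrable lborel (\<lambda>z. cis (x \<bullet> z) * of_real (gaussian z))"
    and "(LINT z|lborel. cis (x \<bullet> z) * of_real (gaussian z)) = of_real (sqrt (2 * pi) ^ CARD('n) * gaussian x)"
proof -
  have eq: "cis (x \<bullet> z) * of_real (gaussian z) = (\<Prod>b\<in>Basis. cis ((x \<bullet> b) * (z \<bullet> b)) * of_real (exp (- (z \<bullet> b)\<^sup>2 / 2)))" for z :: "real^'n"
    unfolding prod.distrib gaussian_prod of_real_prod cis_sum[OF finite_Basis, symmetric] euclidean_inner[of x z] ..
  show "integrable lborel (\<lambda>z. cis (x \<bullet> z) * of_real (gaussian z))"
    unfolding eq by (rule integrable_lborel_prod) (rule gaussian_real_fourier)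
  show "(LINT z|lborel. cis (x \<bullet> z) * of_real (gaussian z)) = of_real (sqrt (2 * pi) ^ CARD('n) * gaussian x)"
    unfolding eq
    by (subst integral_lborel_prod[OF gaussian_real_fourier(1)])
       (simp_all only: gaussian_real_fourier(2) prod.distrib of_real_mult gaussian_prod of_real_prod prod_constant DIM_cart DIM_real mult_1_right of_real_power)
qed

lemma integrable_gaussian: "integrable lborel (gaussian :: real^'n \<Rightarrow> real)"
  using gaussian_fourier(1)[of "0 :: real^'n"] by (simp add: complex_of_real_integrable_eq)

lemma nn_integral_gaussian:
  "(\<integral>\<^sup>+z. ennreal (gaussian (z :: real^'n)) \<partial>lborel) = ennreal (sqrt (2 * pi) ^ CARD('n))"
proof -
  have "complex_of_real (LINT z|lborel. gaussian (z :: real^'n)) = of_real (sqrt (2 * pi) ^ CARD('n))"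
    using gaussian_fourier(2)[of "0 :: real^'n"] by (simp add: gaussian_def)
  then have "(LINT z|lborel. gaussian (z :: real^'n)) = sqrt (2 * pi) ^ CARD('n)"
    unfolding of_real_eq_iff .
  then show ?thesis
    by (subst nn_integral_eq_integral[OF integrable_gaussian]) simp_all
qed

text \<open>Tonelli for a majorant that is a product of functions of one variable each; it justifies
  Fubini for the Fourier kernels, whose characters have modulus 1.\<close>

lemma integrable_pair_bound:
  fixes F :: "'a::euclidean_space \<Rightarrow> 'b::euclidean_space \<Rightarrow> 'c::{banach, second_countable_topology}"
    and u :: "'a \<Rightarrow> real" and v :: "'b \<Rightarrow> real"
  assumes [measurable]: "case_prod F \<in> borel_measurable (lborel \<Otimes>\<^sub>M lborel)"
    and u: "integrable lborel u" and v: "integrable lborel v"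
    and le: "\<And>x y. norm (F x y) \<le> u x * v y"
  shows "integrable (lborel \<Otimes>\<^sub>M lborel) (case_prod F)"
proof -
  have [measurable]: "u \<in> borel_measurable borel" "v \<in> borel_measurable borel" using u v by auto
  have "(\<integral>\<^sup>+p. norm (case_prod F p) \<partial>(lborel \<Otimes>\<^sub>M lborel)) \<le> (\<integral>\<^sup>+(x, y). ennreal (norm (u x)) * ennreal (norm (v y)) \<partial>(lborel \<Otimes>\<^sub>M lborel))"
    using le by (intro nn_integral_mono)
      (auto simp: ennreal_mult[symmetric] abs_mult[symmetric] intro!: ennreal_leI order_trans[OF _ abs_ge_self])
  also have "\<dots> = (\<integral>\<^sup>+x. \<integral>\<^sup>+y. ennreal (norm (u x)) * ennreal (norm (v y)) \<partial>lborel \<partial>lborel)"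
    by (subst lborel.nn_integral_fst[symmetric]) (simp_all add: case_prod_unfold)
  also have "\<dots> = (\<integral>\<^sup>+x. ennreal (norm (u x)) \<partial>lborel) * (\<integral>\<^sup>+y. ennreal (norm (v y)) \<partial>lborel)"
    by (simp add: nn_integral_cmult nn_integral_multc)
  also have "\<dots> < \<infinity>"
    using u v by (simp add: integrable_iff_bounded ennreal_mult_less_top)
  finally show ?thesis unfolding integrable_iff_bounded by simp
qed

lemma borel_measurable_fourier:
  assumes "integrable lborel f"
  shows "fourier f \<in> borel_measurable borel"
proof -
  have [measurable]: "f \<in> borel_measurable borel" using assms by auto
  have "(\<lambda>\<xi>. LINT x|lborel. cis (- (x \<bullet> \<xi>)) * f x) \<in> borel_measurable borel"
    by (rule lborel.borel_measurable_lebesgue_integral) measurable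
  then show ?thesis by (simp add: fourier_def[abs_def])
qed

text \<open>Fubini for the kernel \<open>cis (- (x \<bullet> \<xi>))\<close>, which is symmetric in
  its two variables.\<close>

lemma multiplication_formula:
  fixes f g :: "real^'n \<Rightarrow> complex"
  assumes f: "integrable lborel f" and g: "integrable lborel g"
  shows "(LINT x|lborel. f x * fourier g x) = (LINT \<xi>|lborel. fourier f \<xi> * g \<xi>)"
proof -
  have [measurable]: "f \<in> borel_measurable borel" "g \<in> borel_measurable borel" using f g by auto
  have "integrable (lborel \<Otimes>\<^sub>M lborel) (\<lambda>(x, \<xi>). cis (- (x \<bullet> \<xi>)) * (f x * g \<xi>))"
    by (rule integrable_pair_bound[OF _ integrable_norm[OF f] integrable_norm[OF g]]) (simp_all add: norm_mult)
  from lborel_pair.Fubini_integral[OF this]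
  have "(LINT \<xi>|lborel. LINT x|lborel. cis (- (x \<bullet> \<xi>)) * (f x * g \<xi>)) = (LINT x|lborel. LINT \<xi>|lborel. cis (- (x \<bullet> \<xi>)) * (f x * g \<xi>))" .
  moreover have "(LINT x|lborel. cis (- (x \<bullet> \<xi>)) * (f x * g \<xi>)) = fourier f \<xi> * g \<xi>" for \<xi>
    unfolding fourier_def by (subst integral_mult_left_zero[symmetric]) (simp add: mult.assoc)
  moreover have "(LINT \<xi>|lborel. cis (- (x \<bullet> \<xi>)) * (f x * g \<xi>)) = f x * fourier g x" for x
    unfolding fourier_def by (subst integral_mult_right_zero[symmetric]) (simp add: inner_commute ac_simps)
  ultimately show ?thesis by simp
qed

lemma gaussian_dilation_integrable:
  assumes "\<epsilon> > 0"
  shows "integrable lborel (\<lambda>\<xi>::real^'n. gaussian (\<epsilon> *\<^sub>R \<xi>))"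
  using integrable_lborel_affine[OF integrable_gaussian, of \<epsilon> 0] assms by simp

text \<open>The Gaussian factor makes the inversion integral absolutely convergent for every
  integrable \<open>f\<close>. After Fubini the inner integral is again a Gaussian, of width
  \<open>\<epsilon>\<close> around \<open>x\<close>, so the right side averages \<open>f\<close>
  near \<open>x\<close>.\<close>

lemma gaussian_regularisation:
  fixes f :: "real^'n \<Rightarrow> complex"
  assumes f: "integrable lborel f" and \<epsilon>: "\<epsilon> > 0"
  shows "(LINT \<xi>|lborel. cis (x \<bullet> \<xi>) * fourier f \<xi> * of_real (gaussian (\<epsilon> *\<^sub>R \<xi>))) =
    of_real (sqrt (2 * pi) ^ CARD('n)) * (LINT z|lborel. f (x - \<epsilon> *\<^sub>R z) * of_real (gaussian z))"
proof -
  have [measurable]: "f \<in> borel_measurable borel" using f by auto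
  let ?K = "sqrt (2 * pi) ^ CARD('n)"
  let ?F = "\<lambda>\<xi> y. f y * (cis ((x - y) \<bullet> \<xi>) * of_real (gaussian (\<epsilon> *\<^sub>R \<xi>)))"
  have "integrable (lborel \<Otimes>\<^sub>M lborel) (\<lambda>(\<xi>, y). ?F \<xi> y)"
    by (rule integrable_pair_bound[OF _ gaussian_dilation_integrable[OF \<epsilon>] integrable_norm[OF f]])
       (simp_all add: norm_mult)
  from lborel_pair.Fubini_integral[OF this]
  have fub: "(LINT y|lborel. LINT \<xi>|lborel. ?F \<xi> y) = (LINT \<xi>|lborel. LINT y|lborel. ?F \<xi> y)" .
  have F1: "(LINT y|lborel. ?F \<xi> y) = cis (x \<bullet> \<xi>) * fourier f \<xi> * of_real (gaussian (\<epsilon> *\<^sub>R \<xi>))" for \<xi>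
  proof -
    have "?F \<xi> y = (cis (x \<bullet> \<xi>) * of_real (gaussian (\<epsilon> *\<^sub>R \<xi>))) * (cis (- (y \<bullet> \<xi>)) * f y)" for y
    proof -
      have "cis ((x - y) \<bullet> \<xi>) = cis (x \<bullet> \<xi>) * cis (- (y \<bullet> \<xi>))"
        by (simp add: cis_mult inner_diff_left)
      then show ?thesis by simp
    qed
    then have "(LINT y|lborel. ?F \<xi> y) = (cis (x \<bullet> \<xi>) * of_real (gaussian (\<epsilon> *\<^sub>R \<xi>))) * fourier f \<xi>"
      unfolding fourier_def by (simp only: integral_mult_right_zero)
    then show ?thesis by (simp add: ac_simps)
  qed
  \<comment> \<open>The substitution \<open>z = \<epsilon> \<xi>\<close> reduces this to the
    transform of the unscaled Gaussian.\<close>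
  have F2: "(LINT \<xi>|lborel. ?F \<xi> y) = f y * of_real (?K * inverse (\<epsilon> ^ CARD('n)) * gaussian ((x - y) /\<^sub>R \<epsilon>))" for y
  proof -
    have "(LINT z|lborel. cis (((x - y) /\<^sub>R \<epsilon>) \<bullet> z) * of_real (gaussian z)) =
        \<epsilon> ^ CARD('n) *\<^sub>R (LINT \<xi>|lborel. cis ((x - y) \<bullet> \<xi>) * of_real (gaussian (\<epsilon> *\<^sub>R \<xi>)))"
    proof -
      have e: "(v /\<^sub>R \<epsilon>) \<bullet> (0 + \<epsilon> *\<^sub>R \<xi>) = v \<bullet> \<xi>" for v \<xi> :: "real^'n" using \<epsilon> by simp
      show ?thesis
        using integral_lborel_affine[OF gaussian_fourier(1), of \<epsilon> "(x - y) /\<^sub>R \<epsilon>" 0] \<epsilon>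
        unfolding e by simp
    qed
    then have "of_real (?K * gaussian ((x - y) /\<^sub>R \<epsilon>)) =
        \<epsilon> ^ CARD('n) *\<^sub>R (LINT \<xi>|lborel. cis ((x - y) \<bullet> \<xi>) * of_real (gaussian (\<epsilon> *\<^sub>R \<xi>)))"
      unfolding gaussian_fourier(2) .
    then have "(LINT \<xi>|lborel. cis ((x - y) \<bullet> \<xi>) * of_real (gaussian (\<epsilon> *\<^sub>R \<xi>))) =
        of_real (?K * inverse (\<epsilon> ^ CARD('n)) * gaussian ((x - y) /\<^sub>R \<epsilon>))"
      using \<epsilon> by (simp add: scaleR_conv_of_real field_simps)
    then show ?thesis by (simp only: integral_mult_right_zero)
  qed
  have 1: "(LINT \<xi>|lborel. cis (x \<bullet> \<xi>) * fourier f \<xi> * of_real (gaussian (\<epsilon> *\<^sub>R \<xi>))) =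
      (LINT y|lborel. f y * of_real (?K * inverse (\<epsilon> ^ CARD('n)) * gaussian ((x - y) /\<^sub>R \<epsilon>)))"
    using fub unfolding F1 F2 by (rule sym)
  have "integrable lborel (\<lambda>y. f y * of_real (?K * inverse (\<epsilon> ^ CARD('n)) * gaussian ((x - y) /\<^sub>R \<epsilon>)))"
  proof (rule Bochner_Integration.integrable_bound)
    show "integrable lborel (\<lambda>y. ?K * inverse (\<epsilon> ^ CARD('n)) * norm (f y))" using f by simp
    show "AE y in lborel. norm (f y * of_real (?K * inverse (\<epsilon> ^ CARD('n)) * gaussian ((x - y) /\<^sub>R \<epsilon>)))
        \<le> norm (?K * inverse (\<epsilon> ^ CARD('n)) * norm (f y))"
    proof (rule AE_I2)
      fix y
      let ?c = "?K * inverse (\<epsilon> ^ CARD('n))"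
      have c: "?c \<ge> 0" using \<epsilon> by simp
      have "norm (f y * of_real (?c * gaussian ((x - y) /\<^sub>R \<epsilon>))) = ?c * norm (f y) * gaussian ((x - y) /\<^sub>R \<epsilon>)"
      proof -
        have "norm (w * of_real (c * g)) = c * norm w * g" if "c \<ge> 0" "g \<ge> 0" for w :: complex and c g
          using that by (simp add: norm_mult)
        then show ?thesis using c gaussian_nonneg by blast
      qed
      also have "\<dots> \<le> ?c * norm (f y)"
        using c gaussian_bounds(2) by (intro mult_left_le) auto
      finally show "norm (f y * of_real (?c * gaussian ((x - y) /\<^sub>R \<epsilon>))) \<le> norm (?c * norm (f y))"
        by (rule order_trans) (simp only: real_norm_def abs_ge_self)
    qed
  qed measurable
  \<comment> \<open>The substitution \<open>y = x - \<epsilon> z\<close>; its Jacobian cancels the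
    factor \<open>inverse (\<epsilon> ^ CARD('n))\<close>.\<close>
  from integral_lborel_affine[OF this, of "- \<epsilon>" x] \<epsilon>
  have "(LINT y|lborel. f y * of_real (?K * inverse (\<epsilon> ^ CARD('n)) * gaussian ((x - y) /\<^sub>R \<epsilon>))) =
      \<epsilon> ^ CARD('n) *\<^sub>R (LINT z|lborel. f (x - \<epsilon> *\<^sub>R z) * of_real (?K * inverse (\<epsilon> ^ CARD('n)) * gaussian z))"
    by simp
  also have "\<dots> = \<epsilon> ^ CARD('n) *\<^sub>R (LINT z|lborel. of_real (?K * inverse (\<epsilon> ^ CARD('n))) * (f (x - \<epsilon> *\<^sub>R z) * of_real (gaussian z)))"
    by (simp add: ac_simps)
  also have "\<dots> = of_real ?K * (LINT z|lborel. f (x - \<epsilon> *\<^sub>R z) * of_real (gaussian z))"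
    using \<epsilon> by (subst integral_mult_right_zero) (simp add: scaleR_conv_of_real)
  finally show ?thesis using 1 by simp
qed

lemma gaussian_dilation_tendsto: "(\<lambda>m. gaussian (inverse (real (Suc m)) *\<^sub>R \<xi>)) \<longlonglongrightarrow> 1"
proof -
  have "(\<lambda>m. exp (- (norm (inverse (real (Suc m)) *\<^sub>R \<xi>))\<^sup>2 / 2)) \<longlonglongrightarrow> exp (- (norm (0 *\<^sub>R \<xi>))\<^sup>2 / 2)"
    by (intro tendsto_intros LIMSEQ_inverse_real_of_nat) simp
  then show ?thesis by (simp add: gaussian_def)
qed

text \<open>Both sides of \<open>gaussian_regularisation\<close> converge as
  \<open>\<epsilon>\<close> tends to 0: the left is dominated by the integrable transform, the right
  by \<open>B * gaussian\<close> with pointwise limit given by the continuity of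
  \<open>f\<close>.\<close>

theorem fourier_inversion:
  fixes f :: "real^'n \<Rightarrow> complex"
  assumes f: "integrable lborel f" "continuous_on UNIV f" "\<And>x. norm (f x) \<le> B"
    and ff: "integrable lborel (fourier f)"
  shows "inv_fourier (fourier f) x = f x"
proof -
  let ?K = "sqrt (2 * pi) ^ CARD('n)"
  let ?\<epsilon> = "\<lambda>m. inverse (real (Suc m))"
  have [measurable]: "f \<in> borel_measurable borel" using f(1) by auto
  have [measurable]: "fourier f \<in> borel_measurable borel" using ff by auto
  have "(\<lambda>m. LINT \<xi>|lborel. cis (x \<bullet> \<xi>) * fourier f \<xi> * of_real (gaussian (?\<epsilon> m *\<^sub>R \<xi>)))
      \<longlonglongrightarrow> (LINT \<xi>|lborel. cis (x \<bullet> \<xi>) * fourier f \<xi>)"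
  proof (rule integral_dominated_convergence[OF _ _ integrable_norm[OF ff]])
    show "AE \<xi> in lborel. (\<lambda>m. cis (x \<bullet> \<xi>) * fourier f \<xi> * of_real (gaussian (?\<epsilon> m *\<^sub>R \<xi>))) \<longlonglongrightarrow> cis (x \<bullet> \<xi>) * fourier f \<xi>"
    proof (rule AE_I2)
      fix \<xi>
      have "(\<lambda>m. cis (x \<bullet> \<xi>) * fourier f \<xi> * of_real (gaussian (?\<epsilon> m *\<^sub>R \<xi>))) \<longlonglongrightarrow> cis (x \<bullet> \<xi>) * fourier f \<xi> * of_real 1"
        by (intro tendsto_mult tendsto_const tendsto_of_real gaussian_dilation_tendsto)
      then show "(\<lambda>m. cis (x \<bullet> \<xi>) * fourier f \<xi> * of_real (gaussian (?\<epsilon> m *\<^sub>R \<xi>))) \<longlonglongrightarrow> cis (x \<bullet> \<xi>) * fourier f \<xi>"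
        by simp
    qed
    show "AE \<xi> in lborel. norm (cis (x \<bullet> \<xi>) * fourier f \<xi> * of_real (gaussian (?\<epsilon> m *\<^sub>R \<xi>))) \<le> norm (fourier f \<xi>)" for m
      by (intro AE_I2) (simp add: norm_mult mult_left_le gaussian_bounds less_imp_le)
  qed measurable
  moreover have "(\<lambda>m. LINT z|lborel. f (x - ?\<epsilon> m *\<^sub>R z) * of_real (gaussian z))
      \<longlonglongrightarrow> (LINT z|lborel. f x * of_real (gaussian (z :: real^'n)))"
  proof (rule integral_dominated_convergence[where w = "\<lambda>z. B * gaussian z"])
    show "integrable lborel (\<lambda>z::real^'n. B * gaussian z)" using integrable_gaussian[where 'n='n] by simp
    show "AE z in lborel. (\<lambda>m. f (x - ?\<epsilon> m *\<^sub>R z) * of_real (gaussian z)) \<longlonglongrightarrow> f x * of_real (gaussian z)"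
    proof (intro AE_I2 tendsto_mult tendsto_const)
      fix z
      have "(\<lambda>m. x - ?\<epsilon> m *\<^sub>R z) \<longlonglongrightarrow> x - 0 *\<^sub>R z"
        by (intro tendsto_intros LIMSEQ_inverse_real_of_nat)
      moreover have "isCont f x" using f(2) by (simp add: continuous_on_eq_continuous_at)
      ultimately show "(\<lambda>m. f (x - ?\<epsilon> m *\<^sub>R z)) \<longlonglongrightarrow> f x"
        using isCont_tendsto_compose by fastforce
    qed
    show "AE z in lborel. norm (f (x - ?\<epsilon> m *\<^sub>R z) * of_real (gaussian z)) \<le> B * gaussian z" for m
      using f(3) gaussian_bounds(1) by (intro AE_I2) (simp add: norm_mult less_imp_le mult_right_mono)
  qed measurable
  then have "(\<lambda>m. of_real ?K * (LINT z|lborel. f (x - ?\<epsilon> m *\<^sub>R z) * of_real (gaussian z)))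
      \<longlonglongrightarrow> of_real ?K * (LINT z|lborel. f x * of_real (gaussian (z :: real^'n)))"
    by (intro tendsto_mult tendsto_const)
  ultimately have "(LINT \<xi>|lborel. cis (x \<bullet> \<xi>) * fourier f \<xi>) = of_real ?K * (LINT z|lborel. f x * of_real (gaussian (z :: real^'n)))"
    by (subst (asm) gaussian_regularisation[OF f(1)]) (simp, rule LIMSEQ_unique)
  also have "(LINT z|lborel. f x * of_real (gaussian (z :: real^'n))) = f x * of_real ?K"
    using gaussian_fourier(2)[of "0 :: real^'n"] by (simp add: gaussian_def[of 0])
  \<comment> \<open>One factor \<open>?K\<close> stems from the regularised identity, the other is
    the mass of the Gaussian; together they cancel the normalisation of
    \<open>inv_fourier\<close>.\<close>
  also have "of_real ?K * (f x * of_real ?K) = (2 * pi) ^ CARD('n) *\<^sub>R f x"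
  proof -
    have "?K * ?K = (2 * pi) ^ CARD('n)"
      by (subst power_mult_distrib[symmetric]) simp
    moreover have "of_real ?K * (f x * of_real ?K) = of_real (?K * ?K) * f x"
      by (simp only: of_real_mult ac_simps)
    ultimately show ?thesis by (simp only: scaleR_conv_of_real)
  qed
  finally have "inv_fourier (fourier f) x = (inverse ((2 * pi) ^ CARD('n)) * (2 * pi) ^ CARD('n)) *\<^sub>R f x"
    by (simp only: inv_fourier_def scaleR_scaleR)
  also have "inverse ((2 * pi) ^ CARD('n)) * (2 * pi) ^ CARD('n) = 1"
    by (rule left_inverse) simp
  finally show ?thesis by simp
qed

lemma inv_fourier_fourier_schwartz:
  assumes "schwartz f"
  shows "inv_fourier (fourier f) = f"
proof
  obtain B where B: "\<And>x. norm (f x) \<le> B" using schwartz_bounded[OF assms] by blast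
  show "inv_fourier (fourier f) x = f x" for x
    by (rule fourier_inversion[OF schwartz_integrable schwartz_continuous B]) (intro assms schwartz_integrable schwartz_fourier)+
qed

lemma fourier_inv_fourier_schwartz:
  assumes "schwartz f"
  shows "fourier (inv_fourier f) = f"
  using fourier_inv_fourier[OF schwartz_integrable[OF schwartz_fourier[OF assms]]]
    inv_fourier_fourier_schwartz[OF assms] by auto

lemma nn_integral_lborel_translate:
  fixes t :: "'a::euclidean_space"
  assumes [measurable]: "f \<in> borel_measurable borel"
  shows "(\<integral>\<^sup>+x. f (x + t) \<partial>lborel) = (\<integral>\<^sup>+x. f x \<partial>lborel)"
  by (subst nn_integral_lborel_affine[of f 1 t]) (simp_all add: add.commute)

text \<open>Against a wide Gaussian, the integral of the squared transform becomes, by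
  \<open>gaussian_regularisation\<close>, a Gaussian average over \<open>z\<close> of the
  correlations of \<open>f\<close> with its translates by \<open>\<epsilon> z\<close>. Each
  correlation is at most the squared norm of \<open>f\<close>, and Fatou removes the Gaussian. The
  norm of \<open>f\<close> may be infinite.\<close>

theorem plancherel_le:
  fixes f :: "real^'n \<Rightarrow> complex"
  assumes f: "integrable lborel f"
  shows "sq_integral lborel (fourier f) \<le> ennreal ((2 * pi) ^ CARD('n)) * sq_integral lborel f"
proof -
  let ?K = "sqrt (2 * pi) ^ CARD('n)"
  let ?P = "sq_integral lborel f"
  let ?\<epsilon> = "\<lambda>m. inverse (real (Suc m))"
  have [measurable]: "f \<in> borel_measurable borel" using f by auto
  have [measurable]: "fourier f \<in> borel_measurable borel" using f by (rule borel_measurable_fourier)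
  have main: "(\<integral>\<^sup>+\<xi>. ennreal ((norm (fourier f \<xi>))\<^sup>2 * gaussian (\<epsilon> *\<^sub>R \<xi>)) \<partial>lborel) \<le> ennreal ((2 * pi) ^ CARD('n)) * ?P"
    if \<epsilon>: "\<epsilon> > 0" for \<epsilon>
  proof -
    let ?B = "LINT x|lborel. norm (f x)"
    have B: "norm (fourier f \<xi>) \<le> ?B" for \<xi> by (rule norm_fourier_le[OF f])
    have ig: "integrable lborel (\<lambda>\<xi>. norm (fourier f \<xi>) * gaussian (\<epsilon> *\<^sub>R \<xi>))"
    proof (rule Bochner_Integration.integrable_bound)
      show "integrable lborel (\<lambda>\<xi>::real^'n. ?B * gaussian (\<epsilon> *\<^sub>R \<xi>))"
        using gaussian_dilation_integrable[OF \<epsilon>, where 'n='n] by simp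
      show "AE \<xi> in lborel. norm (norm (fourier f \<xi>) * gaussian (\<epsilon> *\<^sub>R \<xi>)) \<le> norm (?B * gaussian (\<epsilon> *\<^sub>R \<xi>))"
        using B gaussian_bounds(1) by (intro AE_I2) (simp add: abs_mult mult_right_mono)
    qed measurable
    have ig2: "integrable lborel (\<lambda>\<xi>. (norm (fourier f \<xi>))\<^sup>2 * gaussian (\<epsilon> *\<^sub>R \<xi>))"
    proof (rule Bochner_Integration.integrable_bound)
      show "integrable lborel (\<lambda>\<xi>. ?B * (norm (fourier f \<xi>) * gaussian (\<epsilon> *\<^sub>R \<xi>)))"
        using ig by simp
      show "AE \<xi> in lborel. norm ((norm (fourier f \<xi>))\<^sup>2 * gaussian (\<epsilon> *\<^sub>R \<xi>)) \<le> norm (?B * (norm (fourier f \<xi>) * gaussian (\<epsilon> *\<^sub>R \<xi>)))"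
        using B gaussian_bounds(1) by (intro AE_I2) (simp add: abs_mult mult_right_mono power2_eq_square mult.assoc[symmetric])
    qed measurable
    let ?F = "\<lambda>x \<xi>. cnj (f x) * (cis (x \<bullet> \<xi>) * fourier f \<xi> * of_real (gaussian (\<epsilon> *\<^sub>R \<xi>)))"
    have "integrable (lborel \<Otimes>\<^sub>M lborel) (\<lambda>(x, \<xi>). ?F x \<xi>)"
      by (rule integrable_pair_bound[OF _ integrable_norm[OF f] ig])
         (simp_all add: norm_mult)
    from lborel_pair.Fubini_integral[OF this]
    have fub: "(LINT \<xi>|lborel. LINT x|lborel. ?F x \<xi>) = (LINT x|lborel. LINT \<xi>|lborel. ?F x \<xi>)" .
    have 1: "(LINT x|lborel. ?F x \<xi>) = of_real ((norm (fourier f \<xi>))\<^sup>2 * gaussian (\<epsilon> *\<^sub>R \<xi>))" for \<xi>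
    proof -
      have "cnj (fourier f \<xi>) = (LINT x|lborel. cnj (cis (- (x \<bullet> \<xi>)) * f x))"
        unfolding fourier_def by (rule Bochner_Integration.integral_cnj[symmetric])
      also have "\<dots> = (LINT x|lborel. cis (x \<bullet> \<xi>) * cnj (f x))" by (simp add: cis_cnj)
      finally have c: "cnj (fourier f \<xi>) = (LINT x|lborel. cis (x \<bullet> \<xi>) * cnj (f x))" .
      have "(LINT x|lborel. ?F x \<xi>) = (LINT x|lborel. (fourier f \<xi> * of_real (gaussian (\<epsilon> *\<^sub>R \<xi>))) * (cis (x \<bullet> \<xi>) * cnj (f x)))"
        by (simp add: ac_simps)
      also have "\<dots> = (fourier f \<xi> * of_real (gaussian (\<epsilon> *\<^sub>R \<xi>))) * cnj (fourier f \<xi>)"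
        unfolding c by (rule integral_mult_right_zero)
      also have "\<dots> = (fourier f \<xi> * cnj (fourier f \<xi>)) * of_real (gaussian (\<epsilon> *\<^sub>R \<xi>))" by (simp add: ac_simps)
      finally show ?thesis by (simp only: complex_norm_square[symmetric] of_real_mult)
    qed
    let ?S = "\<lambda>x. LINT z|lborel. f (x - \<epsilon> *\<^sub>R z) * of_real (gaussian z)"
    have 2: "(LINT \<xi>|lborel. ?F x \<xi>) = of_real ?K * (cnj (f x) * ?S x)" for x
      by (subst integral_mult_right_zero) (simp add: gaussian_regularisation[OF f \<epsilon>])
    have "complex_of_real (LINT \<xi>|lborel. (norm (fourier f \<xi>))\<^sup>2 * gaussian (\<epsilon> *\<^sub>R \<xi>)) = of_real ?K * (LINT x|lborel. cnj (f x) * ?S x)"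
      using fub unfolding 1 2 by (simp only: integral_complex_of_real integral_mult_right_zero)
    then have "\<bar>LINT \<xi>|lborel. (norm (fourier f \<xi>))\<^sup>2 * gaussian (\<epsilon> *\<^sub>R \<xi>)\<bar> = ?K * norm (LINT x|lborel. cnj (f x) * ?S x)"
      by (subst norm_of_real[symmetric, where 'a=complex]) (simp add: norm_mult norm_power)
    then have "(\<integral>\<^sup>+\<xi>. ennreal ((norm (fourier f \<xi>))\<^sup>2 * gaussian (\<epsilon> *\<^sub>R \<xi>)) \<partial>lborel) = ennreal (?K * norm (LINT x|lborel. cnj (f x) * ?S x))"
      using gaussian_bounds(1)
      by (subst nn_integral_eq_integral[OF ig2]) (auto simp: less_imp_le abs_of_nonneg)
    also have "\<dots> = ennreal ?K * ennreal (norm (LINT x|lborel. cnj (f x) * ?S x))"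
      by (simp add: ennreal_mult)
    also have "\<dots> \<le> ennreal ?K * (\<integral>\<^sup>+x. norm (cnj (f x) * ?S x) \<partial>lborel)"
    proof (rule mult_left_mono)
      \<comment> \<open>If the integrand is not integrable, the Bochner integral is 0 by convention
        and the bound holds trivially.\<close>
      show "ennreal (norm (LINT x|lborel. cnj (f x) * ?S x)) \<le> (\<integral>\<^sup>+x. norm (cnj (f x) * ?S x) \<partial>lborel)"
        by (cases "integrable lborel (\<lambda>x. cnj (f x) * ?S x)")
           (auto intro: integral_norm_bound_ennreal simp: not_integrable_integral_eq)
    qed simp
    also have "(\<integral>\<^sup>+x. norm (cnj (f x) * ?S x) \<partial>lborel) \<le> (\<integral>\<^sup>+x. \<integral>\<^sup>+z. ennreal (norm (f x) * norm (f (x - \<epsilon> *\<^sub>R z))) * gaussian z \<partial>lborel \<partial>lborel)"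
    proof (rule nn_integral_mono)
      fix x
      have "ennreal (norm (?S x)) \<le> (\<integral>\<^sup>+z. norm (f (x - \<epsilon> *\<^sub>R z) * of_real (gaussian z)) \<partial>lborel)"
        by (cases "integrable lborel (\<lambda>z. f (x - \<epsilon> *\<^sub>R z) * of_real (gaussian z))")
           (auto intro: integral_norm_bound_ennreal simp: not_integrable_integral_eq)
      then have "ennreal (norm (f x)) * ennreal (norm (?S x)) \<le> ennreal (norm (f x)) * (\<integral>\<^sup>+z. norm (f (x - \<epsilon> *\<^sub>R z) * of_real (gaussian z)) \<partial>lborel)"
        by (rule mult_left_mono) simp
      also have "\<dots> = (\<integral>\<^sup>+z. ennreal (norm (f x)) * ennreal (norm (f (x - \<epsilon> *\<^sub>R z) * of_real (gaussian z))) \<partial>lborel)"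
        by (rule nn_integral_cmult[symmetric]) measurable
      also have "\<dots> = (\<integral>\<^sup>+z. ennreal (norm (f x) * norm (f (x - \<epsilon> *\<^sub>R z))) * gaussian z \<partial>lborel)"
        using gaussian_bounds(1) by (simp add: norm_mult ennreal_mult less_imp_le mult.assoc)
      finally show "ennreal (norm (cnj (f x) * ?S x)) \<le> (\<integral>\<^sup>+z. ennreal (norm (f x) * norm (f (x - \<epsilon> *\<^sub>R z))) * gaussian z \<partial>lborel)"
        by (simp add: norm_mult ennreal_mult)
    qed
    also have "\<dots> = (\<integral>\<^sup>+z. \<integral>\<^sup>+x. ennreal (norm (f x) * norm (f (x - \<epsilon> *\<^sub>R z))) * gaussian z \<partial>lborel \<partial>lborel)"
      by (rule lborel_pair.Fubini'[symmetric]) measurable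
    also have "\<dots> \<le> (\<integral>\<^sup>+z. ?P * ennreal (gaussian (z::real^'n)) \<partial>lborel)"
    proof (rule nn_integral_mono)
      fix z :: "real^'n"
      have "(\<integral>\<^sup>+x. ennreal (norm (f x) * norm (f (x - \<epsilon> *\<^sub>R z))) \<partial>lborel)
          \<le> (\<integral>\<^sup>+x. ennreal (1/2) * (ennreal ((norm (f x))\<^sup>2) + ennreal ((norm (f (x + (- (\<epsilon> *\<^sub>R z)))))\<^sup>2)) \<partial>lborel)"
      proof (rule nn_integral_mono)
        fix x
        \<comment> \<open>With this inequality and translation invariance, the bound on the
          correlation does not depend on \<open>z\<close>.\<close>
        have "norm (f x) * norm (f (x - \<epsilon> *\<^sub>R z)) \<le> 1/2 * ((norm (f x))\<^sup>2 + (norm (f (x + (- (\<epsilon> *\<^sub>R z)))))\<^sup>2)"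
          using sum_squares_bound[of "norm (f x)" "norm (f (x - \<epsilon> *\<^sub>R z))"] by simp
        then have "ennreal (norm (f x) * norm (f (x - \<epsilon> *\<^sub>R z))) \<le> ennreal (1/2 * ((norm (f x))\<^sup>2 + (norm (f (x + (- (\<epsilon> *\<^sub>R z)))))\<^sup>2))"
          by (rule ennreal_leI)
        also have "\<dots> = ennreal (1/2) * ennreal ((norm (f x))\<^sup>2 + (norm (f (x + (- (\<epsilon> *\<^sub>R z)))))\<^sup>2)"
          by (rule ennreal_mult) auto
        also have "ennreal ((norm (f x))\<^sup>2 + (norm (f (x + (- (\<epsilon> *\<^sub>R z)))))\<^sup>2)
            = ennreal ((norm (f x))\<^sup>2) + ennreal ((norm (f (x + (- (\<epsilon> *\<^sub>R z)))))\<^sup>2)"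
          by (rule ennreal_plus) auto
        finally show "ennreal (norm (f x) * norm (f (x - \<epsilon> *\<^sub>R z)))
            \<le> ennreal (1/2) * (ennreal ((norm (f x))\<^sup>2) + ennreal ((norm (f (x + (- (\<epsilon> *\<^sub>R z)))))\<^sup>2))" .
      qed
      also have "\<dots> = ennreal (1/2) * (?P + ?P)"
        by (subst nn_integral_cmult, measurable, subst nn_integral_add, measurable,
            subst nn_integral_lborel_translate[of "\<lambda>x. ennreal ((norm (f x))\<^sup>2)"]) auto
      also have "\<dots> = ?P"
      proof -
        have "ennreal (1/2) * (?P + ?P) = (ennreal (1/2) * 2) * ?P"
          by (simp add: mult.assoc mult_2[symmetric])
        also have "ennreal (1/2) * 2 = ennreal (1/2 * 2)" by (subst ennreal_mult) auto
        finally show ?thesis by simp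
      qed
      finally show "(\<integral>\<^sup>+x. ennreal (norm (f x) * norm (f (x - \<epsilon> *\<^sub>R z))) * gaussian z \<partial>lborel) \<le> ?P * ennreal (gaussian z)"
        by (subst nn_integral_multc) (auto intro: mult_right_mono)
    qed
    also have "\<dots> = ?P * ennreal ?K"
      by (subst nn_integral_cmult) (simp_all add: nn_integral_gaussian)
    finally have "(\<integral>\<^sup>+\<xi>. ennreal ((norm (fourier f \<xi>))\<^sup>2 * gaussian (\<epsilon> *\<^sub>R \<xi>)) \<partial>lborel) \<le> ennreal ?K * (?P * ennreal ?K)"
      by (simp add: mult_left_mono)
    also have "\<dots> = ennreal (?K * ?K) * ?P" by (subst ennreal_mult) (auto simp: ac_simps)
    also have "?K * ?K = (2 * pi) ^ CARD('n)"
      by (subst power_mult_distrib[symmetric]) simp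
    finally show ?thesis .
  qed
  \<comment> \<open>The Gaussian weights tend to 1 pointwise, so Fatou turns the uniform bound
    \<open>main\<close> into the claim.\<close>
  have "sq_integral lborel (fourier f) = (\<integral>\<^sup>+\<xi>. liminf (\<lambda>m. ennreal ((norm (fourier f \<xi>))\<^sup>2 * gaussian (?\<epsilon> m *\<^sub>R \<xi>))) \<partial>lborel)"
  proof (rule nn_integral_cong)
    fix \<xi>
    have "(\<lambda>m. ennreal ((norm (fourier f \<xi>))\<^sup>2 * gaussian (?\<epsilon> m *\<^sub>R \<xi>))) \<longlonglongrightarrow> ennreal ((norm (fourier f \<xi>))\<^sup>2 * 1)"
      by (intro tendsto_ennrealI tendsto_mult tendsto_const gaussian_dilation_tendsto)
    from lim_imp_Liminf[OF sequentially_bot this]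
    show "ennreal ((norm (fourier f \<xi>))\<^sup>2) = liminf (\<lambda>m. ennreal ((norm (fourier f \<xi>))\<^sup>2 * gaussian (?\<epsilon> m *\<^sub>R \<xi>)))"
      unfolding mult_1_right by (rule sym)
  qed
  also have "\<dots> \<le> liminf (\<lambda>m. \<integral>\<^sup>+\<xi>. ennreal ((norm (fourier f \<xi>))\<^sup>2 * gaussian (?\<epsilon> m *\<^sub>R \<xi>)) \<partial>lborel)"
    by (rule nn_integral_liminf) measurable
  also have "\<dots> \<le> ennreal ((2 * pi) ^ CARD('n)) * ?P"
    by (rule Liminf_le[OF sequentially_bot]) (intro always_eventually allI main, simp)
  finally show ?thesis .
qed


subsection \<open>The Fourier transform of a square-integrable function\<close>

text \<open>A weighted arithmetic-geometric inequality; the free weight \<open>c\<close> allows a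
  small first factor to be balanced against a fixed second one.\<close>

lemma nn_integral_power2_mult_le:
  fixes u v :: "'a \<Rightarrow> complex" and c :: real
  assumes [measurable]: "u \<in> borel_measurable M" "v \<in> borel_measurable M" and "c > 0"
  shows "(\<integral>\<^sup>+x. ennreal (norm (u x * v x)) \<partial>M) \<le>
    ennreal c * sq_integral M u + ennreal (inverse c) * sq_integral M v"
proof -
  have "a * b \<le> c * a\<^sup>2 + inverse c * b\<^sup>2" if "a \<ge> 0" "b \<ge> 0" for a b :: real
  proof -
    have "0 \<le> inverse c * (c * a - b)\<^sup>2" using \<open>c > 0\<close> by simp
    also have "\<dots> = c * a\<^sup>2 + inverse c * b\<^sup>2 - 2 * (a * b)"
      using \<open>c > 0\<close> by (simp add: power2_eq_square field_simps)
    finally show ?thesis using mult_nonneg_nonneg[OF that] by linarith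
  qed
  then have "ennreal (norm (u x * v x)) \<le> ennreal c * ennreal ((norm (u x))\<^sup>2) + ennreal (inverse c) * ennreal ((norm (v x))\<^sup>2)" for x
    using \<open>c > 0\<close> by (simp add: norm_mult ennreal_mult[symmetric] ennreal_plus[symmetric] ennreal_leI del: ennreal_plus)
  then have "(\<integral>\<^sup>+x. ennreal (norm (u x * v x)) \<partial>M) \<le>
      (\<integral>\<^sup>+x. ennreal c * ennreal ((norm (u x))\<^sup>2) + ennreal (inverse c) * ennreal ((norm (v x))\<^sup>2) \<partial>M)"
    by (rule nn_integral_mono)
  also have "\<dots> = ennreal c * sq_integral M u + ennreal (inverse c) * sq_integral M v"
    by (subst nn_integral_add) (auto simp: nn_integral_cmult)
  finally show ?thesis .
qed

lemma integrable_mult_of_power2: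
  fixes u v :: "'a \<Rightarrow> complex"
  assumes [measurable]: "u \<in> borel_measurable M" "v \<in> borel_measurable M"
    and "sq_integral M u < \<infinity>" "sq_integral M v < \<infinity>"
  shows "integrable M (\<lambda>x. u x * v x)"
  unfolding integrable_iff_bounded
  using nn_integral_power2_mult_le[of u M v 1] assms by (auto intro: le_less_trans)

text \<open>With weight \<open>2^i\<close> the squared error \<open>\<delta> 4^(-i)\<close> and the
  fixed square integral of \<open>v\<close> both contribute a multiple of
  \<open>2^(-i)\<close>.\<close>

lemma L2_pairing_tendsto:
  fixes u v :: "'a \<Rightarrow> complex"
  assumes [measurable]: "u \<in> borel_measurable M" "\<And>i. U i \<in> borel_measurable M" "v \<in> borel_measurable M"
    and i1: "integrable M (\<lambda>x. u x * v x)" and i2: "\<And>i. integrable M (\<lambda>x. U i x * v x)"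
    and v: "sq_integral M v < \<infinity>"
    and le: "\<And>i::nat. (\<integral>\<^sup>+x. ennreal ((norm (u x - U i x))\<^sup>2) \<partial>M) \<le> ennreal (\<delta> * (1/4) ^ i)" and "\<delta> \<ge> 0"
  shows "(\<lambda>i. LINT x|M. U i x * v x) \<longlonglongrightarrow> (LINT x|M. u x * v x)"
proof -
  obtain V where V: "sq_integral M v = ennreal V" "V \<ge> 0"
    using v by (cases "sq_integral M v") auto
  have bd: "norm ((LINT x|M. U i x * v x) - (LINT x|M. u x * v x)) \<le> (\<delta> + V) * (1/2) ^ i" for i
  proof -
    have "(LINT x|M. u x * v x) - (LINT x|M. U i x * v x) = (LINT x|M. (u x - U i x) * v x)"
      using i1 i2[of i] by (simp add: left_diff_distrib)
    moreover have int: "integrable M (\<lambda>x. (u x - U i x) * v x)"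
      using i1 i2[of i] by (simp add: left_diff_distrib)
    ultimately have "ennreal (norm ((LINT x|M. u x * v x) - (LINT x|M. U i x * v x))) \<le> (\<integral>\<^sup>+x. ennreal (norm ((u x - U i x) * v x)) \<partial>M)"
      using integral_norm_bound_ennreal[OF int] by simp
    also have "\<dots> \<le> ennreal (2 ^ i) * (\<integral>\<^sup>+x. ennreal ((norm (u x - U i x))\<^sup>2) \<partial>M) + ennreal (inverse (2 ^ i)) * sq_integral M v"
      by (rule nn_integral_power2_mult_le) auto
    also have "\<dots> \<le> ennreal (2 ^ i) * ennreal (\<delta> * (1/4) ^ i) + ennreal (inverse (2 ^ i)) * ennreal V"
      unfolding V by (intro add_mono mult_left_mono le) auto
    also have "\<dots> = ennreal (2 ^ i * (\<delta> * (1/4) ^ i) + inverse (2 ^ i) * V)"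
      using V(2) \<open>\<delta> \<ge> 0\<close> by (subst ennreal_plus) (auto simp: ennreal_mult)
    also have "2 ^ i * (\<delta> * (1/4) ^ i) + inverse (2 ^ i) * V = (\<delta> + V) * (1/2) ^ i"
    proof -
      have "2 ^ i * (\<delta> * (1/4) ^ i) = \<delta> * (2 ^ i * (1/4) ^ i)" by simp
      also have "(2::real) ^ i * (1/4) ^ i = (1/2) ^ i" by (subst power_mult_distrib[symmetric]) simp
      finally show ?thesis by (simp add: distrib_right add_divide_distrib power_one_over inverse_eq_divide)
    qed
    finally have "norm ((LINT x|M. u x * v x) - (LINT x|M. U i x * v x)) \<le> (\<delta> + V) * (1/2) ^ i"
      using V(2) \<open>\<delta> \<ge> 0\<close> by (subst (asm) ennreal_le_iff) auto
    then show ?thesis by (simp add: norm_minus_commute)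
  qed
  have l: "(\<lambda>i. (\<delta> + V) * (1/2) ^ i) \<longlonglongrightarrow> 0"
    using tendsto_mult[OF tendsto_const LIMSEQ_power_zero[of "1/2::real"], of "\<delta> + V"] by simp
  have "(\<lambda>i. (LINT x|M. U i x * v x) - (LINT x|M. u x * v x)) \<longlonglongrightarrow> 0"
    by (rule Lim_null_comparison[OF _ l]) (use bd in auto)
  then show ?thesis by (simp add: LIM_zero_iff)
qed

lemma fourier_diff:
  assumes "integrable lborel f" "integrable lborel g"
  shows "fourier (\<lambda>x. f x - g x) \<xi> = fourier f \<xi> - fourier g \<xi>"
  unfolding fourier_def using cis_minus_integrable[OF assms(1)] cis_minus_integrable[OF assms(2)]
  by (simp add: right_diff_distrib)

text \<open>The squared increments weighted by \<open>2^j\<close> still have a finite sum of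
  integrals, so their sum \<open>H\<close> is finite almost everywhere. There the increments are at
  most \<open>sqrt H * 2^(-j/2)\<close>, and the telescoping series converges absolutely.\<close>

lemma AE_convergent_of_geometric_L2:
  fixes F :: "nat \<Rightarrow> 'a \<Rightarrow> complex"
  assumes [measurable]: "\<And>j. F j \<in> borel_measurable M"
    and le: "\<And>j. (\<integral>\<^sup>+x. ennreal ((norm (F (Suc j) x - F j x))\<^sup>2) \<partial>M) \<le> ennreal (D * (1/4) ^ j)" and "D \<ge> 0"
  shows "AE x in M. convergent (\<lambda>j. F j x)"
proof -
  let ?a = "\<lambda>j x. F (Suc j) x - F j x"
  let ?h = "\<lambda>x. \<Sum>j. ennreal (2 ^ j * (norm (?a j x))\<^sup>2)"
  have "(\<integral>\<^sup>+x. ?h x \<partial>M) = (\<Sum>j. \<integral>\<^sup>+x. ennreal (2 ^ j * (norm (?a j x))\<^sup>2) \<partial>M)"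
    by (rule nn_integral_suminf) measurable
  also have "\<dots> \<le> (\<Sum>j. ennreal (D * (1/2) ^ j))"
  proof (rule suminf_le)
    fix j
    have "(\<integral>\<^sup>+x. ennreal (2 ^ j * (norm (?a j x))\<^sup>2) \<partial>M) = ennreal (2 ^ j) * (\<integral>\<^sup>+x. ennreal ((norm (?a j x))\<^sup>2) \<partial>M)"
      by (subst nn_integral_cmult[symmetric]) (auto simp: ennreal_mult)
    also have "\<dots> \<le> ennreal (2 ^ j) * ennreal (D * (1/4) ^ j)"
      by (intro mult_left_mono le) simp
    also have "\<dots> = ennreal (2 ^ j * (D * (1/4) ^ j))" using \<open>D \<ge> 0\<close> by (simp add: ennreal_mult)
    also have "2 ^ j * (D * (1/4) ^ j) = D * (1/2) ^ j"
    proof -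
      have "2 ^ j * (D * (1/4) ^ j) = D * (2 ^ j * (1/4) ^ j)" by simp
      also have "(2::real) ^ j * (1/4) ^ j = (1/2) ^ j" by (subst power_mult_distrib[symmetric]) simp
      finally show ?thesis .
    qed
    finally show "(\<integral>\<^sup>+x. ennreal (2 ^ j * (norm (?a j x))\<^sup>2) \<partial>M) \<le> ennreal (D * (1/2) ^ j)" .
  qed auto
  also have "\<dots> = ennreal (\<Sum>j. D * (1/2) ^ j)"
    using \<open>D \<ge> 0\<close> by (intro suminf_ennreal2) (auto intro!: summable_mult summable_geometric)
  also have "\<dots> < \<infinity>" by simp
  finally have "AE x in M. ?h x \<noteq> \<infinity>"
    by (intro nn_integral_PInf_AE) auto
  then show ?thesis
  proof eventually_elim
    case (elim x)
    define H where "H = enn2real (?h x)"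
    have H: "?h x = ennreal H" "H \<ge> 0"
      unfolding H_def using elim by (simp_all only: ennreal_enn2real_if if_False enn2real_nonneg infinity_ennreal_def)
    have b: "norm (?a j x) \<le> sqrt H * (sqrt (1/2)) ^ j" for j
    proof -
      have "(\<Sum>j\<in>{j}. ennreal (2 ^ j * (norm (?a j x))\<^sup>2)) \<le> ?h x"
        by (rule sum_le_suminf) auto
      then have "ennreal (2 ^ j * (norm (?a j x))\<^sup>2) \<le> ennreal H" unfolding H(1) by simp
      then have *: "2 ^ j * (norm (?a j x))\<^sup>2 \<le> H" using H(2) by (simp only: ennreal_le_iff)
      have "(norm (?a j x))\<^sup>2 = (2 ^ j * (norm (?a j x))\<^sup>2) * (1/2) ^ j" by (simp add: power_one_over)
      also have "\<dots> \<le> H * (1/2) ^ j" by (rule mult_right_mono[OF *]) simp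
      finally have "(norm (?a j x))\<^sup>2 \<le> H * (1/2) ^ j" .
      then have "sqrt ((norm (?a j x))\<^sup>2) \<le> sqrt (H * (1/2) ^ j)" by (rule real_sqrt_le_mono)
      then show ?thesis by (simp add: real_sqrt_mult real_sqrt_power[symmetric])
    qed
    have "summable (\<lambda>j. sqrt H * (sqrt (1/2)) ^ j)"
      by (intro summable_mult summable_geometric) (simp add: real_sqrt_lt_1_iff)
    then have "summable (\<lambda>j. ?a j x)"
      by (rule summable_comparison_test'[of _ 0]) (rule b)
    then have "convergent (\<lambda>n. F n x - F 0 x)"
      by (simp add: summable_iff_convergent sum_lessThan_telescope[of "\<lambda>j. F j x"])
    then have "convergent (\<lambda>n. (F n x - F 0 x) + F 0 x)"
      by (rule convergent_add) (rule convergent_const)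
    then show ?case by simp
  qed
qed

text \<open>Fatou; it transfers L^2 bounds from approximants to an almost everywhere limit.\<close>

lemma nn_integral_norm_power2_liminf_le:
  fixes F :: "nat \<Rightarrow> 'a \<Rightarrow> complex"
  assumes [measurable]: "\<And>j. F j \<in> borel_measurable M"
    and lim: "AE x in M. (\<lambda>j. F j x) \<longlonglongrightarrow> G x"
    and le: "eventually (\<lambda>j. (sq_integral M (F j)) \<le> B) sequentially"
  shows "sq_integral M G \<le> B"
proof -
  have "sq_integral M G = (\<integral>\<^sup>+x. liminf (\<lambda>j. ennreal ((norm (F j x))\<^sup>2)) \<partial>M)"
    using lim
  proof (intro nn_integral_cong_AE, eventually_elim)
    case (elim x)
    have "(\<lambda>j. ennreal ((norm (F j x))\<^sup>2)) \<longlonglongrightarrow> ennreal ((norm (G x))\<^sup>2)"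
      by (intro tendsto_ennrealI tendsto_power tendsto_norm elim)
    then show ?case using lim_imp_Liminf[OF sequentially_bot] by metis
  qed
  also have "\<dots> \<le> liminf (\<lambda>j. sq_integral M (F j))"
    by (rule nn_integral_liminf) measurable
  also have "\<dots> \<le> B" by (rule Liminf_le[OF sequentially_bot le])
  finally show ?thesis .
qed

text \<open>The Fourier transform on \<open>L\<^sup>2\<close> as an almost everywhere limit along truncations whose tails
  decay geometrically; this needs neither completeness of \<open>L\<^sup>2\<close> nor the Riesz representation.\<close>

theorem L2_fourier_exists:
  fixes g :: "real^'n \<Rightarrow> complex"
  assumes [measurable]: "g \<in> borel_measurable borel" and fin: "sq_integral lborel g < \<infinity>"
  shows "\<exists>G\<in>borel_measurable borel.
    (sq_integral lborel G) \<le> ennreal ((2 * pi) ^ CARD('n)) * sq_integral lborel g \<and>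
    (\<forall>\<psi>. schwartz \<psi> \<longrightarrow> (LINT x|lborel. g x * fourier \<psi> x) = (LINT x|lborel. G x * \<psi> x))"
proof -
  let ?K = "(2 * pi) ^ CARD('n)"
  let ?T = "\<lambda>k::nat. \<lambda>x. if norm x \<le> real k then g x else 0"
  let ?t = "\<lambda>k. LINT x|lborel. (norm (g x - ?T k x))\<^sup>2"
  have gint: "integrable lborel (\<lambda>x. (norm (g x))\<^sup>2)"
    using fin by (intro integrableI_nonneg) auto
  have T_cases: "?T k x = 0 \<or> ?T k x = g x" for k x by simp
  have Tle: "norm (?T k x) \<le> norm (g x)" for k x using T_cases[of x k] by auto
  have T_diff: "norm (g x - ?T k x) \<le> norm (g x)" for k x using T_cases[of x k] by auto
  have tint: "integrable lborel (\<lambda>x. (norm (g x - ?T k x))\<^sup>2)" for k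
  proof (rule Bochner_Integration.integrable_bound[OF gint])
    show "AE x in lborel. norm ((norm (g x - ?T k x))\<^sup>2) \<le> norm ((norm (g x))\<^sup>2)"
      using power_mono[OF T_diff norm_ge_zero] by (intro AE_I2) simp
  qed measurable
  have "?t \<longlonglongrightarrow> (LINT x|(lborel::(real^'n) measure). (0::real))"
  proof (rule integral_dominated_convergence[OF _ _ gint])
    show "AE x in lborel. (\<lambda>k. (norm (g x - ?T k x))\<^sup>2) \<longlonglongrightarrow> 0"
    proof (rule AE_I2)
      fix x :: "real^'n"
      obtain k0 :: nat where k0: "norm x \<le> real k0" using real_arch_simple by blast
      show "(\<lambda>k. (norm (g x - ?T k x))\<^sup>2) \<longlonglongrightarrow> 0"
      proof (rule tendsto_eventually, rule eventually_sequentiallyI[of k0])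
        fix k assume "k0 \<le> k"
        then have "norm x \<le> real k" using k0 by simp
        then show "(norm (g x - ?T k x))\<^sup>2 = 0" by simp
      qed
    qed
    show "AE x in lborel. norm ((norm (g x - ?T k x))\<^sup>2) \<le> (norm (g x))\<^sup>2" for k
      using power_mono[OF T_diff norm_ge_zero] by (intro AE_I2) simp
  qed measurable
  then have t0: "?t \<longlonglongrightarrow> 0" by simp
  \<comment> \<open>A choice of radii with tails below \<open>4^(-j)\<close> gives the geometric
    rate demanded by the convergence lemmas.\<close>
  have "\<exists>k. ?t k \<le> (1/4) ^ j" for j :: nat
  proof -
    have "eventually (\<lambda>k. ?t k < (1/4) ^ j) sequentially"
      by (rule order_tendstoD(2)[OF t0]) simp
    from eventually_happens'[OF sequentially_bot this] obtain k where "?t k < (1/4) ^ j" ..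
    then show ?thesis by (intro exI[of _ k]) (rule less_imp_le)
  qed
  then have "\<exists>k. \<forall>j. ?t (k j) \<le> (1/4) ^ j" by (intro choice allI)
  then obtain k where k: "?t (k j) \<le> (1/4) ^ j" for j by blast
  define f where "f j = ?T (k j)" for j
  have [measurable]: "f j \<in> borel_measurable borel" for j unfolding f_def by measurable
  have f_cases: "f j x = 0 \<or> f j x = g x" for j x unfolding f_def by (rule T_cases)
  have tail: "(\<integral>\<^sup>+x. ennreal ((norm (g x - f j x))\<^sup>2) \<partial>lborel) \<le> ennreal ((1/4) ^ j)" for j
    unfolding f_def by (subst nn_integral_eq_integral[OF tint]) (auto intro!: ennreal_leI k)
  have f_int: "integrable lborel (f j)" for j
  proof (rule Bochner_Integration.integrable_bound)
    show "integrable lborel (\<lambda>x. (norm (g x))\<^sup>2 + indicator (cball 0 (real (k j))) x)"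
      using emeasure_bounded_finite[of "cball 0 (real (k j)) :: (real^'n) set"]
      by (intro Bochner_Integration.integrable_add gint integrable_real_indicator) auto
    have "norm (f j x) \<le> (norm (g x))\<^sup>2 + indicator (cball 0 (real (k j))) x" for x
    proof -
      \<comment> \<open>On the ball carrying the truncation, \<open>|g|\<close> is dominated by
        \<open>|g|^2 + 1\<close>, which is integrable there.\<close>
      have "a \<le> a\<^sup>2 + 1" for a :: real
        using zero_le_power2[of "a - 1/2"] by (simp add: power2_eq_square algebra_simps)
      then show ?thesis by (simp add: f_def indicator_def)
    qed
    then show "AE x in lborel. norm (f j x) \<le> norm ((norm (g x))\<^sup>2 + indicator (cball 0 (real (k j))) x)"
      by (intro AE_I2)
         (simp only: real_norm_def abs_of_nonneg add_nonneg_nonneg zero_le_power2 indicator_pos_le)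
  qed measurable
  define F where "F j = fourier (f j)" for j
  have [measurable]: "F j \<in> borel_measurable borel" for j
    unfolding F_def by (rule borel_measurable_fourier[OF f_int])
  have diff: "(\<integral>\<^sup>+x. ennreal ((norm (F j x - F i x))\<^sup>2) \<partial>lborel) \<le> ennreal (2 * ?K * (1/4) ^ i)" if "i \<le> j" for i j
  proof -
    have "(\<integral>\<^sup>+x. ennreal ((norm (F j x - F i x))\<^sup>2) \<partial>lborel) = (\<integral>\<^sup>+\<xi>. ennreal ((norm (fourier (\<lambda>x. f j x - f i x) \<xi>))\<^sup>2) \<partial>lborel)"
      by (simp add: F_def fourier_diff[OF f_int f_int])
    also have "\<dots> \<le> ennreal ?K * (\<integral>\<^sup>+x. ennreal ((norm (f j x - f i x))\<^sup>2) \<partial>lborel)"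
      by (rule plancherel_le) (intro Bochner_Integration.integrable_diff f_int)
    also have "\<dots> \<le> ennreal ?K * (\<integral>\<^sup>+x. ennreal ((norm (g x - f j x))\<^sup>2) + ennreal ((norm (g x - f i x))\<^sup>2) \<partial>lborel)"
    proof (intro mult_left_mono nn_integral_mono)
      fix x
      \<comment> \<open>Pointwise each truncation is 0 or \<open>g x\<close>; where the two differ,
        one of the tails on the right equals \<open>g x\<close>.\<close>
      have "(norm (f j x - f i x))\<^sup>2 \<le> (norm (g x - f j x))\<^sup>2 + (norm (g x - f i x))\<^sup>2"
        using f_cases[of j x] f_cases[of i x] by auto
      then show "ennreal ((norm (f j x - f i x))\<^sup>2) \<le> ennreal ((norm (g x - f j x))\<^sup>2) + ennreal ((norm (g x - f i x))\<^sup>2)"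
        by (simp add: ennreal_plus[symmetric] ennreal_leI del: ennreal_plus)
    qed simp
    also have "\<dots> \<le> ennreal ?K * (ennreal ((1/4) ^ j) + ennreal ((1/4) ^ i))"
      by (subst nn_integral_add) (auto intro!: mult_left_mono add_mono tail)
    also have "\<dots> \<le> ennreal ?K * (ennreal ((1/4) ^ i) + ennreal ((1/4) ^ i))"
      by (intro mult_left_mono add_mono order_refl ennreal_leI power_decreasing that) auto
    also have "\<dots> = ennreal (2 * ?K * (1/4) ^ i)"
      by (subst ennreal_plus[symmetric]) (auto simp: ennreal_mult[symmetric] mult_ac)
    finally show ?thesis .
  qed
  \<comment> \<open>Where the sequence diverges, \<open>lim\<close> is an unspecified value; this
    concerns only a null set.\<close>
  define G where "G x = lim (\<lambda>j. F j x)" for x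
  have [measurable]: "G \<in> borel_measurable borel"
    unfolding G_def by (rule borel_measurable_lim_metric) measurable
  have "AE x in lborel. convergent (\<lambda>j. F j x)"
    by (rule AE_convergent_of_geometric_L2[where D = "2 * ?K"], measurable, rule diff) simp_all
  then have limG: "AE x in lborel. (\<lambda>j. F j x) \<longlonglongrightarrow> G x"
    by eventually_elim (simp add: G_def convergent_LIMSEQ_iff)
  have nG: "sq_integral lborel G \<le> ennreal ?K * sq_integral lborel g"
  proof (rule nn_integral_norm_power2_liminf_le[OF _ limG], measurable, intro always_eventually allI)
    fix j
    have "sq_integral lborel (F j) \<le> ennreal ?K * sq_integral lborel (f j)"
      unfolding F_def by (rule plancherel_le[OF f_int])
    also have "\<dots> \<le> ennreal ?K * sq_integral lborel g"
      unfolding f_def by (intro mult_left_mono nn_integral_mono ennreal_leI power_mono Tle) auto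
    finally show "sq_integral lborel (F j) \<le> ennreal ?K * sq_integral lborel g" .
  qed
  \<comment> \<open>The index \<open>i\<close> stays fixed while \<open>j\<close> tends to infinity,
    so Fatou turns the Cauchy estimate into a rate of convergence to \<open>G\<close>.\<close>
  have GF: "(\<integral>\<^sup>+x. ennreal ((norm (G x - F i x))\<^sup>2) \<partial>lborel) \<le> ennreal (2 * ?K * (1/4) ^ i)" for i
  proof (rule nn_integral_norm_power2_liminf_le)
    show "AE x in lborel. (\<lambda>j. F j x - F i x) \<longlonglongrightarrow> G x - F i x"
      using limG by eventually_elim (intro tendsto_diff tendsto_const)
    show "\<forall>\<^sub>F j in sequentially. (\<integral>\<^sup>+x. ennreal ((norm (F j x - F i x))\<^sup>2) \<partial>lborel) \<le> ennreal (2 * ?K * (1/4) ^ i)"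
      using diff by (rule eventually_sequentiallyI)
  qed measurable
  have fin_f: "sq_integral lborel (f j) < \<infinity>" for j
    unfolding f_def by (rule le_less_trans[OF _ fin], intro nn_integral_mono ennreal_leI power_mono Tle norm_ge_zero)
  have fin_F: "sq_integral lborel (F j) < \<infinity>" for j
    using plancherel_le[OF f_int[of j]] fin_f[of j] unfolding F_def
    by (auto intro: le_less_trans simp: ennreal_mult_less_top)
  have fin_G: "sq_integral lborel G < \<infinity>"
    using nG fin by (auto intro: le_less_trans simp: ennreal_mult_less_top)
  have "(LINT x|lborel. g x * fourier \<psi> x) = (LINT x|lborel. G x * \<psi> x)" if \<psi>: "schwartz \<psi>" for \<psi>
  proof -
    note \<psi>F = schwartz_fourier[OF \<psi>]
    have [measurable]: "\<psi> \<in> borel_measurable borel" "fourier \<psi> \<in> borel_measurable borel"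
      using \<psi> \<psi>F by (auto intro: schwartz_measurable)
    have fin_s: "sq_integral lborel \<theta> < \<infinity>" if "schwartz \<theta>" for \<theta> :: "real^'n \<Rightarrow> complex"
      using schwartz_norm_power2_integrable[OF that] by (simp add: integrable_iff_bounded)
    \<comment> \<open>The multiplication formula holds for each integrable truncation, and both of
      its sides converge.\<close>
    have "(\<lambda>i. LINT x|lborel. f i x * fourier \<psi> x) \<longlonglongrightarrow> (LINT x|lborel. g x * fourier \<psi> x)"
    proof (rule L2_pairing_tendsto[where \<delta> = 1])
      show "(\<integral>\<^sup>+x. ennreal ((norm (g x - f i x))\<^sup>2) \<partial>lborel) \<le> ennreal (1 * (1/4) ^ i)" for i
        using tail[of i] by simp
      show "integrable lborel (\<lambda>x. g x * fourier \<psi> x)"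
        by (rule integrable_mult_of_power2, measurable, rule fin, rule fin_s[OF \<psi>F])
      show "integrable lborel (\<lambda>x. f i x * fourier \<psi> x)" for i
        by (rule integrable_mult_of_power2, measurable, rule fin_f, rule fin_s[OF \<psi>F])
      show "sq_integral lborel (fourier \<psi>) < \<infinity>" by (rule fin_s[OF \<psi>F])
      show "0 \<le> (1::real)" by simp
    qed measurable
    moreover have "(\<lambda>i. LINT x|lborel. F i x * \<psi> x) \<longlonglongrightarrow> (LINT x|lborel. G x * \<psi> x)"
    proof (rule L2_pairing_tendsto[where \<delta> = "2 * ?K", OF _ _ _ _ _ _ GF])
      show "integrable lborel (\<lambda>x. G x * \<psi> x)"
        by (rule integrable_mult_of_power2, measurable, rule fin_G, rule fin_s[OF \<psi>])
      show "integrable lborel (\<lambda>x. F i x * \<psi> x)" for i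
        by (rule integrable_mult_of_power2, measurable, rule fin_F, rule fin_s[OF \<psi>])
      show "sq_integral lborel \<psi> < \<infinity>" by (rule fin_s[OF \<psi>])
      show "0 \<le> 2 * ?K" by simp
    qed measurable
    moreover have "(LINT x|lborel. f i x * fourier \<psi> x) = (LINT x|lborel. F i x * \<psi> x)" for i
      unfolding F_def by (rule multiplication_formula[OF f_int schwartz_integrable[OF \<psi>]])
    ultimately have "(\<lambda>i. LINT x|lborel. F i x * \<psi> x) \<longlonglongrightarrow> (LINT x|lborel. g x * fourier \<psi> x)"
      "(\<lambda>i. LINT x|lborel. F i x * \<psi> x) \<longlonglongrightarrow> (LINT x|lborel. G x * \<psi> x)" by simp_all
    then show ?thesis by (rule LIMSEQ_unique)
  qed
  then show ?thesis using nG by (intro bexI[of _ G]) auto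
qed


subsection \<open>Convolution with a frequency cutoff\<close>

text \<open>Below the height \<open>c\<close> the first term suffices. Above it
  \<open>a = a^(1-r) a^r\<close>, and \<open>a^(1-r)\<close> is at most \<open>c^(1-r)\<close>
  because the exponent is not positive.\<close>

lemma le_truncation_bound:
  fixes a c r :: real
  assumes "a \<ge> 0" "c > 0" "r \<ge> 1"
  shows "a \<le> c + c powr (1 - r) * a powr r"
proof (cases "a \<le> c")
  case True
  moreover have "0 \<le> c powr (1 - r) * a powr r" by simp
  ultimately show ?thesis by linarith
next
  case False
  then have "a powr (1 - r) \<le> c powr (1 - r)" using assms by (intro powr_mono2') auto
  then have "a powr (1 - r) * a powr r \<le> c powr (1 - r) * a powr r" by (rule mult_right_mono) simp
  moreover have "a powr (1 - r) * a powr r = a" using False assms by (simp add: powr_add[symmetric])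
  ultimately show ?thesis using assms by linarith
qed

text \<open>Young's inequality from \<open>L\<^sup>r\<close> to \<open>L\<^sup>2\<close> with a bounded integrable kernel: split \<open>|g|\<close> at the
  height \<open>c = p(z)\<^bsup>1/r\<^esup>\<close>, where \<open>p\<close> is the convolution of \<open>|g|\<^sup>r\<close> and \<open>|h|\<close>.\<close>

lemma bernstein_L2:
  fixes g h :: "real^'n \<Rightarrow> complex"
  assumes [measurable]: "g \<in> borel_measurable borel" "h \<in> borel_measurable borel"
    and r: "1 \<le> r" "r \<le> 2"
    and h1: "(\<integral>\<^sup>+x. ennreal (norm (h x)) \<partial>lborel) \<le> ennreal H1" "0 \<le> H1"
    and hi: "\<And>x. norm (h x) \<le> Hi"
    and P: "(\<integral>\<^sup>+x. ennreal (norm (g x) powr r) \<partial>lborel) = ennreal P" "0 \<le> P"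
  shows "(\<integral>\<^sup>+z. (\<integral>\<^sup>+x. ennreal (norm (g x * h (z - x))) \<partial>lborel)\<^sup>2 \<partial>lborel)
    \<le> ennreal ((H1 + 1)\<^sup>2 * (Hi * P) powr (2 / r - 1) * (H1 * P))"
proof -
  have Hi: "0 \<le> Hi" using hi[of 0] norm_ge_zero order_trans by blast
  define A where "A z = (\<integral>\<^sup>+x. ennreal (norm (g x * h (z - x))) \<partial>lborel)" for z
  define p where "p z = (\<integral>\<^sup>+x. ennreal (norm (g x) powr r) * ennreal (norm (h (z - x))) \<partial>lborel)" for z
  have [measurable]: "p \<in> borel_measurable borel"
    unfolding p_def by (rule lborel.borel_measurable_nn_integral) measurable
  have hz: "(\<integral>\<^sup>+x. ennreal (norm (h (z - x))) \<partial>lborel) \<le> ennreal H1" for z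
    using nn_integral_lborel_affine[of "\<lambda>x. ennreal (norm (h x))" "-1" z] h1(1) by simp
  have p_le: "p z \<le> ennreal (Hi * P)" for z
  proof -
    have "p z \<le> (\<integral>\<^sup>+x. ennreal Hi * ennreal (norm (g x) powr r) \<partial>lborel)"
      unfolding p_def by (intro nn_integral_mono) (simp add: mult.commute mult_right_mono ennreal_leI hi)
    also have "\<dots> = ennreal (Hi * P)"
      using Hi P by (simp add: nn_integral_cmult ennreal_mult)
    finally show ?thesis .
  qed
  have p_int: "(\<integral>\<^sup>+z. p z \<partial>lborel) \<le> ennreal (H1 * P)"
  proof -
    have "(\<integral>\<^sup>+z. p z \<partial>lborel) = (\<integral>\<^sup>+x. \<integral>\<^sup>+z. ennreal (norm (g x) powr r) * ennreal (norm (h (z - x))) \<partial>lborel \<partial>lborel)"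
      unfolding p_def by (rule lborel_pair.Fubini') measurable
    also have "\<dots> = (\<integral>\<^sup>+x. ennreal (norm (g x) powr r) * (\<integral>\<^sup>+z. ennreal (norm (h z)) \<partial>lborel) \<partial>lborel)"
    proof (rule nn_integral_cong)
      fix x :: "real^'n"
      have "(\<integral>\<^sup>+z. ennreal (norm (h (z + (- x)))) \<partial>lborel) = (\<integral>\<^sup>+z. ennreal (norm (h z)) \<partial>lborel)"
        by (rule nn_integral_lborel_translate) measurable
      then show "(\<integral>\<^sup>+z. ennreal (norm (g x) powr r) * ennreal (norm (h (z - x))) \<partial>lborel)
          = ennreal (norm (g x) powr r) * (\<integral>\<^sup>+z. ennreal (norm (h z)) \<partial>lborel)"
        by (subst nn_integral_cmult) simp_all
    qed
    also have "\<dots> = ennreal P * (\<integral>\<^sup>+z. ennreal (norm (h z)) \<partial>lborel)"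
      by (subst nn_integral_multc) (simp_all add: P)
    also have "\<dots> \<le> ennreal P * ennreal H1" by (intro mult_left_mono h1) simp
    finally show ?thesis using P h1 by (simp add: ennreal_mult mult.commute)
  qed
  have split: "A z \<le> ennreal (c * H1) + ennreal (c powr (1 - r)) * p z" if "c > 0" for z c
  proof -
    have "A z \<le> (\<integral>\<^sup>+x. ennreal c * ennreal (norm (h (z - x))) +
        ennreal (c powr (1 - r)) * (ennreal (norm (g x) powr r) * ennreal (norm (h (z - x)))) \<partial>lborel)"
      unfolding A_def
    proof (rule nn_integral_mono)
      fix x
      have "norm (g x) * norm (h (z - x)) \<le> (c + c powr (1 - r) * norm (g x) powr r) * norm (h (z - x))"
        using that r by (intro mult_right_mono le_truncation_bound) auto
      also have "\<dots> = c * norm (h (z - x)) + c powr (1 - r) * (norm (g x) powr r * norm (h (z - x)))"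
        by (simp add: algebra_simps)
      finally have "ennreal (norm (g x * h (z - x))) \<le> ennreal (c * norm (h (z - x)) + c powr (1 - r) * (norm (g x) powr r * norm (h (z - x))))"
        unfolding norm_mult by (rule ennreal_leI)
      also have "\<dots> = ennreal c * ennreal (norm (h (z - x))) +
          ennreal (c powr (1 - r)) * (ennreal (norm (g x) powr r) * ennreal (norm (h (z - x))))"
        using that by (subst ennreal_plus) (auto simp: ennreal_mult)
      finally show "ennreal (norm (g x * h (z - x))) \<le> ennreal c * ennreal (norm (h (z - x))) +
          ennreal (c powr (1 - r)) * (ennreal (norm (g x) powr r) * ennreal (norm (h (z - x))))" .
    qed
    also have "\<dots> = ennreal c * (\<integral>\<^sup>+x. ennreal (norm (h (z - x))) \<partial>lborel) + ennreal (c powr (1 - r)) * p z"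
      unfolding p_def by (subst nn_integral_add) (auto simp: nn_integral_cmult)
    also have "\<dots> \<le> ennreal c * ennreal H1 + ennreal (c powr (1 - r)) * p z"
      by (intro add_right_mono mult_left_mono hz) simp
    finally show ?thesis using that h1(2) by (simp add: ennreal_mult)
  qed
  let ?K = "(H1 + 1)\<^sup>2 * (Hi * P) powr (2 / r - 1)"
  have A2: "(A z)\<^sup>2 \<le> ennreal ?K * p z" for z
  proof -
    have "p z < \<infinity>" using p_le[of z] by (auto intro: le_less_trans)
    then obtain y where y: "p z = ennreal y" "0 \<le> y" by (cases "p z") auto
    have yle: "y \<le> Hi * P" using p_le[of z] Hi P(2) y by (simp add: ennreal_le_iff)
    show ?thesis
    proof (cases "y = 0")
      case True
      \<comment> \<open>For \<open>p z = 0\<close> the optimal height would be 0, which is excluded;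
        arbitrarily small heights are used instead. Dividing by \<open>H1 + 1\<close> avoids a
        separate case \<open>H1 = 0\<close>.\<close>
      have "A z \<le> 0"
      proof (rule ennreal_le_epsilon)
        fix e :: real assume e: "0 < e"
        have "A z \<le> ennreal (e / (H1 + 1) * H1)"
          using split[of "e / (H1 + 1)" z] e h1(2) y True by simp
        also have "\<dots> \<le> ennreal e"
          using e h1(2) by (intro ennreal_leI) (simp add: field_simps)
        finally show "A z \<le> 0 + ennreal e" by simp
      qed
      then show ?thesis by simp
    next
      case False
      then have ypos: "y > 0" using y by simp
      \<comment> \<open>At this height both terms of the splitting are multiples of
        \<open>y powr (1 / r)\<close>.\<close>
      have "y powr (1 / r) > 0" using ypos by simp
      from split[OF this, of z] have "A z \<le> ennreal (y powr (1 / r) * H1) + ennreal ((y powr (1 / r)) powr (1 - r)) * ennreal y"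
        unfolding y(1) .
      also have "\<dots> = ennreal (y powr (1 / r) * H1 + (y powr (1 / r)) powr (1 - r) * y)"
        using h1(2) y(2) by (simp add: ennreal_mult[symmetric] ennreal_plus[symmetric] del: ennreal_plus)
      also have "(y powr (1 / r)) powr (1 - r) * y = y powr (1 / r)"
      proof -
        have "(y powr (1 / r)) powr (1 - r) * y = y powr (1 / r * (1 - r)) * y powr 1"
          using ypos by (simp add: powr_powr)
        also have "\<dots> = y powr (1 / r * (1 - r) + 1)" by (rule powr_add[symmetric])
        also have "1 / r * (1 - r) + 1 = 1 / r" using r by (simp add: field_simps)
        finally show ?thesis .
      qed
      also have "y powr (1 / r) * H1 + y powr (1 / r) = (H1 + 1) * y powr (1 / r)" by (simp add: algebra_simps)
      finally have "(A z)\<^sup>2 \<le> (ennreal ((H1 + 1) * y powr (1 / r)))\<^sup>2" by (rule power_mono) simp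
      also have "\<dots> = ennreal (((H1 + 1) * y powr (1 / r))\<^sup>2)"
        using h1(2) by (simp add: ennreal_power)
      also have "\<dots> \<le> ennreal (?K * y)"
      proof (rule ennreal_leI)
        \<comment> \<open>Of \<open>y^(2/r)\<close> one full power is kept for integration in
          \<open>z\<close>; the rest, of exponent \<open>2/r - 1 >= 0\<close> since
          \<open>r <= 2\<close>, is estimated by the supremum of \<open>p\<close>.\<close>
        have "(y powr (1 / r))\<^sup>2 = y powr (1 / r + 1 / r)"
          by (simp only: power2_eq_square powr_add)
        also have "1 / r + 1 / r = (2 / r - 1) + 1" by simp
        also have "y powr \<dots> = y powr (2 / r - 1) * y powr 1" by (rule powr_add)
        also have "\<dots> = y powr (2 / r - 1) * y" using ypos by simp
        also have "\<dots> \<le> (Hi * P) powr (2 / r - 1) * y"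
          using yle ypos r by (intro mult_right_mono powr_mono2) (auto simp: field_simps)
        finally have "(H1 + 1)\<^sup>2 * (y powr (1 / r))\<^sup>2 \<le> (H1 + 1)\<^sup>2 * ((Hi * P) powr (2 / r - 1) * y)"
          by (rule mult_left_mono) simp
        then show "((H1 + 1) * y powr (1 / r))\<^sup>2 \<le> ?K * y" by (simp add: power_mult_distrib mult.assoc)
      qed
      also have "\<dots> = ennreal ?K * p z" unfolding y using y(2) by (intro ennreal_mult) auto
      finally show ?thesis .
    qed
  qed
  have "(\<integral>\<^sup>+z. (A z)\<^sup>2 \<partial>lborel) \<le> (\<integral>\<^sup>+z. ennreal ?K * p z \<partial>lborel)" by (rule nn_integral_mono) (rule A2)
  also have "\<dots> = ennreal ?K * (\<integral>\<^sup>+z. p z \<partial>lborel)" by (rule nn_integral_cmult) measurable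
  also have "\<dots> \<le> ennreal ?K * ennreal (H1 * P)" by (intro mult_left_mono p_int) simp
  also have "\<dots> = ennreal (?K * (H1 * P))"
    using h1(2) P(2) by (intro ennreal_mult[symmetric]) auto
  finally show ?thesis unfolding A_def .
qed

section \<open>From multiplication by a cutoff to convolution with its kernel\<close>

lemma inv_fourier_integrable:
  assumes "schwartz f"
  shows "integrable lborel (inv_fourier f)"
proof -
  have "integrable lborel (\<lambda>x. fourier f (0 + (-1) *\<^sub>R x) /\<^sub>R (2 * pi) ^ CARD('n))" if "schwartz f" for f :: "real^'n \<Rightarrow> complex"
    by (intro integrable_scaleR_right integrable_lborel_affine schwartz_integrable schwartz_fourier that) simp
  from this[OF assms] show ?thesis by (simp add: inv_fourier_eq[abs_def])
qed

lemma norm_inv_fourier_le: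
  fixes f :: "real^'n \<Rightarrow> complex"
  assumes "integrable lborel f"
  shows "norm (inv_fourier f x) \<le> inverse ((2 * pi) ^ CARD('n)) * (LINT x|lborel. norm (f x))"
  unfolding inv_fourier_eq norm_scaleR
  by (rule mult_mono) (auto intro: norm_fourier_le[OF assms])

text \<open>Writing \<open>\<kappa>\<close> as the transform of its kernel, the multiplication
  formula moves that transform onto \<open>\<theta>\<close> times a character, and the character
  becomes a translation. The \<open>2 * pi\<close> factors are contained in
  \<open>inv_fourier\<close>.\<close>

lemma fourier_mult_schwartz:
  fixes \<kappa> \<theta> :: "real^'n \<Rightarrow> complex"
  assumes \<kappa>: "schwartz \<kappa>" and \<theta>: "schwartz \<theta>"
  shows "fourier (\<lambda>\<xi>. \<kappa> \<xi> * \<theta> \<xi>) x = (LINT z|lborel. inv_fourier \<kappa> (z - x) * fourier \<theta> z)"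
proof -
  let ?h = "inv_fourier \<kappa>"
  have h: "integrable lborel ?h" by (rule inv_fourier_integrable[OF \<kappa>])
  have [measurable]: "?h \<in> borel_measurable borel" using h by auto
  have [measurable]: "fourier \<theta> \<in> borel_measurable borel" using schwartz_measurable[OF schwartz_fourier[OF \<theta>]] .
  have "fourier (\<lambda>\<xi>. \<kappa> \<xi> * \<theta> \<xi>) x = (LINT \<xi>|lborel. fourier ?h \<xi> * (cis (- (\<xi> \<bullet> x)) * \<theta> \<xi>))"
    by (simp add: fourier_def[of "\<lambda>\<xi>. \<kappa> \<xi> * \<theta> \<xi>"] fourier_inv_fourier_schwartz[OF \<kappa>] ac_simps)
  also have "\<dots> = (LINT y|lborel. ?h y * fourier (\<lambda>\<xi>. cis (- (\<xi> \<bullet> x)) * \<theta> \<xi>) y)"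
    by (rule multiplication_formula[symmetric]) (intro h cis_minus_integrable schwartz_integrable \<theta>)+
  also have "\<dots> = (LINT y|lborel. ?h y * fourier \<theta> (y + x))"
    by (simp add: fourier_def inner_add_right mult.assoc[symmetric] cis_mult)
  also have "\<dots> = (LINT z|lborel. ?h (z - x) * fourier \<theta> z)"
  proof -
    obtain C where C: "\<And>z. norm (fourier \<theta> z) \<le> C" using schwartz_bounded[OF schwartz_fourier[OF \<theta>]] by blast
    have "integrable lborel (\<lambda>y. ?h y * fourier \<theta> (y + x))"
    proof (rule Bochner_Integration.integrable_bound)
      show "integrable lborel (\<lambda>y. C * norm (?h y))" using h by simp
      have "norm (?h y * fourier \<theta> (y + x)) \<le> norm (C * norm (?h y))" for y
      proof -
        have "norm (?h y * fourier \<theta> (y + x)) \<le> norm (?h y) * C"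
          unfolding norm_mult by (rule mult_left_mono[OF C]) simp
        also have "\<dots> \<le> norm (C * norm (?h y))" by (simp add: mult.commute)
        finally show ?thesis .
      qed
      then show "AE y in lborel. norm (?h y * fourier \<theta> (y + x)) \<le> norm (C * norm (?h y))" by (intro AE_I2)
    qed measurable
    from integral_lborel_affine[OF this, of 1 "- x"] show ?thesis by simp
  qed
  finally show ?thesis .
qed

text \<open>Here \<open>w\<close> is the convolution of \<open>g\<close> with the kernel of
  \<open>\<kappa>\<close>, and the identity says weakly that its transform is
  \<open>\<kappa>\<close> times that of \<open>g\<close>. The bound of \<open>bernstein_L2\<close>,
  which concerns absolute values, controls \<open>w\<close> and also justifies Fubini.\<close>

lemma convolution_pairing:
  fixes g \<kappa> :: "real^'n \<Rightarrow> complex"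
  assumes [measurable]: "g \<in> borel_measurable borel" and \<kappa>: "schwartz \<kappa>"
    and r: "1 \<le> r" "r \<le> 2"
    and h1: "(\<integral>\<^sup>+x. ennreal (norm (inv_fourier \<kappa> x)) \<partial>lborel) \<le> ennreal H1" "0 \<le> H1"
    and hi: "\<And>x. norm (inv_fourier \<kappa> x) \<le> Hi"
    and P: "(\<integral>\<^sup>+x. ennreal (norm (g x) powr r) \<partial>lborel) = ennreal P" "0 \<le> P"
  shows "\<exists>w\<in>borel_measurable borel.
    (sq_integral lborel w) \<le> ennreal ((H1 + 1)\<^sup>2 * (Hi * P) powr (2 / r - 1) * (H1 * P)) \<and>
    (\<forall>\<theta>. schwartz \<theta> \<longrightarrow> (LINT x|lborel. g x * fourier (\<lambda>\<xi>. \<kappa> \<xi> * \<theta> \<xi>) x) = (LINT z|lborel. w z * fourier \<theta> z))"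
proof -
  let ?h = "inv_fourier \<kappa>"
  let ?B = "(H1 + 1)\<^sup>2 * (Hi * P) powr (2 / r - 1) * (H1 * P)"
  have [measurable]: "?h \<in> borel_measurable borel" using inv_fourier_integrable[OF \<kappa>] by auto
  define A where "A z = (\<integral>\<^sup>+x. ennreal (norm (g x * ?h (z - x))) \<partial>lborel)" for z
  have [measurable]: "A \<in> borel_measurable borel"
    unfolding A_def by (rule lborel.borel_measurable_nn_integral) measurable
  have A: "(\<integral>\<^sup>+z. (A z)\<^sup>2 \<partial>lborel) \<le> ennreal ?B"
    unfolding A_def by (rule bernstein_L2[OF _ _ r h1 hi P]) measurable
  define w where "w z = (LINT x|lborel. g x * ?h (z - x))" for z
  have [measurable]: "w \<in> borel_measurable borel"
    unfolding w_def by (rule lborel.borel_measurable_lebesgue_integral) measurable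
  \<comment> \<open>Where the convolution integral does not converge absolutely, \<open>w z\<close>
    is 0 by convention, so the bound holds at every point.\<close>
  have w: "ennreal (norm (w z)) \<le> A z" for z
    unfolding w_def A_def
    by (cases "integrable lborel (\<lambda>x. g x * ?h (z - x))")
       (auto intro: integral_norm_bound_ennreal simp: not_integrable_integral_eq)
  have "sq_integral lborel w \<le> (\<integral>\<^sup>+z. (A z)\<^sup>2 \<partial>lborel)"
    using power_mono[OF w, where n = 2] by (intro nn_integral_mono) (simp add: ennreal_power)
  then have wB: "sq_integral lborel w \<le> ennreal ?B" using A by (rule order_trans)
  have "(LINT x|lborel. g x * fourier (\<lambda>\<xi>. \<kappa> \<xi> * \<theta> \<xi>) x) = (LINT z|lborel. w z * fourier \<theta> z)"
    if \<theta>: "schwartz \<theta>" for \<theta>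
  proof -
    have [measurable]: "fourier \<theta> \<in> borel_measurable borel" using schwartz_measurable[OF schwartz_fourier[OF \<theta>]] .
    have fin\<theta>: "sq_integral lborel (fourier \<theta>) < \<infinity>"
      using schwartz_norm_power2_integrable[OF schwartz_fourier[OF \<theta>]] by (simp add: integrable_iff_bounded)
    have "(\<integral>\<^sup>+z. A z * ennreal (norm (fourier \<theta> z)) \<partial>lborel) \<le> (\<integral>\<^sup>+z. (A z)\<^sup>2 + ennreal ((norm (fourier \<theta> z))\<^sup>2) \<partial>lborel)"
    proof (rule nn_integral_mono)
      fix z
      \<comment> \<open>Since \<open>A z\<close> may be infinite, the product is compared with the
        square of the larger factor.\<close>
      show "A z * ennreal (norm (fourier \<theta> z)) \<le> (A z)\<^sup>2 + ennreal ((norm (fourier \<theta> z))\<^sup>2)"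
      proof (cases "A z \<le> ennreal (norm (fourier \<theta> z))")
        case True
        then have "A z * ennreal (norm (fourier \<theta> z)) \<le> ennreal (norm (fourier \<theta> z)) * ennreal (norm (fourier \<theta> z))"
          by (rule mult_right_mono) simp
        also have "\<dots> = ennreal ((norm (fourier \<theta> z))\<^sup>2)" by (simp add: ennreal_mult[symmetric] power2_eq_square)
        finally show ?thesis by (simp add: add_increasing)
      next
        case False
        then have "A z * ennreal (norm (fourier \<theta> z)) \<le> A z * A z"
          by (intro mult_left_mono) auto
        then show ?thesis by (simp add: power2_eq_square add_increasing2)
      qed
    qed
    also have "\<dots> = (\<integral>\<^sup>+z. (A z)\<^sup>2 \<partial>lborel) + sq_integral lborel (fourier \<theta>)"
      by (rule nn_integral_add) measurable
    also have "\<dots> < \<infinity>" using A fin\<theta> by (auto intro: le_less_trans)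
    finally have fin: "(\<integral>\<^sup>+z. A z * ennreal (norm (fourier \<theta> z)) \<partial>lborel) < \<infinity>" .
    have "integrable (lborel \<Otimes>\<^sub>M lborel) (\<lambda>(z, x). g x * ?h (z - x) * fourier \<theta> z)"
      unfolding integrable_iff_bounded
    proof
      have "(\<integral>\<^sup>+p. ennreal (norm (case p of (z, x) \<Rightarrow> g x * ?h (z - x) * fourier \<theta> z)) \<partial>(lborel \<Otimes>\<^sub>M lborel))
          = (\<integral>\<^sup>+z. \<integral>\<^sup>+x. ennreal (norm (g x * ?h (z - x))) * ennreal (norm (fourier \<theta> z)) \<partial>lborel \<partial>lborel)"
        by (subst lborel.nn_integral_fst[symmetric]) (simp_all add: norm_mult ennreal_mult)
      also have "\<dots> = (\<integral>\<^sup>+z. A z * ennreal (norm (fourier \<theta> z)) \<partial>lborel)"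
        unfolding A_def by (intro nn_integral_cong nn_integral_multc) measurable
      finally show "(\<integral>\<^sup>+p. ennreal (norm (case p of (z, x) \<Rightarrow> g x * ?h (z - x) * fourier \<theta> z)) \<partial>(lborel \<Otimes>\<^sub>M lborel)) < \<infinity>"
        using fin by simp
    qed measurable
    from lborel_pair.Fubini_integral[OF this]
    have fub: "(LINT x|lborel. LINT z|lborel. g x * ?h (z - x) * fourier \<theta> z) = (LINT z|lborel. LINT x|lborel. g x * ?h (z - x) * fourier \<theta> z)" .
    have F1: "(LINT z|lborel. g x * ?h (z - x) * fourier \<theta> z) = g x * fourier (\<lambda>\<xi>. \<kappa> \<xi> * \<theta> \<xi>) x" for x
      unfolding fourier_mult_schwartz[OF \<kappa> \<theta>] mult.assoc by (rule integral_mult_right_zero)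
    have F2: "(LINT x|lborel. g x * ?h (z - x) * fourier \<theta> z) = w z * fourier \<theta> z" for z
      unfolding w_def by (rule integral_mult_left_zero)
    show ?thesis using fub unfolding F1 F2 .
  qed
  then show ?thesis using wB by (intro bexI[of _ w]) auto
qed

text \<open>The cutoff \<open>\<kappa>\<close> is inserted twice, using
  \<open>\<phi> = \<phi> \<kappa>^2\<close>: one copy turns the block into a convolution, the other
  confines \<open>m\<close> to the frequencies where \<open>\<kappa> m\<close> is at most
  \<open>M\<close>.\<close>

lemma multiplier_block_bound:
  fixes \<phi> \<kappa> m :: "real^'n \<Rightarrow> real"
  assumes \<kappa>: "schwartz (\<lambda>\<xi>. of_real (\<kappa> \<xi>))" "\<And>k. symbol_class k 0 \<kappa>"
    and m: "\<And>k. symbol_class k 0 m"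
    and \<phi>\<kappa>: "\<And>\<xi>. \<phi> \<xi> * \<kappa> \<xi> = \<phi> \<xi>"
    and M: "\<And>\<xi>. \<bar>\<kappa> \<xi> * m \<xi>\<bar> \<le> M"
    and g: "represents g (distr_inv_fourier (distr_mult \<phi> (distr_fourier f)))"
    and r: "1 \<le> r" "r \<le> 2"
    and h1: "(\<integral>\<^sup>+x. ennreal (norm (inv_fourier (\<lambda>\<xi>. of_real (\<kappa> \<xi>)) x)) \<partial>lborel) \<le> ennreal H1" "0 \<le> H1"
    and hi: "\<And>x. norm (inv_fourier (\<lambda>\<xi>. of_real (\<kappa> \<xi>)) x) \<le> Hi"
    and P: "(\<integral>\<^sup>+x. ennreal (norm (g x) powr r) \<partial>lborel) = ennreal P" "0 \<le> P"
  shows "\<exists>G. represents G (distr_mult m (distr_fourier (distr_inv_fourier (distr_mult \<phi> (distr_fourier f))))) \<and>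
    (sq_integral lborel G) \<le> ennreal (M\<^sup>2 * (2 * pi) ^ CARD('n) * ((H1 + 1)\<^sup>2 * (Hi * P) powr (2 / r - 1) * (H1 * P)))"
proof -
  let ?\<kappa> = "\<lambda>\<xi>. complex_of_real (\<kappa> \<xi>)"
  let ?B = "(H1 + 1)\<^sup>2 * (Hi * P) powr (2 / r - 1) * (H1 * P)"
  let ?u = "distr_inv_fourier (distr_mult \<phi> (distr_fourier f))"
  have B: "0 \<le> ?B" using h1(2) P(2) by simp
  have [measurable]: "g \<in> borel_measurable borel" using g by (simp add: represents_def)
  obtain w where [measurable]: "w \<in> borel_measurable borel"
    and w: "sq_integral lborel w \<le> ennreal ?B"
    and wp: "\<And>\<theta>. schwartz \<theta> \<Longrightarrow> (LINT x|lborel. g x * fourier (\<lambda>\<xi>. ?\<kappa> \<xi> * \<theta> \<xi>) x) = (LINT z|lborel. w z * fourier \<theta> z)"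
    using convolution_pairing[OF \<open>g \<in> borel_measurable borel\<close> \<kappa>(1) r h1 hi P] by blast
  have "sq_integral lborel w < \<infinity>" using w by (auto intro: le_less_trans)
  then obtain G0 where [measurable]: "G0 \<in> borel_measurable borel"
    and G0: "sq_integral lborel G0 \<le> ennreal ((2 * pi) ^ CARD('n)) * sq_integral lborel w"
    and G0p: "\<And>\<psi>. schwartz \<psi> \<Longrightarrow> (LINT x|lborel. w x * fourier \<psi> x) = (LINT x|lborel. G0 x * \<psi> x)"
    using L2_fourier_exists[of w] by auto
  have [measurable]: "\<kappa> \<in> borel_measurable borel" "m \<in> borel_measurable borel"
    using symbol_class_differentiable[OF \<kappa>(2)] symbol_class_differentiable[OF m]
    by (auto intro!: borel_measurable_continuous_onI continuous_at_imp_continuous_on differentiable_imp_continuous_within)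
  \<comment> \<open>\<open>G0\<close> is the L^2 transform of the convolution \<open>w\<close>, so
    it already carries the first copy of \<open>\<kappa>\<close>.\<close>
  let ?G = "\<lambda>\<xi>. G0 \<xi> * of_real (\<kappa> \<xi> * m \<xi>)"
  have "0 \<le> M" using M[of 0] by linarith
  have "(\<integral>\<^sup>+x. ennreal ((norm (?G x))\<^sup>2) \<partial>lborel) \<le> (\<integral>\<^sup>+x. ennreal (M\<^sup>2) * ennreal ((norm (G0 x))\<^sup>2) \<partial>lborel)"
  proof (rule nn_integral_mono)
    fix x
    have "(norm (?G x))\<^sup>2 = \<bar>\<kappa> x * m x\<bar>\<^sup>2 * (norm (G0 x))\<^sup>2"
      by (simp only: norm_mult norm_of_real power_mult_distrib mult.commute)
    also have "\<dots> \<le> M\<^sup>2 * (norm (G0 x))\<^sup>2"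
      by (intro mult_right_mono power_mono M) auto
    finally show "ennreal ((norm (?G x))\<^sup>2) \<le> ennreal (M\<^sup>2) * ennreal ((norm (G0 x))\<^sup>2)"
      by (subst ennreal_mult[symmetric]) (auto intro: ennreal_leI)
  qed
  also have "\<dots> = ennreal (M\<^sup>2) * sq_integral lborel G0"
    by (rule nn_integral_cmult) measurable
  also have "\<dots> \<le> ennreal (M\<^sup>2) * (ennreal ((2 * pi) ^ CARD('n)) * ennreal ?B)"
    by (intro mult_left_mono order_trans[OF G0] w) auto
  also have "\<dots> = ennreal (M\<^sup>2 * (2 * pi) ^ CARD('n) * ?B)"
  proof -
    have "ennreal ((2 * pi) ^ CARD('n)) * ennreal ?B = ennreal ((2 * pi) ^ CARD('n) * ?B)"
      by (rule ennreal_mult[symmetric]) (simp, rule B)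
    moreover have "ennreal (M\<^sup>2) * ennreal ((2 * pi) ^ CARD('n) * ?B) = ennreal (M\<^sup>2 * ((2 * pi) ^ CARD('n) * ?B))"
      by (rule ennreal_mult[symmetric]) (simp, intro mult_nonneg_nonneg[OF _ B], simp)
    ultimately show ?thesis by (simp only: mult.assoc)
  qed
  finally have bound: "(\<integral>\<^sup>+x. ennreal ((norm (?G x))\<^sup>2) \<partial>lborel) \<le> ennreal (M\<^sup>2 * (2 * pi) ^ CARD('n) * ?B)" .
  have "represents ?G (distr_mult m (distr_fourier ?u))"
    unfolding represents_def
  proof (intro conjI allI impI)
    show "?G \<in> borel_measurable lborel" by measurable
    fix \<psi> :: "real^'n \<Rightarrow> complex" assume \<psi>: "schwartz \<psi>"
    have [measurable]: "\<psi> \<in> borel_measurable borel" using \<psi> by (rule schwartz_measurable)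
    show "integrable lborel (\<lambda>x. ?G x * \<psi> x)"
    proof (rule integrable_mult_of_power2)
      show "(\<integral>\<^sup>+x. ennreal ((norm (?G x))\<^sup>2) \<partial>lborel) < \<infinity>" using bound by (auto intro: le_less_trans)
      show "sq_integral lborel \<psi> < \<infinity>"
        using schwartz_norm_power2_integrable[OF \<psi>] by (simp add: integrable_iff_bounded)
    qed measurable
    define \<mu> where "\<mu> = (\<lambda>\<xi>. m \<xi> *\<^sub>R \<psi> \<xi>)"
    define \<theta> where "\<theta> = (\<lambda>\<xi>. \<kappa> \<xi> *\<^sub>R \<mu> \<xi>)"
    \<comment> \<open>\<open>\<theta>'\<close> carries both copies of \<open>\<kappa>\<close>;
      multiplication by \<open>\<phi>\<close> does not distinguish it from \<open>\<mu>\<close>,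
      which permits the replacement below.\<close>
    define \<theta>' where "\<theta>' = (\<lambda>\<xi>. \<kappa> \<xi> *\<^sub>R \<theta> \<xi>)"
    have s: "schwartz \<mu>" "schwartz \<theta>" "schwartz \<theta>'"
      unfolding \<theta>'_def \<theta>_def \<mu>_def by (intro schwartz_mult_bounded_symbol \<kappa>(2) m \<psi>)+
    have "distr_mult m (distr_fourier ?u) \<psi> = f (fourier (\<lambda>\<xi>. \<phi> \<xi> *\<^sub>R inv_fourier (fourier \<mu>) \<xi>))"
      by (simp add: distr_mult_def distr_fourier_def distr_inv_fourier_def \<mu>_def)
    also have "\<dots> = f (fourier (\<lambda>\<xi>. \<phi> \<xi> *\<^sub>R inv_fourier (fourier \<theta>') \<xi>))"
      unfolding s[THEN inv_fourier_fourier_schwartz]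
      by (simp add: \<theta>'_def \<theta>_def \<phi>\<kappa> mult.assoc[symmetric])
    also have "\<dots> = ?u (fourier \<theta>')"
      by (simp add: distr_mult_def distr_fourier_def distr_inv_fourier_def)
    also have "\<dots> = (LINT x|lborel. g x * fourier \<theta>' x)"
      using g schwartz_fourier[OF s(3)] by (simp add: represents_def)
    also have "\<dots> = (LINT z|lborel. w z * fourier \<theta> z)"
      using wp[OF s(2)] by (simp add: \<theta>'_def scaleR_conv_of_real)
    also have "\<dots> = (LINT x|lborel. G0 x * \<theta> x)" by (rule G0p[OF s(2)])
    also have "\<dots> = (LINT x|lborel. ?G x * \<psi> x)"
      by (simp add: \<theta>_def \<mu>_def scaleR_conv_of_real mult.assoc)
    finally show "distr_mult m (distr_fourier ?u) \<psi> = (LINT x|lborel. ?G x * \<psi> x)" .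
  qed
  then show ?thesis using bound by blast
qed


subsection \<open>Littlewood-Paley blocks\<close>

lemma enn_powr_mono: "a \<le> b \<Longrightarrow> 0 \<le> c \<Longrightarrow> enn_powr a c \<le> enn_powr b c"
  unfolding enn_powr_def
  by (auto simp: top_unique less_top[symmetric] intro!: ennreal_leI powr_mono2 enn2real_mono)

lemma enn_powr_ennreal: "0 \<le> a \<Longrightarrow> enn_powr (ennreal a) c = ennreal (a powr c)"
  by (simp add: enn_powr_def)

lemma ennreal_cancel_left:
  assumes "0 < K"
  shows "ennreal (1 / K) * (ennreal K * x) = x"
proof -
  have "ennreal (1 / K) * ennreal K = ennreal (1 / K * K)" using assms by (intro ennreal_mult[symmetric]) auto
  also have "1 / K * K = 1" using assms by simp
  finally show ?thesis by (simp add: mult.assoc[symmetric])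
qed

lemma smooth_of_symbol_class: "(\<And>k. symbol_class k a f) \<Longrightarrow> smooth f"
  using symbol_class_all_iff by blast

lemma inv_fourier_dilation:
  fixes f :: "real^'n \<Rightarrow> complex"
  assumes f: "integrable lborel f" and c: "c > 0"
  shows "inv_fourier (\<lambda>\<xi>. f (c *\<^sub>R \<xi>)) x = inverse (c ^ CARD('n)) *\<^sub>R inv_fourier f (x /\<^sub>R c)"
proof -
  have e: "(x /\<^sub>R c) \<bullet> (0 + c *\<^sub>R \<xi>) = x \<bullet> \<xi>" for \<xi> using c by simp
  have "integrable lborel (\<lambda>\<xi>. cis (1 * (\<xi> \<bullet> (x /\<^sub>R c))) * f \<xi>)" by (rule cis_integrable[OF f])
  then have i: "integrable lborel (\<lambda>\<xi>. cis ((x /\<^sub>R c) \<bullet> \<xi>) * f \<xi>)" by (simp add: inner_commute)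
  have "(LINT \<xi>|lborel. cis ((x /\<^sub>R c) \<bullet> \<xi>) * f \<xi>) = \<bar>c\<bar> ^ DIM(real^'n) *\<^sub>R (LINT \<xi>|lborel. cis (x \<bullet> \<xi>) * f (c *\<^sub>R \<xi>))"
    using integral_lborel_affine[OF i, of c 0] c unfolding e by simp
  then show ?thesis using c by (simp add: inv_fourier_def)
qed

text \<open>The three terms belong to the block indices -1, 0 and 1. The cutoff around the block
  \<open>q\<close> is the dilation of this one by \<open>2 powi (- q)\<close>.\<close>

definition cutoff_neighbours :: "(real^'n \<Rightarrow> real) \<Rightarrow> real^'n \<Rightarrow> real"
  where "cutoff_neighbours \<phi> \<xi> = \<phi> (2 *\<^sub>R \<xi>) + \<phi> \<xi> + \<phi> ((1/2) *\<^sub>R \<xi>)"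

context
  fixes \<phi> :: "real^'n \<Rightarrow> real"
  assumes \<phi>: "lp_cutoff \<phi>"
begin

section \<open>The cutoff, its neighbours and the size of the symbol on a block\<close>

lemma lp_cutoff_support:
  assumes "\<phi> \<xi> \<noteq> 0"
  shows "3/4 \<le> norm \<xi>" "norm \<xi> \<le> 8/3"
proof -
  have "\<xi> \<in> closure {\<xi>. \<phi> \<xi> \<noteq> 0}" using assms closure_subset[of "{\<xi>. \<phi> \<xi> \<noteq> 0}"] by auto
  then show "3/4 \<le> norm \<xi>" "norm \<xi> \<le> 8/3" using \<phi> by (auto simp: lp_cutoff_def)
qed

lemma lp_cutoff_range: "0 \<le> \<phi> \<xi>" "\<phi> \<xi> \<le> 1"
proof -
  have "range \<phi> \<subseteq> {0..1}" using \<phi> by (simp only: lp_cutoff_def)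
  then have "\<phi> \<xi> \<in> {0..1}" by blast
  then show "0 \<le> \<phi> \<xi>" "\<phi> \<xi> \<le> 1" by auto
qed

lemma lp_cutoff_symbol_class: "symbol_class k 0 \<phi>"
proof (rule smooth_compact_support_symbol_class)
  show "smooth \<phi>" using \<phi> by (simp add: lp_cutoff_def)
  show "bounded {x. \<phi> x \<noteq> 0}" using lp_cutoff_support(2) unfolding bounded_iff by blast
qed

text \<open>For \<open>|k| >= 2\<close> the point \<open>2^(-k) \<xi>\<close> misses the annulus,
  since (1/4)(8/3) < 3/4 and 4 (3/4) > 8/3. The partition of unity therefore reduces to the terms k
  = -1, 0, 1.\<close>

lemma cutoff_neighbours_eq_1:
  assumes "\<phi> \<xi> \<noteq> 0"
  shows "cutoff_neighbours \<phi> \<xi> = 1"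
proof -
  have n: "3/4 \<le> norm \<xi>" "norm \<xi> \<le> 8/3" using lp_cutoff_support[OF assms] .
  then have "\<xi> \<noteq> 0" by auto
  then have "((\<lambda>k::int. \<phi> (2 powi (- k) *\<^sub>R \<xi>)) has_sum 1) UNIV" using \<phi> by (simp add: lp_cutoff_def)
  also have "?this \<longleftrightarrow> ((\<lambda>k::int. \<phi> (2 powi (- k) *\<^sub>R \<xi>)) has_sum 1) {-1, 0, 1}"
  proof (rule has_sum_cong_neutral)
    fix k :: int assume k: "k \<in> UNIV - {-1, 0, 1}"
    show "\<phi> (2 powi (- k) *\<^sub>R \<xi>) = 0"
    proof (rule ccontr)
      assume "\<phi> (2 powi (- k) *\<^sub>R \<xi>) \<noteq> 0"
      from lp_cutoff_support[OF this]
      have b: "3/4 \<le> 2 powi (- k) * norm \<xi>" "2 powi (- k) * norm \<xi> \<le> 8/3" by simp_all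
      consider "k \<ge> 2" | "k \<le> -2" using k by force
      then show False
      proof cases
        case 1
        then have "(2::real) powi (- k) \<le> 2 powi (-2)" by (intro power_int_increasing) auto
        then have "2 powi (- k) * norm \<xi> \<le> (1/4) * (8/3)"
          using n by (intro mult_mono) (auto simp: power_int_minus)
        then show False using b by simp
      next
        case 2
        then have "(2::real) powi 2 \<le> 2 powi (- k)" by (intro power_int_increasing) auto
        then have "4 * (3/4) \<le> 2 powi (- k) * norm \<xi>"
          using n by (intro mult_mono) auto
        then show False using b by simp
      qed
    qed
  qed auto
  finally have "(\<Sum>k\<in>{-1, 0, 1::int}. \<phi> (2 powi (- k) *\<^sub>R \<xi>)) = 1"
    using has_sum_unique has_sum_finite[of "{-1, 0, 1::int}"] by blast
  then show ?thesis by (simp add: cutoff_neighbours_def power_int_minus)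
qed

lemma cutoff_mult_neighbours: "\<phi> \<xi> * cutoff_neighbours \<phi> \<xi> = \<phi> \<xi>"
  using cutoff_neighbours_eq_1 by (cases "\<phi> \<xi> = 0") auto

lemma cutoff_neighbours_support:
  assumes "cutoff_neighbours \<phi> \<xi> \<noteq> 0"
  shows "3/8 \<le> norm \<xi>" "norm \<xi> \<le> 16/3"
proof -
  have "\<phi> (2 *\<^sub>R \<xi>) \<noteq> 0 \<or> \<phi> \<xi> \<noteq> 0 \<or> \<phi> ((1/2) *\<^sub>R \<xi>) \<noteq> 0"
    using assms by (auto simp: cutoff_neighbours_def)
  then have "3/8 \<le> norm \<xi> \<and> norm \<xi> \<le> 16/3"
    using lp_cutoff_support[of "2 *\<^sub>R \<xi>"] lp_cutoff_support[of \<xi>] lp_cutoff_support[of "(1/2) *\<^sub>R \<xi>"] by auto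
  then show "3/8 \<le> norm \<xi>" "norm \<xi> \<le> 16/3" by auto
qed

lemma cutoff_neighbours_bounds: "0 \<le> cutoff_neighbours \<phi> \<xi>" "cutoff_neighbours \<phi> \<xi> \<le> 3"
  using lp_cutoff_range[of "2 *\<^sub>R \<xi>"] lp_cutoff_range[of \<xi>] lp_cutoff_range[of "(1/2) *\<^sub>R \<xi>"]
  by (auto simp: cutoff_neighbours_def)

lemma symbol_class_cutoff_neighbours: "symbol_class k 0 (\<lambda>\<xi>. cutoff_neighbours \<phi> (c *\<^sub>R \<xi>))"
  by (rule symbol_class_dilation)
     (unfold cutoff_neighbours_def[abs_def], intro symbol_class_add symbol_class_dilation lp_cutoff_symbol_class)

lemma schwartz_cutoff_neighbours:
  assumes "c > 0"
  shows "schwartz (\<lambda>\<xi>. of_real (cutoff_neighbours \<phi> (c *\<^sub>R \<xi>)))"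
proof (rule schwartz_of_smooth_compact_support)
  show "smooth (\<lambda>\<xi>. cutoff_neighbours \<phi> (c *\<^sub>R \<xi>))"
    by (rule smooth_of_symbol_class[OF symbol_class_cutoff_neighbours])
  have "norm \<xi> \<le> 16 / 3 / c" if "cutoff_neighbours \<phi> (c *\<^sub>R \<xi>) \<noteq> 0" for \<xi>
    using cutoff_neighbours_support(2)[OF that] assms by (simp add: field_simps)
  then show "bounded {\<xi>. cutoff_neighbours \<phi> (c *\<^sub>R \<xi>) \<noteq> 0}"
    unfolding bounded_iff by blast
qed

text \<open>Let \<open>a = 2^q\<close> and \<open>y = |\<xi>|^2\<close>, so that 9/64 a^2 <= y <=
  256/9 a^2. As 1 + 256/9 < 30, \<open>1 + y\<close> is at most 30 max(1, a^2). Hence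
  \<open>eta\<close> is at least a^2 / (6400 max(1, a^4)), where 6400 = 900 (64/9), and this is
  4^(-|q|) / 6400 for either sign of \<open>q\<close>.\<close>

lemma eta_ge_on_block:
  assumes "cutoff_neighbours \<phi> (2 powi (- q) *\<^sub>R \<xi>) \<noteq> 0"
  shows "2 powr (- 2 * \<bar>real_of_int q\<bar>) / 6400 \<le> eta \<xi>"
proof -
  define a where "a = (2::real) powi q"
  have a: "a > 0" unfolding a_def by simp
  have "2 powi (- q) * norm \<xi> = norm \<xi> / a"
    by (simp add: a_def power_int_minus divide_inverse)
  with cutoff_neighbours_support[OF assms] have x: "3/8 * a \<le> norm \<xi>" "norm \<xi> \<le> 16/3 * a"
    using a by (simp_all add: pos_le_divide_eq pos_divide_le_eq)
  define y where "y = (norm \<xi>)\<^sup>2"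
  have "(3/8 * a)\<^sup>2 \<le> y" unfolding y_def using x a by (intro power_mono) auto
  then have y1: "9/64 * a\<^sup>2 \<le> y" by (simp add: power_mult_distrib power_divide)
  have "y \<le> (16/3 * a)\<^sup>2" unfolding y_def using x a by (intro power_mono) auto
  then have y2: "y \<le> 256/9 * a\<^sup>2" by (simp add: power_mult_distrib power_divide)
  have y0: "0 \<le> y" unfolding y_def by simp
  have eta: "eta \<xi> = y / (1 + y)\<^sup>2" by (simp add: eta_def y_def)
  have key: "9/64 * a\<^sup>2 / (30 * B)\<^sup>2 \<le> eta \<xi>" if "1 + y \<le> 30 * B" for B
    unfolding eta using y0 y1 a that by (intro frac_le power_mono) auto
  have a2: "a = 2 powr q" unfolding a_def by (simp add: powr_real_of_int')
  show ?thesis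
  proof (cases "q \<ge> 0")
    case True
    then have "1 \<le> a" unfolding a2 by (simp add: ge_one_powr_ge_zero)
    then have a1: "1 \<le> a\<^sup>2" by simp
    then have "1 + y \<le> 30 * a\<^sup>2" using y2 by linarith
    note key[OF this]
    moreover have "9/64 * a\<^sup>2 / (30 * a\<^sup>2)\<^sup>2 = 1 / a\<^sup>2 / 6400"
      using a by (simp add: power2_eq_square field_simps)
    moreover have "1 / a\<^sup>2 = 2 powr (- 2 * \<bar>real_of_int q\<bar>)"
    proof -
      have "a\<^sup>2 = 2 powr (2 * q)" unfolding a2 power2_eq_square powr_add[symmetric] by simp
      then show ?thesis using True by (simp add: powr_minus divide_inverse)
    qed
    ultimately show ?thesis by simp
  next
    case False
    then have "a \<le> 1" unfolding a2 using powr_mono[of "real_of_int q" 0 2] by simp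
    then have "a\<^sup>2 \<le> 1" using a by (simp add: power_le_one)
    then have "1 + y \<le> 30 * 1" using y2 by linarith
    note key[OF this]
    moreover have "9/64 * a\<^sup>2 / (30 * 1)\<^sup>2 = a\<^sup>2 / 6400" by (simp add: power2_eq_square)
    moreover have "a\<^sup>2 = 2 powr (- 2 * \<bar>real_of_int q\<bar>)"
    proof -
      have "a\<^sup>2 = 2 powr (2 * q)" unfolding a2 power2_eq_square powr_add[symmetric] by simp
      then show ?thesis using False by simp
    qed
    ultimately show ?thesis by simp
  qed
qed

lemma cutoff_neighbours_exp_eta_le:
  assumes "t \<ge> 0"
  shows "\<bar>cutoff_neighbours \<phi> (2 powi (- q) *\<^sub>R \<xi>) * exp (- eta \<xi> * t)\<bar>
    \<le> 3 * exp (- (t / 6400 * 2 powr (- 2 * \<bar>real_of_int q\<bar>)))"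
proof (cases "cutoff_neighbours \<phi> (2 powi (- q) *\<^sub>R \<xi>) = 0")
  case False
  have "2 powr (- 2 * \<bar>real_of_int q\<bar>) / 6400 * t \<le> eta \<xi> * t"
    by (rule mult_right_mono[OF eta_ge_on_block[OF False] assms])
  then have "exp (- eta \<xi> * t) \<le> exp (- (t / 6400 * 2 powr (- 2 * \<bar>real_of_int q\<bar>)))"
    by (simp add: mult.commute)
  then show ?thesis
    using cutoff_neighbours_bounds[of "2 powi (- q) *\<^sub>R \<xi>"] unfolding abs_mult
    by (intro mult_mono) auto
qed simp

text \<open>Dilation keeps the L^1 norm \<open>H1\<close> of the kernel and multiplies its supremum
  \<open>Hi\<close> by \<open>2^(qn)\<close>. Taking the square root of
  \<open>(2^(qn) Hi P)^(2/r-1)\<close> produces the factor in \<open>q\<close>, and the powers of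
  \<open>P\<close> combine to \<open>P^(1/r)\<close>, the L^r norm of the block.\<close>

theorem block_estimate:
  fixes r :: real
  assumes r: "1 \<le> r" "r \<le> 2"
  shows "\<exists>C>0. \<forall>q F t. 0 \<le> t \<longrightarrow>
    distr_Lp_norm 2 (distr_mult (\<lambda>\<xi>. exp (- eta \<xi> * t)) (distr_fourier (lp_block \<phi> q F)))
    \<le> ennreal (C * exp (- (t / 6400 * 2 powr (- 2 * \<bar>real_of_int q\<bar>))) * 2 powr (real_of_int q * (real CARD('n) * (1 / r - 1 / 2))))
      * distr_Lp_norm (ennreal r) (lp_block \<phi> q F)"
proof -
  let ?n = "real CARD('n)"
  let ?s = "1 / r - 1 / 2"
  let ?\<kappa> = "\<lambda>\<xi>. complex_of_real (cutoff_neighbours \<phi> \<xi>)"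
  have \<kappa>s: "schwartz ?\<kappa>" using schwartz_cutoff_neighbours[of 1] by simp
  define H1 where "H1 = (LINT x|lborel. norm (inv_fourier ?\<kappa> x))"
  define Hi where "Hi = inverse ((2 * pi) ^ CARD('n)) * (LINT x|lborel. norm (?\<kappa> x))"
  have H1: "0 \<le> H1" unfolding H1_def by simp
  have Hi: "norm (inv_fourier ?\<kappa> x) \<le> Hi" for x
    unfolding Hi_def by (rule norm_inv_fourier_le[OF schwartz_integrable[OF \<kappa>s]])
  have Hi0: "0 \<le> Hi" using Hi[of 0] norm_ge_zero order_trans by blast
  have h_int: "integrable lborel (inv_fourier ?\<kappa>)" by (rule inv_fourier_integrable[OF \<kappa>s])
  \<comment> \<open>The part of the square root of the L^2 bound that is independent of
    \<open>q\<close>, \<open>t\<close> and the block: 3 bounds the neighbouring cutoffs, the power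
    of \<open>2 * pi\<close> comes from Plancherel, and the rest from Young's inequality.\<close>
  define C0 where "C0 = 3 * ((2 * pi) ^ CARD('n)) powr (1/2) * (H1 + 1) * Hi powr ?s * H1 powr (1/2)"
  have C0: "0 \<le> C0" unfolding C0_def using H1 by simp
  show ?thesis
  \<comment> \<open>Adding 1 makes the constant strictly positive, which the infinite case and the
    division by \<open>?K\<close> require.\<close>
  proof (intro exI[of _ "C0 + 1"] conjI allI impI)
    show "C0 + 1 > 0" using C0 by simp
    fix q :: int and F :: "'n distr set" and t :: real assume t: "0 \<le> t"
    let ?a = "2 powr (real_of_int q * ?n)"
    let ?c = "(2::real) powi (- q)"
    let ?e = "exp (- (t / 6400 * 2 powr (- 2 * \<bar>real_of_int q\<bar>)))"
    let ?u = "lp_block \<phi> q F"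
    let ?v = "distr_mult (\<lambda>\<xi>. exp (- eta \<xi> * t)) (distr_fourier ?u)"
    let ?\<kappa>q = "\<lambda>\<xi>. complex_of_real (cutoff_neighbours \<phi> (?c *\<^sub>R \<xi>))"
    let ?K = "(C0 + 1) * ?e * 2 powr (real_of_int q * (?n * ?s))"
    have c: "?c > 0" by simp
    have ca: "inverse (?c ^ CARD('n)) = ?a"
    proof -
      have "inverse (?c ^ CARD('n)) = (2 powi q) ^ CARD('n)"
        by (simp add: power_int_minus power_inverse)
      also have "\<dots> = (2 powr q) ^ CARD('n)" by (simp add: powr_real_of_int')
      also have "\<dots> = ?a" by (simp add: powr_powr powr_realpow[symmetric])
      finally show ?thesis .
    qed
    have hq: "inv_fourier ?\<kappa>q x = ?a *\<^sub>R inv_fourier ?\<kappa> (x /\<^sub>R ?c)" for x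
      using inv_fourier_dilation[OF schwartz_integrable[OF \<kappa>s] c, of x] unfolding ca by simp
    have hq_le: "norm (inv_fourier ?\<kappa>q x) \<le> ?a * Hi" for x
      unfolding hq by (simp add: mult_left_mono Hi)
    have hq_int: "(\<integral>\<^sup>+x. ennreal (norm (inv_fourier ?\<kappa>q x)) \<partial>lborel) \<le> ennreal H1"
    proof -
      have [measurable]: "inv_fourier ?\<kappa> \<in> borel_measurable borel" using h_int by auto
      have "ennreal H1 = (\<integral>\<^sup>+x. ennreal (norm (inv_fourier ?\<kappa> x)) \<partial>lborel)"
        unfolding H1_def by (rule nn_integral_eq_integral[symmetric]) (use h_int in auto)
      also have "\<dots> = ennreal (\<bar>inverse ?c\<bar> ^ DIM(real^'n)) * (\<integral>\<^sup>+x. ennreal (norm (inv_fourier ?\<kappa> (0 + inverse ?c *\<^sub>R x))) \<partial>lborel)"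
        by (rule nn_integral_lborel_affine) auto
      also have "\<bar>inverse ?c\<bar> ^ DIM(real^'n) = ?a"
        using c ca by (simp add: power_inverse)
      also have "ennreal ?a * (\<integral>\<^sup>+x. ennreal (norm (inv_fourier ?\<kappa> (0 + inverse ?c *\<^sub>R x))) \<partial>lborel)
          = (\<integral>\<^sup>+x. ennreal (norm (inv_fourier ?\<kappa>q x)) \<partial>lborel)"
        by (subst nn_integral_cmult[symmetric]) (simp_all add: hq ennreal_mult)
      finally show ?thesis by simp
    qed
    have each: "distr_Lp_norm 2 ?v \<le> ennreal ?K * Lp_norm lborel (ennreal r) (\<lambda>x. ennreal (norm (g x)))"
      if g: "represents g ?u" for g
    proof (cases "(\<integral>\<^sup>+x. ennreal (norm (g x) powr r) \<partial>lborel)")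
      case top
      \<comment> \<open>An infinite L^r norm makes the right side infinite, because its coefficient
        is nonzero.\<close>
      then have "Lp_norm lborel (ennreal r) (\<lambda>x. ennreal (norm (g x))) = \<infinity>"
        using r by (simp add: Lp_norm_def enn_powr_ennreal) (simp add: enn_powr_def)
      moreover have "ennreal ?K \<noteq> 0" using C0 by simp
      ultimately show ?thesis by (simp only: infinity_ennreal_def ennreal_mult_top if_False top_greatest)
    next
      case (real P)
      then have P: "(\<integral>\<^sup>+x. ennreal (norm (g x) powr r) \<partial>lborel) = ennreal P" "0 \<le> P" by auto
      have Lr: "Lp_norm lborel (ennreal r) (\<lambda>x. ennreal (norm (g x))) = ennreal (P powr (1 / r))"
        using r P by (simp add: Lp_norm_def enn_powr_ennreal)
      let ?X = "(3 * ?e)\<^sup>2 * (2 * pi) ^ CARD('n) * ((H1 + 1)\<^sup>2 * (?a * Hi * P) powr (2 / r - 1) * (H1 * P))"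
      have "\<exists>G. represents G ?v \<and> (sq_integral lborel G) \<le> ennreal ?X"
        unfolding lp_block_def
      proof (rule multiplier_block_bound[where \<kappa> = "\<lambda>\<xi>. cutoff_neighbours \<phi> (?c *\<^sub>R \<xi>)"])
        show "schwartz ?\<kappa>q" by (rule schwartz_cutoff_neighbours[OF c])
        show "represents g (distr_inv_fourier (distr_mult (\<lambda>\<xi>. \<phi> (?c *\<^sub>R \<xi>)) (distr_fourier (SOME f. f \<in> F))))"
          using g unfolding lp_block_def .
      qed (rule symbol_class_cutoff_neighbours symbol_class_exp_eta[OF t] cutoff_mult_neighbours
           cutoff_neighbours_exp_eta_le[OF t] r hq_int H1 hq_le P)+
      then obtain G where G: "represents G ?v" "sq_integral lborel G \<le> ennreal ?X" by blast
      have X0: "0 \<le> ?X" using H1 P by simp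
      have "distr_Lp_norm 2 ?v \<le> Lp_norm lborel 2 (\<lambda>x. ennreal (norm (G x)))"
        unfolding distr_Lp_norm_def using G(1) by (intro INF_lower) simp
      also have "\<dots> = enn_powr (sq_integral lborel G) (1/2)"
        by (simp add: Lp_norm_def enn_powr_ennreal powr_numeral)
      also have "\<dots> \<le> ennreal (?X powr (1/2))"
        using enn_powr_mono[OF G(2), of "1/2"] X0 by (simp only: enn_powr_ennreal)
      also have "?X powr (1/2) = C0 * ?e * 2 powr (real_of_int q * (?n * ?s)) * P powr (1 / r)"
      proof -
        have half: "((x::real)\<^sup>2) powr (1/2) = x" if "0 \<le> x" for x
          using that by (simp add: powr_half_sqrt)
        have "?X powr (1/2) = ((3 * ?e)\<^sup>2) powr (1/2) * ((2 * pi) ^ CARD('n)) powr (1/2) *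
            (((H1 + 1)\<^sup>2) powr (1/2) * ((?a * Hi * P) powr (2 / r - 1)) powr (1/2) * (H1 powr (1/2) * P powr (1/2)))"
          using H1 P(2) Hi0 by (simp only: powr_mult)
        also have "((3 * ?e)\<^sup>2) powr (1/2) = 3 * ?e" by (rule half) simp
        also have "((H1 + 1)\<^sup>2) powr (1/2) = H1 + 1" using H1 by (intro half) simp
        also have "((?a * Hi * P) powr (2 / r - 1)) powr (1/2) = (?a * Hi * P) powr ?s"
          by (simp add: powr_powr diff_divide_distrib)
        also have "(?a * Hi * P) powr ?s = ?a powr ?s * Hi powr ?s * P powr ?s"
          using P(2) Hi0 by (simp only: powr_mult)
        also have "?a powr ?s = 2 powr (real_of_int q * (?n * ?s))"
          by (simp only: powr_powr mult.assoc)
        finally have "?X powr (1/2) = C0 * ?e * 2 powr (real_of_int q * (?n * ?s)) * (P powr ?s * P powr (1/2))"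
          unfolding C0_def by (simp only: ac_simps)
        also have "P powr ?s * P powr (1/2) = P powr (1 / r)" by (simp only: powr_add[symmetric]) simp
        finally show ?thesis .
      qed
      also have "ennreal (C0 * ?e * 2 powr (real_of_int q * (?n * ?s)) * P powr (1 / r)) \<le> ennreal (?K * P powr (1 / r))"
        by (intro ennreal_leI mult_right_mono) simp_all
      also have "\<dots> = ennreal ?K * ennreal (P powr (1 / r))" using C0 by (intro ennreal_mult) simp_all
      finally show ?thesis unfolding Lr .
    qed
    have K: "?K > 0" using C0 by simp
    \<comment> \<open>Moving the constant to the left leaves a lower bound valid for every
      representing \<open>g\<close>, so the infimum can be taken; it is infinite if there is no such
      \<open>g\<close>.\<close>
    have "ennreal (1 / ?K) * distr_Lp_norm 2 ?v \<le> distr_Lp_norm (ennreal r) ?u"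
      unfolding distr_Lp_norm_def[of "ennreal r"]
    proof (rule INF_greatest)
      fix g assume "g \<in> {g. represents g ?u}"
      then have "ennreal (1 / ?K) * distr_Lp_norm 2 ?v \<le> ennreal (1 / ?K) * (ennreal ?K * Lp_norm lborel (ennreal r) (\<lambda>x. ennreal (norm (g x))))"
        using each by (intro mult_left_mono) auto
      also have "\<dots> = Lp_norm lborel (ennreal r) (\<lambda>x. ennreal (norm (g x)))"
        by (rule ennreal_cancel_left[OF K])
      finally show "ennreal (1 / ?K) * distr_Lp_norm 2 ?v \<le> Lp_norm lborel (ennreal r) (\<lambda>x. ennreal (norm (g x)))" .
    qed
    then have "ennreal ?K * (ennreal (1 / ?K) * distr_Lp_norm 2 ?v) \<le> ennreal ?K * distr_Lp_norm (ennreal r) ?u"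
      by (rule mult_left_mono) simp
    moreover have "ennreal ?K * (ennreal (1 / ?K) * distr_Lp_norm 2 ?v) = distr_Lp_norm 2 ?v"
      using ennreal_cancel_left[of "1 / ?K"] K by (simp only: divide_divide_eq_right mult_1 div_by_1 zero_less_divide_1_iff)
    ultimately show "distr_Lp_norm 2 ?v \<le> ennreal ?K * distr_Lp_norm (ennreal r) ?u" by simp
  qed
qed

end


subsection \<open>Summation over frequencies\<close>

lemma enn_powr_powr:
  assumes "0 < c"
  shows "enn_powr (enn_powr a c) (1 / c) = a"
  using assms by (cases a) (simp_all add: enn_powr_def powr_powr)

lemma enn_powr_cmult:
  assumes "0 < K" "0 < c"
  shows "enn_powr (ennreal K * a) c = ennreal (K powr c) * enn_powr a c"
proof (cases a)
  case (real x)
  then show ?thesis using assms by (simp add: ennreal_mult[symmetric] enn_powr_ennreal powr_mult)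
next
  case top
  then show ?thesis using assms by (simp add: enn_powr_def ennreal_mult_top)
qed

text \<open>Counting measure has no nonempty null set, so the essential supremum is the
  supremum.\<close>

lemma lr_norm_infinity: "lr_norm \<infinity> a = (SUP q. a q)"
proof (rule antisym)
  show "lr_norm \<infinity> a \<le> (SUP q. a q)"
    unfolding lr_norm_def Lp_norm_def by (auto intro!: esssup_I SUP_upper simp: AE_count_space)
  show "(SUP q. a q) \<le> lr_norm \<infinity> a"
  proof (rule SUP_least)
    fix q
    show "a q \<le> lr_norm \<infinity> a"
      using esssup_AE[of a "count_space UNIV"] by (simp add: lr_norm_def Lp_norm_def AE_count_space)
  qed
qed

lemma lr_norm_finite:
  assumes "\<alpha> \<noteq> \<infinity>"
  shows "lr_norm \<alpha> a = enn_powr (\<integral>\<^sup>+q. enn_powr (a q) (enn2real \<alpha>) \<partial>count_space UNIV) (1 / enn2real \<alpha>)"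
  using assms by (simp add: lr_norm_def Lp_norm_def)

lemma enn2real_ge_1:
  assumes "1 \<le> \<alpha>" "\<alpha> \<noteq> \<infinity>"
  shows "1 \<le> enn2real \<alpha>"
  using assms by (cases \<alpha>) (auto simp: ennreal_1[symmetric] simp del: ennreal_1)

lemma lr_norm_mono:
  assumes "1 \<le> \<alpha>" "\<And>q. a q \<le> b q"
  shows "lr_norm \<alpha> a \<le> lr_norm \<alpha> b"
proof (cases "\<alpha> = \<infinity>")
  case True
  then show ?thesis unfolding True lr_norm_infinity by (intro SUP_mono) (use assms(2) in blast)
next
  case False
  then show ?thesis
    using enn2real_ge_1[OF assms(1)] by (auto simp: lr_norm_finite intro!: enn_powr_mono nn_integral_mono assms(2))
qed

lemma lr_norm_cmult:
  assumes "1 \<le> \<alpha>" "0 < K"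
  shows "lr_norm \<alpha> (\<lambda>q. ennreal K * a q) = ennreal K * lr_norm \<alpha> a"
proof (cases "\<alpha> = \<infinity>")
  case True
  show ?thesis unfolding True lr_norm_infinity by (rule SUP_mult_left_ennreal[symmetric])
next
  case False
  have p: "1 \<le> enn2real \<alpha>" by (rule enn2real_ge_1[OF assms(1) False])
  have "(\<integral>\<^sup>+q. enn_powr (ennreal K * a q) (enn2real \<alpha>) \<partial>count_space UNIV)
      = ennreal (K powr enn2real \<alpha>) * (\<integral>\<^sup>+q. enn_powr (a q) (enn2real \<alpha>) \<partial>count_space UNIV)"
    using p assms(2) by (subst nn_integral_cmult[symmetric]) (auto simp: enn_powr_cmult)
  then show ?thesis
    using p assms(2) by (simp add: lr_norm_finite[OF False] enn_powr_cmult powr_powr)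
qed

text \<open>Every entry is at most the total sum \<open>S\<close>, so its \<open>\<alpha>\<close>-th
  power is at most \<open>S^(\<alpha>-1)\<close> times the entry. This reduces the low frequencies
  to a plain sum for every \<open>\<alpha>\<close>.\<close>

lemma lr_norm_le_nn_integral:
  assumes "1 \<le> \<alpha>"
  shows "lr_norm \<alpha> a \<le> (\<integral>\<^sup>+q. a q \<partial>count_space UNIV)"
proof -
  let ?S = "\<integral>\<^sup>+q. a q \<partial>count_space UNIV"
  have le: "a q \<le> ?S" for q
  proof -
    have "a q = (\<integral>\<^sup>+x. a x * indicator {q} x \<partial>count_space UNIV)" by simp
    also have "\<dots> \<le> ?S" by (intro nn_integral_mono) (simp add: indicator_def)
    finally show ?thesis .
  qed
  show ?thesis
  proof (cases "\<alpha> = \<infinity>")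
    case True
    show ?thesis unfolding True lr_norm_infinity by (rule SUP_least) (rule le)
  next
    case False
    have p: "1 \<le> enn2real \<alpha>" by (rule enn2real_ge_1[OF assms False])
    show ?thesis
    proof (cases ?S)
      case (real S)
      have "enn_powr (a q) (enn2real \<alpha>) \<le> ennreal (S powr (enn2real \<alpha> - 1)) * a q" for q
      proof -
        obtain x where x: "a q = ennreal x" "0 \<le> x"
          using le[of q] real by (cases "a q") (auto simp: top_unique)
        have "x \<le> S" using le[of q] real x by simp
        then have "x powr (enn2real \<alpha> - 1) * x \<le> S powr (enn2real \<alpha> - 1) * x"
          using x(2) p by (intro mult_right_mono powr_mono2) auto
        moreover have "x powr enn2real \<alpha> = x powr (enn2real \<alpha> - 1) * x"
          using x(2) powr_add[of x "enn2real \<alpha> - 1" 1] by (cases "x = 0") auto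
        ultimately show ?thesis
          using x by (simp add: enn_powr_ennreal ennreal_mult[symmetric] ennreal_leI)
      qed
      then have "(\<integral>\<^sup>+q. enn_powr (a q) (enn2real \<alpha>) \<partial>count_space UNIV) \<le> (\<integral>\<^sup>+q. ennreal (S powr (enn2real \<alpha> - 1)) * a q \<partial>count_space UNIV)"
        by (rule nn_integral_mono)
      also have "\<dots> = ennreal (S powr (enn2real \<alpha> - 1)) * ennreal S"
        using real by (subst nn_integral_cmult) auto
      also have "\<dots> = ennreal (S powr enn2real \<alpha>)"
        using real powr_add[of S "enn2real \<alpha> - 1" 1] by (cases "S = 0") (auto simp: ennreal_mult[symmetric])
      also have "\<dots> = enn_powr ?S (enn2real \<alpha>)" using real by (simp add: enn_powr_ennreal)
      finally have "lr_norm \<alpha> a \<le> enn_powr (enn_powr ?S (enn2real \<alpha>)) (1 / enn2real \<alpha>)"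
        unfolding lr_norm_finite[OF False] using p by (intro enn_powr_mono) auto
      then show ?thesis using p by (simp add: enn_powr_powr)
    qed simp
  qed
qed

text \<open>The sum is at most twice its larger term, and \<open>2 powr c\<close> is at most
  2.\<close>

lemma enn_powr_add_le:
  assumes "0 \<le> c" "c \<le> 1"
  shows "enn_powr (x + y) c \<le> ennreal 2 * (enn_powr x c + enn_powr y c)"
proof -
  have *: "enn_powr (x + y) c \<le> ennreal 2 * enn_powr y c" if "x \<le> y" for x y
  proof (cases y)
    case (real v)
    have "x \<le> ennreal v" using that real by simp
    then obtain u where u: "x = ennreal u" "0 \<le> u" by (cases x) (auto simp: top_unique)
    then have "u \<le> v" using that real by simp
    then have "(u + v) powr c \<le> (2 * v) powr c" using u assms by (intro powr_mono2) auto
    also have "\<dots> = 2 powr c * v powr c" using real by (simp add: powr_mult)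
    also have "\<dots> \<le> 2 powr 1 * v powr c" using assms by (intro mult_right_mono powr_mono) auto
    finally have "(u + v) powr c \<le> 2 * v powr c" by simp
    then show ?thesis
      using real u by (simp only: ennreal_plus[symmetric] enn_powr_ennreal add_nonneg_nonneg ennreal_mult[symmetric] zero_le_numeral powr_ge_zero ennreal_leI)
  next
    case top
    then show ?thesis by (simp add: enn_powr_def ennreal_mult_top)
  qed
  show ?thesis
  proof (cases "x \<le> y")
    case True
    then show ?thesis using *[OF True] by (auto intro: order_trans mult_left_mono add_increasing)
  next
    case False
    then have "enn_powr (y + x) c \<le> ennreal 2 * enn_powr x c" by (intro *) simp
    then show ?thesis by (auto simp: add.commute[of x] intro: order_trans mult_left_mono add_increasing2)
  qed
qed

text \<open>At each index only one of the two sequences contributes, so the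
  \<open>\<alpha>\<close>-th powers are dominated by their sum; the outer root has exponent at most
  1 and costs the factor 2.\<close>

lemma lr_norm_split_le:
  assumes "1 \<le> \<alpha>"
  shows "lr_norm \<alpha> (\<lambda>q. if Q q then a q else b q) \<le> ennreal 2 * (lr_norm \<alpha> a + lr_norm \<alpha> b)"
proof (cases "\<alpha> = \<infinity>")
  case True
  have "(SUP q. if Q q then a q else b q) \<le> (SUP q. a q) + (SUP q. b q)"
  proof (rule SUP_least)
    fix q
    have "a q \<le> (SUP q. a q)" "b q \<le> (SUP q. b q)" by (auto intro: SUP_upper)
    then show "(if Q q then a q else b q) \<le> (SUP q. a q) + (SUP q. b q)"
      by (auto intro: add_increasing add_increasing2)
  qed
  also have "\<dots> \<le> ennreal 2 * ((SUP q. a q) + (SUP q. b q))"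
    using mult_right_mono[of 1 "ennreal 2" "(SUP q. a q) + (SUP q. b q)"] by simp
  finally show ?thesis unfolding True lr_norm_infinity .
next
  case False
  let ?p = "enn2real \<alpha>"
  have p: "1 \<le> ?p" by (rule enn2real_ge_1[OF assms False])
  have "(\<integral>\<^sup>+q. enn_powr (if Q q then a q else b q) ?p \<partial>count_space UNIV)
      \<le> (\<integral>\<^sup>+q. enn_powr (a q) ?p + enn_powr (b q) ?p \<partial>count_space UNIV)"
    by (intro nn_integral_mono) (simp add: add_increasing add_increasing2)
  also have "\<dots> = (\<integral>\<^sup>+q. enn_powr (a q) ?p \<partial>count_space UNIV) + (\<integral>\<^sup>+q. enn_powr (b q) ?p \<partial>count_space UNIV)"
    by (rule nn_integral_add) auto
  finally have "lr_norm \<alpha> (\<lambda>q. if Q q then a q else b q)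
      \<le> enn_powr ((\<integral>\<^sup>+q. enn_powr (a q) ?p \<partial>count_space UNIV) + (\<integral>\<^sup>+q. enn_powr (b q) ?p \<partial>count_space UNIV)) (1 / ?p)"
    unfolding lr_norm_finite[OF False] using p by (intro enn_powr_mono) auto
  also have "\<dots> \<le> ennreal 2 * (lr_norm \<alpha> a + lr_norm \<alpha> b)"
    unfolding lr_norm_finite[OF False] using p by (intro enn_powr_add_le) auto
  finally show ?thesis .
qed

section \<open>Scalar estimates in \<open>t\<close> and \<open>q\<close>\<close>

text \<open>The right side is the value at the maximum \<open>y = a / c\<close>; the estimate is
  \<open>ln u <= u - 1\<close> at \<open>u = c * y / a\<close>.\<close>

lemma powr_mult_exp_le:
  fixes a c y :: real
  assumes "0 \<le> a" "0 < c" "0 < y"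
  shows "y powr a * exp (- (c * y)) \<le> exp (a * (ln (a / c) - 1))"
proof (cases "a = 0")
  case True
  then show ?thesis using assms by simp
next
  case False
  then have a: "0 < a" using assms by simp
  have "ln (c * y / a) \<le> c * y / a - 1" using a assms by (intro ln_le_minus_one) simp
  then have "a * ln (c * y / a) \<le> a * (c * y / a - 1)" using a by (intro mult_left_mono) auto
  then have "a * (ln y - ln (a / c)) \<le> c * y - a"
    using a assms by (simp add: ln_mult ln_div algebra_simps)
  then have "a * ln y - c * y \<le> a * (ln (a / c) - 1)" by (simp add: algebra_simps)
  moreover have "y powr a * exp (- (c * y)) = exp (a * ln y - c * y)"
    using assms by (simp add: powr_def exp_add[symmetric] mult.commute)
  ultimately show ?thesis by simp
qed

text \<open>The integers are covered by \<open>n\<close> and \<open>- n\<close> for natural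
  \<open>n\<close>; counting 0 twice only enlarges the sum, and each half is geometric with ratio
  \<open>2 powr (- \<sigma>)\<close>.\<close>

lemma nn_integral_geometric_int:
  fixes \<sigma> :: real
  assumes "0 < \<sigma>"
  shows "(\<integral>\<^sup>+j. ennreal (2 powr (- (\<sigma> * \<bar>real_of_int j\<bar>))) \<partial>count_space UNIV) < \<infinity>"
proof -
  let ?f = "\<lambda>j::int. ennreal (2 powr (- (\<sigma> * \<bar>real_of_int j\<bar>)))"
  let ?g = "\<lambda>n::nat. (2 powr (- \<sigma>)) ^ n"
  have g: "(\<Sum>n. ennreal (?g n)) < \<infinity>"
  proof -
    have "(2::real) powr (- \<sigma>) < 2 powr 0" using assms by (intro powr_less_mono) auto
    then have "summable ?g" by (intro summable_geometric) simp
    then show ?thesis by (subst suminf_ennreal2) auto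
  qed
  have half: "(\<integral>\<^sup>+j. ?f j * indicator (range h) j \<partial>count_space UNIV) = (\<Sum>n. ennreal (?g n))"
    if h: "inj h" "\<And>n. \<bar>real_of_int (h n)\<bar> = real n" for h :: "nat \<Rightarrow> int"
  proof -
    have "(\<integral>\<^sup>+j. ?f j * indicator (range h) j \<partial>count_space UNIV) = (\<integral>\<^sup>+j. ?f j \<partial>count_space (range h))"
      by (simp add: nn_integral_count_space_indicator)
    also have "\<dots> = (\<integral>\<^sup>+n. ?f (h n) \<partial>count_space UNIV)"
      by (rule nn_integral_bij_count_space[symmetric]) (simp add: bij_betw_def h(1))
    also have "\<dots> = (\<Sum>n. ennreal (?g n))"
      unfolding nn_integral_count_space_nat h(2) by (simp add: powr_realpow[symmetric] powr_powr)
    finally show ?thesis .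
  qed
  have "(\<integral>\<^sup>+j. ?f j \<partial>count_space UNIV) \<le> (\<integral>\<^sup>+j. ?f j * indicator (range int) j + ?f j * indicator (range (\<lambda>n. - int n)) j \<partial>count_space UNIV)"
  proof (rule nn_integral_mono)
    fix j :: int
    show "?f j \<le> ?f j * indicator (range int) j + ?f j * indicator (range (\<lambda>n. - int n)) j"
      by (cases j rule: int_cases2) (auto simp: indicator_def)
  qed
  also have "\<dots> = (\<integral>\<^sup>+j. ?f j * indicator (range int) j \<partial>count_space UNIV) + (\<integral>\<^sup>+j. ?f j * indicator (range (\<lambda>n. - int n)) j \<partial>count_space UNIV)"
    by (rule nn_integral_add) auto
  also have "\<dots> = (\<Sum>n. ennreal (?g n)) + (\<Sum>n. ennreal (?g n))"
    by (subst half, simp add: inj_def, simp, subst half) (auto simp: inj_def)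
  also have "\<dots> < \<infinity>" using g by simp
  finally show ?thesis .
qed

text \<open>Here \<open>x\<close> is the relevant power of \<open>4\<close>; the two factors combine in \<open>v = (1 + t) x\<close>.\<close>

lemma powr_mult_exp_rescale:
  fixes a c t x :: real
  assumes "0 < c" "0 \<le> t" "0 < x" "x \<le> 1"
  shows "x powr a * exp (- (c * t * x)) \<le> exp c * (1 + t) powr (- a) * (((1 + t) * x) powr a * exp (- (c * ((1 + t) * x))))"
proof -
  \<comment> \<open>Since \<open>x <= 1\<close>, replacing \<open>t\<close> by \<open>1 + t\<close>
    costs at most the factor \<open>exp c\<close>; this keeps the rate finite at
    \<open>t = 0\<close>.\<close>
  have "exp (- (c * t * x)) \<le> exp (c + - (c * ((1 + t) * x)))"
    using assms by (simp add: algebra_simps)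
  then have "exp (- (c * t * x)) \<le> exp c * exp (- (c * ((1 + t) * x)))" by (simp only: exp_add)
  then have "x powr a * exp (- (c * t * x)) \<le> x powr a * (exp c * exp (- (c * ((1 + t) * x))))"
    by (rule mult_left_mono) simp
  moreover have "x powr a = (1 + t) powr (- a) * ((1 + t) * x) powr a"
    using assms by (simp add: powr_mult powr_minus)
  ultimately show ?thesis by (simp only: ac_simps)
qed

text \<open>With \<open>x = 4^(-q)\<close> the left side is
  \<open>x^(\<beta>/2) exp (- c t x)\<close>; after rescaling, the maximum of
  \<open>v^(\<beta>/2) exp (- c v)\<close> bounds it uniformly in \<open>q\<close>. Nothing is
  summed, so \<open>\<beta> = 0\<close> is admissible, which covers \<open>r = 2\<close>,
  \<open>l = 0\<close>.\<close>

lemma high_frequency_bound: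
  fixes \<beta> c :: real
  assumes "0 \<le> \<beta>" "0 < c"
  shows "\<exists>C>0. \<forall>t\<ge>0. \<forall>q::int. 0 \<le> q \<longrightarrow>
    2 powr (- (real_of_int q * \<beta>)) * exp (- (c * t * 2 powr (- 2 * real_of_int q))) \<le> C * (1 + t) powr (- \<beta> / 2)"
proof (intro exI conjI allI impI)
  let ?C = "exp c * exp (\<beta> / 2 * (ln (\<beta> / 2 / c) - 1))"
  show "?C > 0" by simp
  fix t :: real and q :: int assume t: "0 \<le> t" and q: "0 \<le> q"
  let ?x = "2 powr (- 2 * real_of_int q)"
  have x: "0 < ?x" "?x \<le> 1" using q powr_mono[of "- 2 * real_of_int q" 0 2] by auto
  have eq: "?x powr (\<beta> / 2) = 2 powr (- (real_of_int q * \<beta>))" by (simp add: powr_powr)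
  have "?x powr (\<beta> / 2) * exp (- (c * t * ?x)) \<le> exp c * (1 + t) powr (- (\<beta> / 2)) * (((1 + t) * ?x) powr (\<beta> / 2) * exp (- (c * ((1 + t) * ?x))))"
    by (rule powr_mult_exp_rescale[OF assms(2) t x])
  also have "\<dots> \<le> exp c * (1 + t) powr (- (\<beta> / 2)) * exp (\<beta> / 2 * (ln (\<beta> / 2 / c) - 1))"
    using assms t x by (intro mult_left_mono powr_mult_exp_le) auto
  finally show "2 powr (- (real_of_int q * \<beta>)) * exp (- (c * t * ?x)) \<le> ?C * (1 + t) powr (- \<beta> / 2)"
    unfolding eq by (simp add: mult_ac)
qed

text \<open>With \<open>v = (1 + t) 4\<^sup>q\<close> the summands are controlled by \<open>min v v\<^sup>-\<^sup>1\<close> to the power \<open>\<sigma>/2\<close>,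
  and a shift of \<open>q\<close> by the integer part of \<open>log\<^sub>4 (1 + t)\<close> makes the sum independent of \<open>t\<close>.\<close>

lemma low_frequency_sum:
  fixes \<sigma> c :: real
  assumes \<sigma>: "0 < \<sigma>" and c: "0 < c"
  shows "\<exists>C>0. \<forall>t\<ge>0.
    (\<integral>\<^sup>+q. (if q < 0 then ennreal (2 powr (real_of_int q * \<sigma>) * exp (- (c * t * 2 powr (2 * real_of_int q)))) else 0) \<partial>count_space UNIV)
    \<le> ennreal (C * (1 + t) powr (- \<sigma> / 2))"
proof -
  obtain S where S: "(\<integral>\<^sup>+j. ennreal (2 powr (- (\<sigma> * \<bar>real_of_int j\<bar>))) \<partial>count_space UNIV) = ennreal S" "0 \<le> S"
    using nn_integral_geometric_int[OF \<sigma>]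
    by (cases "\<integral>\<^sup>+j. ennreal (2 powr (- (\<sigma> * \<bar>real_of_int j\<bar>))) \<partial>count_space UNIV") auto
  \<comment> \<open>The value 1 serves \<open>v <= 1\<close>; the other entry is the maximum of
    \<open>v^\<sigma> exp (- c v)\<close> and serves \<open>v > 1\<close>.\<close>
  define B where "B = max 1 (exp (\<sigma> * (ln (\<sigma> / c) - 1)))"
  have B: "1 \<le> B" unfolding B_def by simp
  let ?C = "exp c * B * 2 powr \<sigma>"
  have term_le: "2 powr (real_of_int q * \<sigma>) * exp (- (c * t * 2 powr (2 * real_of_int q)))
      \<le> ?C * (1 + t) powr (- \<sigma> / 2) * 2 powr (- (\<sigma> * \<bar>real_of_int (q + \<lfloor>log 2 (1 + t) / 2\<rfloor>)\<bar>))"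
    if t: "0 \<le> t" and q: "q < 0" for t and q :: int
  proof -
    let ?x = "2 powr (2 * real_of_int q)"
    let ?j = "q + \<lfloor>log 2 (1 + t) / 2\<rfloor>"
    have x: "0 < ?x" "?x \<le> 1" using q powr_mono[of "2 * real_of_int q" 0 2] by auto
    \<comment> \<open>The exponent before rounding: \<open>log 2 (1 + t) / 2\<close> is the
      logarithm of \<open>1 + t\<close> to base 4, so that \<open>v = 4^e\<close>.\<close>
    define e where "e = real_of_int q + log 2 (1 + t) / 2"
    have "(1 + t) * ?x = 2 powr (log 2 (1 + t)) * ?x" using t by simp
    also have "\<dots> = 2 powr (2 * e)" unfolding powr_add[symmetric] e_def by (simp add: algebra_simps)
    finally have v: "(1 + t) * ?x = 2 powr (2 * e)" .
    have vs: "(2 powr (2 * e)) powr (\<sigma> / 2) = 2 powr (\<sigma> * e)" by (simp add: powr_powr mult.commute)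
    have main: "(2 powr (2 * e)) powr (\<sigma> / 2) * exp (- (c * 2 powr (2 * e))) \<le> B * 2 powr (- (\<sigma> * \<bar>e\<bar>))"
    proof (cases "e \<le> 0")
      case True
      have "2 powr (\<sigma> * e) * exp (- (c * 2 powr (2 * e))) \<le> 2 powr (\<sigma> * e) * 1"
        using c by (intro mult_left_mono) auto
      also have "\<dots> \<le> B * 2 powr (- (\<sigma> * \<bar>e\<bar>))" using True B by simp
      finally show ?thesis unfolding vs .
    next
      case False
      \<comment> \<open>Spending twice the available power, \<open>v^\<sigma>\<close> in place of
        \<open>v^(\<sigma>/2)\<close>, leaves the factor \<open>v^(-\<sigma>/2)\<close> as decay for
        large \<open>v\<close>.\<close>
      have "(2 powr (2 * e)) powr \<sigma> * exp (- (c * 2 powr (2 * e))) \<le> B"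
        using powr_mult_exp_le[of \<sigma> c "2 powr (2 * e)"] \<sigma> c unfolding B_def by simp
      then have "2 powr (- (\<sigma> * e)) * ((2 powr (2 * e)) powr \<sigma> * exp (- (c * 2 powr (2 * e)))) \<le> 2 powr (- (\<sigma> * e)) * B"
        by (rule mult_left_mono) simp
      moreover have "2 powr (\<sigma> * e) = 2 powr (- (\<sigma> * e)) * (2 powr (2 * e)) powr \<sigma>"
        by (simp add: powr_powr powr_add[symmetric] algebra_simps)
      ultimately show ?thesis unfolding vs using False by (simp add: mult_ac)
    qed
    \<comment> \<open>Rounding moves the exponent by less than 1 and costs the factor
      \<open>2 powr \<sigma>\<close>.\<close>
    have "\<bar>real_of_int ?j\<bar> \<le> \<bar>e\<bar> + 1" unfolding e_def by linarith
    then have "\<sigma> * \<bar>real_of_int ?j\<bar> \<le> \<sigma> * (\<bar>e\<bar> + 1)" using \<sigma> by (intro mult_left_mono) auto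
    then have "- (\<sigma> * \<bar>e\<bar>) \<le> \<sigma> + - (\<sigma> * \<bar>real_of_int ?j\<bar>)" by (simp add: algebra_simps)
    then have "2 powr (- (\<sigma> * \<bar>e\<bar>)) \<le> 2 powr (\<sigma> + - (\<sigma> * \<bar>real_of_int ?j\<bar>))" by (intro powr_mono) auto
    then have j: "2 powr (- (\<sigma> * \<bar>e\<bar>)) \<le> 2 powr \<sigma> * 2 powr (- (\<sigma> * \<bar>real_of_int ?j\<bar>))" by (simp only: powr_add)
    have "2 powr (real_of_int q * \<sigma>) = ?x powr (\<sigma> / 2)" by (simp add: powr_powr)
    then have "2 powr (real_of_int q * \<sigma>) * exp (- (c * t * ?x)) \<le> exp c * (1 + t) powr (- (\<sigma> / 2)) * ((2 powr (2 * e)) powr (\<sigma> / 2) * exp (- (c * 2 powr (2 * e))))"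
      using powr_mult_exp_rescale[OF c t x, of "\<sigma> / 2"] unfolding v by simp
    also have "\<dots> \<le> exp c * (1 + t) powr (- (\<sigma> / 2)) * (B * (2 powr \<sigma> * 2 powr (- (\<sigma> * \<bar>real_of_int ?j\<bar>))))"
      using B by (intro mult_left_mono order_trans[OF main] j) auto
    finally show ?thesis by (simp add: mult_ac)
  qed
  show ?thesis
  proof (intro exI[of _ "?C * (S + 1)"] conjI allI impI)
    show "?C * (S + 1) > 0" using B S(2) by simp
    fix t :: real assume t: "0 \<le> t"
    let ?m = "\<lfloor>log 2 (1 + t) / 2\<rfloor>"
    let ?D = "?C * (1 + t) powr (- \<sigma> / 2)"
    have D: "0 \<le> ?D" using B by simp
    have "(\<integral>\<^sup>+q. (if q < 0 then ennreal (2 powr (real_of_int q * \<sigma>) * exp (- (c * t * 2 powr (2 * real_of_int q)))) else 0) \<partial>count_space UNIV)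
        \<le> (\<integral>\<^sup>+q. ennreal ?D * ennreal (2 powr (- (\<sigma> * \<bar>real_of_int (q + ?m)\<bar>))) \<partial>count_space UNIV)"
      using D term_le[OF t] by (intro nn_integral_mono) (auto simp only: ennreal_mult[symmetric] powr_ge_zero zero_le intro!: ennreal_leI split: if_splits)
    also have "\<dots> = ennreal ?D * (\<integral>\<^sup>+q. ennreal (2 powr (- (\<sigma> * \<bar>real_of_int (q + ?m)\<bar>))) \<partial>count_space UNIV)"
      by (rule nn_integral_cmult) simp
    also have "(\<integral>\<^sup>+q. ennreal (2 powr (- (\<sigma> * \<bar>real_of_int (q + ?m)\<bar>))) \<partial>count_space UNIV) = ennreal S"
      unfolding S(1)[symmetric]
      by (rule nn_integral_bij_count_space[where f = "\<lambda>j. ennreal (2 powr (- (\<sigma> * \<bar>real_of_int j\<bar>)))"])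
         (rule bij_betw_byWitness[where f' = "\<lambda>j. j - ?m"], auto)
    also have "ennreal ?D * ennreal S = ennreal (?D * S)" using D S(2) by (simp add: ennreal_mult)
    also have "\<dots> \<le> ennreal (?C * (S + 1) * (1 + t) powr (- \<sigma> / 2))"
    proof (rule ennreal_leI)
      have "?D * S \<le> ?D * (S + 1)" using D by (intro mult_left_mono) auto
      then show "?D * S \<le> ?C * (S + 1) * (1 + t) powr (- \<sigma> / 2)" by (simp only: mult_ac)
    qed
    finally show "(\<integral>\<^sup>+q. (if q < 0 then ennreal (2 powr (real_of_int q * \<sigma>) * exp (- (c * t * 2 powr (2 * real_of_int q)))) else 0) \<partial>count_space UNIV)
        \<le> ennreal (?C * (S + 1) * (1 + t) powr (- \<sigma> / 2))" .
  qed
qed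


subsection \<open>The decay estimate\<close>

theorem corollary1p1:
  fixes \<phi> :: "real^'n::finite \<Rightarrow> real"
    and s \<rho> r l :: real
    and \<alpha> :: ennreal
  assumes "lp_cutoff \<phi>"
    and "s + \<rho> > 0"
    and "1 \<le> \<alpha>"
    and "(1 \<le> r \<and> r < 2 \<and> l > real CARD('n) * (1 / r - 1 / 2)) \<or> (r = 2 \<and> l \<ge> 0)"
  shows "\<exists>C>0. \<forall>F \<in> besov_space \<phi> (s + l) (ennreal r) \<alpha> \<inter> besov_space \<phi> (- \<rho>) 2 \<infinity>. \<forall>t\<ge>0.
    lr_norm \<alpha> (\<lambda>q. ennreal (2 powr (real_of_int q * s)) *
        distr_Lp_norm 2 (distr_mult (\<lambda>\<xi>. exp (- eta \<xi> * t)) (distr_fourier (lp_block \<phi> q F))))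
    \<le> ennreal C *
      (ennreal ((1 + t) powr (- (s + \<rho>) / 2)) * besov_norm \<phi> (- \<rho>) 2 \<infinity> F
       + ennreal ((1 + t) powr (- l / 2 + real CARD('n) / 2 * (1 / r - 1 / 2)))
           * besov_norm \<phi> (s + l) (ennreal r) \<alpha> F)"
proof -
  let ?n = "real CARD('n)"
  let ?c = "1 / 6400 :: real"
  \<comment> \<open>The derivatives left after the passage from L^r to L^2; at high frequencies they
    determine the rate in \<open>t\<close>.\<close>
  let ?\<beta> = "l - ?n * (1 / r - 1 / 2)"
  have r: "1 \<le> r" "r \<le> 2" and \<beta>: "0 \<le> ?\<beta>" using assms(4) by auto
  let ?E = "\<lambda>t q. exp (- (t / 6400 * 2 powr (- 2 * \<bar>real_of_int q\<bar>)))"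
  let ?D = "\<lambda>q F t. distr_Lp_norm 2 (distr_mult (\<lambda>\<xi>. exp (- eta \<xi> * t)) (distr_fourier (lp_block \<phi> q F)))"
  obtain C2 where C2: "C2 > 0" "\<And>q F t. 0 \<le> t \<Longrightarrow> ?D q F t
      \<le> ennreal (C2 * ?E t q * 2 powr (real_of_int q * (?n * (1 / 2 - 1 / 2)))) * distr_Lp_norm (ennreal 2) (lp_block \<phi> q F)"
    using block_estimate[OF assms(1), of 2] by auto
  obtain Cr where Cr: "Cr > 0" "\<And>q F t. 0 \<le> t \<Longrightarrow> ?D q F t
      \<le> ennreal (Cr * ?E t q * 2 powr (real_of_int q * (?n * (1 / r - 1 / 2)))) * distr_Lp_norm (ennreal r) (lp_block \<phi> q F)"
    using block_estimate[OF assms(1) r] by auto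
  obtain Cl where Cl: "Cl > 0" "\<And>t. 0 \<le> t \<Longrightarrow>
      (\<integral>\<^sup>+q. (if q < 0 then ennreal (2 powr (real_of_int q * (s + \<rho>)) * exp (- (?c * t * 2 powr (2 * real_of_int q)))) else 0) \<partial>count_space UNIV)
      \<le> ennreal (Cl * (1 + t) powr (- (s + \<rho>) / 2))"
    using low_frequency_sum[OF assms(2), of ?c] by auto
  obtain Ch where Ch: "Ch > 0" "\<And>t q. 0 \<le> t \<Longrightarrow> 0 \<le> q \<Longrightarrow>
      2 powr (- (real_of_int q * ?\<beta>)) * exp (- (?c * t * 2 powr (- 2 * real_of_int q))) \<le> Ch * (1 + t) powr (- ?\<beta> / 2)"
    using high_frequency_bound[OF \<beta>, of ?c] by auto
  show ?thesis
  proof (intro exI[of _ "2 * (C2 * Cl + Cr * Ch)"] conjI ballI allI impI)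
    show "0 < 2 * (C2 * Cl + Cr * Ch)" using C2(1) Cr(1) Cl(1) Ch(1) by (simp add: add_pos_pos)
    fix F and t :: real
    assume t: "0 \<le> t"
    let ?N2 = "besov_norm \<phi> (- \<rho>) 2 \<infinity> F"
    let ?Nr = "besov_norm \<phi> (s + l) (ennreal r) \<alpha> F"
    let ?b = "\<lambda>q. ennreal (2 powr (real_of_int q * (s + l))) * distr_Lp_norm (ennreal r) (lp_block \<phi> q F)"
    let ?low = "\<lambda>q. (if q < 0 then ennreal (2 powr (real_of_int q * (s + \<rho>)) * exp (- (?c * t * 2 powr (2 * real_of_int q)))) else 0)"
    let ?tl = "(1 + t) powr (- (s + \<rho>) / 2)"
    let ?th = "(1 + t) powr (- l / 2 + ?n / 2 * (1 / r - 1 / 2))"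
    have th: "(1 + t) powr (- ?\<beta> / 2) = ?th" by (rule arg_cong[where f = "\<lambda>e. (1 + t) powr e"]) (simp add: field_simps)
    \<comment> \<open>The weight is split as \<open>2^(q(s+\<rho>)) 2^(-q \<rho>)\<close>: the
      second factor is absorbed by the supremum norm of the datum, the first remains to be
      summed.\<close>
    have low: "ennreal (2 powr (real_of_int q * s)) * ?D q F t \<le> (ennreal C2 * ?low q) * ?N2" if q: "q < 0" for q
    proof -
      let ?T = "distr_Lp_norm 2 (lp_block \<phi> q F)"
      have N2: "ennreal (2 powr (real_of_int q * - \<rho>)) * ?T \<le> ?N2"
        unfolding besov_norm_def lr_norm_infinity by (rule SUP_upper) simp
      have e: "?E t q = exp (- (?c * t * 2 powr (2 * real_of_int q)))" using q by simp
      have "ennreal (2 powr (real_of_int q * s)) * ?D q F t \<le> ennreal (2 powr (real_of_int q * s)) * (ennreal (C2 * ?E t q) * ?T)"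
        using C2(2)[OF t, of q F] by (intro mult_left_mono) auto
      also have "\<dots> = ennreal (2 powr (real_of_int q * s) * (C2 * ?E t q)) * ?T"
        using C2(1) by (simp add: ennreal_mult mult.assoc)
      also have "2 powr (real_of_int q * s) * (C2 * ?E t q) =
          (C2 * (2 powr (real_of_int q * (s + \<rho>)) * ?E t q)) * 2 powr (real_of_int q * - \<rho>)"
      proof -
        have "2 powr (real_of_int q * s) = 2 powr (real_of_int q * (s + \<rho>)) * 2 powr (real_of_int q * - \<rho>)"
          unfolding powr_add[symmetric] by (simp add: algebra_simps)
        then show ?thesis by (simp only: ac_simps)
      qed
      also have "ennreal \<dots> * ?T = ennreal (C2 * (2 powr (real_of_int q * (s + \<rho>)) * ?E t q)) * (ennreal (2 powr (real_of_int q * - \<rho>)) * ?T)"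
        using C2(1) by (subst ennreal_mult) (simp_all add: mult.assoc)
      also have "\<dots> \<le> ennreal (C2 * (2 powr (real_of_int q * (s + \<rho>)) * ?E t q)) * ?N2"
        by (intro mult_left_mono N2) simp
      also have "\<dots> = (ennreal C2 * ?low q) * ?N2"
        unfolding e using C2(1) q by (simp add: ennreal_mult)
      finally show ?thesis .
    qed
    \<comment> \<open>The product of \<open>2^(qs)\<close> and the factor
      \<open>2^(qn(1/r-1/2))\<close> equals \<open>2^(-q \<beta>) 2^(q(s+l))\<close>; the last
      factor restores the Besov weight, so the \<open>\<alpha>\<close>-summability of the datum is
      kept.\<close>
    have high: "ennreal (2 powr (real_of_int q * s)) * ?D q F t \<le> ennreal (Cr * Ch * ?th) * ?b q" if q: "0 \<le> q" for q
    proof -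
      let ?T = "distr_Lp_norm (ennreal r) (lp_block \<phi> q F)"
      have e: "?E t q = exp (- (?c * t * 2 powr (- 2 * real_of_int q)))" using q by simp
      have "ennreal (2 powr (real_of_int q * s)) * ?D q F t
          \<le> ennreal (2 powr (real_of_int q * s)) * (ennreal (Cr * ?E t q * 2 powr (real_of_int q * (?n * (1 / r - 1 / 2)))) * ?T)"
        by (intro mult_left_mono Cr(2)[OF t]) simp
      also have "\<dots> = ennreal (2 powr (real_of_int q * s) * (Cr * ?E t q * 2 powr (real_of_int q * (?n * (1 / r - 1 / 2))))) * ?T"
        unfolding mult.assoc[symmetric] using Cr(1) by (subst ennreal_mult[symmetric]) (simp_all add: mult.assoc)
      also have "2 powr (real_of_int q * s) * (Cr * ?E t q * 2 powr (real_of_int q * (?n * (1 / r - 1 / 2))))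
          = Cr * (2 powr (- (real_of_int q * ?\<beta>)) * ?E t q) * 2 powr (real_of_int q * (s + l))"
      proof -
        have "2 powr (real_of_int q * s) * 2 powr (real_of_int q * (?n * (1 / r - 1 / 2)))
            = 2 powr (- (real_of_int q * ?\<beta>)) * 2 powr (real_of_int q * (s + l))"
          unfolding powr_add[symmetric] by (simp add: algebra_simps)
        moreover have "A * (c * e * B) = c * (G * e) * H" if "A * B = G * H" for A B G H c e :: real
        proof -
          have "A * (c * e * B) = c * e * (A * B)" by simp
          also have "\<dots> = c * (G * e) * H" unfolding that by simp
          finally show ?thesis .
        qed
        ultimately show ?thesis by blast
      qed
      also have "ennreal \<dots> * ?T = ennreal (Cr * (2 powr (- (real_of_int q * ?\<beta>)) * ?E t q)) * ?b q"
        using Cr(1) by (subst ennreal_mult) (simp_all add: mult.assoc)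
      also have "\<dots> \<le> ennreal (Cr * (Ch * (1 + t) powr (- ?\<beta> / 2))) * ?b q"
        unfolding e using Cr(1) by (intro mult_right_mono ennreal_leI mult_left_mono Ch(2)[OF t q]) auto
      finally show ?thesis unfolding th by (simp add: mult.assoc)
    qed
    \<comment> \<open>The block \<open>q = 0\<close> is counted among the high frequencies.\<close>
    have "lr_norm \<alpha> (\<lambda>q. ennreal (2 powr (real_of_int q * s)) * ?D q F t)
        \<le> lr_norm \<alpha> (\<lambda>q. if q < 0 then (ennreal C2 * ?low q) * ?N2 else ennreal (Cr * Ch * ?th) * ?b q)"
      using low high by (intro lr_norm_mono[OF assms(3)]) (simp del: if_cancel)
    also have "\<dots> \<le> ennreal 2 * (lr_norm \<alpha> (\<lambda>q. (ennreal C2 * ?low q) * ?N2) + lr_norm \<alpha> (\<lambda>q. ennreal (Cr * Ch * ?th) * ?b q))"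
      by (rule lr_norm_split_le[OF assms(3)])
    also have "\<dots> \<le> ennreal 2 * (ennreal (C2 * Cl * ?tl) * ?N2 + ennreal (Cr * Ch * ?th) * ?Nr)"
    proof (intro mult_left_mono add_mono)
      \<comment> \<open>At low frequencies the norm of the datum no longer depends on
        \<open>q\<close>, so it factors out and the scalar sum bounds the norm for every
        \<open>\<alpha>\<close>.\<close>
      have "lr_norm \<alpha> (\<lambda>q. (ennreal C2 * ?low q) * ?N2) \<le> (\<integral>\<^sup>+q. (ennreal C2 * ?low q) * ?N2 \<partial>count_space UNIV)"
        by (rule lr_norm_le_nn_integral[OF assms(3)])
      also have "\<dots> = (ennreal C2 * (\<integral>\<^sup>+q. ?low q \<partial>count_space UNIV)) * ?N2"
        by (subst nn_integral_multc, simp, subst nn_integral_cmult, simp_all)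
      also have "\<dots> \<le> (ennreal C2 * ennreal (Cl * ?tl)) * ?N2"
        by (intro mult_right_mono mult_left_mono Cl(2)[OF t]) auto
      also have "\<dots> = ennreal (C2 * Cl * ?tl) * ?N2"
        using C2(1) Cl(1) by (simp add: ennreal_mult[symmetric] mult.assoc)
      finally show "lr_norm \<alpha> (\<lambda>q. (ennreal C2 * ?low q) * ?N2) \<le> ennreal (C2 * Cl * ?tl) * ?N2" .
      show "lr_norm \<alpha> (\<lambda>q. ennreal (Cr * Ch * ?th) * ?b q) \<le> ennreal (Cr * Ch * ?th) * ?Nr"
        unfolding besov_norm_def using Cr(1) Ch(1) t by (subst lr_norm_cmult[OF assms(3)]) simp_all
    qed simp
    also have "\<dots> \<le> ennreal 2 * (ennreal ((C2 * Cl + Cr * Ch) * ?tl) * ?N2 + ennreal ((C2 * Cl + Cr * Ch) * ?th) * ?Nr)"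
      using C2(1) Cl(1) Cr(1) Ch(1)
      by (intro mult_left_mono add_mono mult_right_mono ennreal_leI) auto
    also have "\<dots> = ennreal (2 * (C2 * Cl + Cr * Ch)) * (ennreal ?tl * ?N2 + ennreal ?th * ?Nr)"
    proof -
      have p: "0 \<le> C2 * Cl + Cr * Ch" using C2(1) Cl(1) Cr(1) Ch(1) by simp
      have "ennreal ((C2 * Cl + Cr * Ch) * x) = ennreal (C2 * Cl + Cr * Ch) * ennreal x" if "0 \<le> x" for x
        using p that by (rule ennreal_mult)
      moreover have "ennreal (2 * (C2 * Cl + Cr * Ch)) = ennreal 2 * ennreal (C2 * Cl + Cr * Ch)"
        using p by (intro ennreal_mult) simp
      ultimately show ?thesis by (simp only: powr_ge_zero distrib_left mult.assoc)
    qed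
    finally show "lr_norm \<alpha> (\<lambda>q. ennreal (2 powr (real_of_int q * s)) * ?D q F t)
        \<le> ennreal (2 * (C2 * Cl + Cr * Ch)) * (ennreal ?tl * ?N2 + ennreal ?th * ?Nr)" .
  qed
qed

end
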